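(* Let $G$ be a locally compact group, $(\alpha,\mathcal H)$ a $G$-groupoid, $\chi\in Z^2(G\ltimes_\alpha\mathcal H;U(1))$ and $\sigma:=\chi|_{\mathcal H}\in Z^2(\mathcal H;U(1))$ (restriction along $\gamma\mapsto(1,\gamma)$). Put $\mathcal L:=G\rtimes_q(G\ltimes_\alpha\mathcal H)$, a $G$-groupoid under left translation $\tau$ in its first $G$-variable. View $\chi$ also as a 2-cocycle on $\mathcal L$ that is constant in the first $G$-variable, and as a 2-cocycle on $G\ltimes_\tau\mathcal L$ that is constant in the first two $G$-variables. Then: (1) The Morita equivalence $\mathcal L\simeq\mathcal H$ (with bimodule $W$ described in the context) extends to a Morita equivalence of $U(1)$-gerbes $$U(1)\rtimes^\chi\big(G\rtimes_q(G\ltimes_\alpha\mathcal H)\big)\simeq U(1)\rtimes^\sigma\mathcal H .$$ (2) The Morita equivalence $G\ltimes_\tau\mathcal L\simeq G\ltimes_\alpha\mathcal H$ induced from the $G$-equivariance of $W$ (with bimodule $G\times W$) extends to a Morita equivalence of $U(1)$-gerbes $$U(1)\rtimes^\chi\big(G\ltimes_\tau(G\rtimes_q(G\ltimes_\alpha\mathcal H))\big)\simeq U(1)\rtimes^\chi(G\ltimes_\alpha\mathcal H).$$ (3) The first equivalence is a subequivalence of the second.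
   Context: A groupoid $\mathcal G=(\mathcal G_1\rightrightarrows\mathcal G_0)$ is a topological groupoid with source $s$ and range $r$ (the product $\gamma_1\gamma_2$ is defined when $s\gamma_1=r\gamma_2$), whose arrow space is locally compact Hausdorff and second countable, equipped with a left Haar system. A $G$-groupoid is a groupoid with a continuous left $G$-action on arrows commuting with all structure maps and leaving the Haar system invariant. A Morita equivalence $(\mathcal G$-$\mathcal H)$-bimodule is a space $P$ with commuting free and proper left $\mathcal G$- and right $\mathcal H$-actions (along moment maps to $\mathcal G_0$, $\mathcal H_0$) such that the moment maps induce homeomorphisms $P/\mathcal H\cong\mathcal G_0$ and $\mathcal G\backslash P\cong\mathcal H_0$. It is $G$-equivariant if $G$ acts on $P$ with $g(\gamma p\eta)=g(\gamma)g(p)g(\eta)$. $G\ltimes_\alpha\mathcal H=(G\times\mathcal H_1\rightrightarrows\mathcal H_0)$ has $s(g,\gamma)=s(g^{-1}\gamma)$, $r(g,\gamma)=r\gamma$, $(g,\gamma)(g',g^{-1}\gamma')=(gg',\gamma\gamma')$; the same formulas define $G\ltimes_\tau\mathcal L$. $q:G\ltimes_\alpha\mathcal H\to G$ is $q(h,\gamma)=h$, and $\mathcal L=G\rtimes_q(G\ltimes_\alpha\mathcal H)=(G\times G\times\mathcal H_1\rightrightarrows G\times\mathcal H_0)$ has $s(g,h,\gamma)=(gh,h^{-1}s\gamma)$, $r(g,h,\gamma)=(g,r\gamma)$, $(g,h_1,\gamma_1)(gh_1,h_2,h_1^{-1}\gamma_2)=(g,h_1h_2,\gamma_1\gamma_2)$,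 with $\tau_{g'}(g,h,\gamma)=(g'g,h,\gamma)$. $W=\{(g,g^{-1},\gamma):g\in G,\gamma\in\mathcal H_1\}\subset\mathcal L_1$ (arrows with source in $\{1\}\times\mathcal H_0$) is the $G$-equivariant Morita $(\mathcal L$-$\mathcal H)$-bimodule with left multiplication by $\mathcal L$, right multiplication by $\mathcal H\simeq\{1\}\times\{1\}\times\mathcal H\subset\mathcal L$, and $G$-action $g\cdot(h,h^{-1},\gamma)=(gh,(gh)^{-1},\gamma)$. The induced $(G\ltimes_\tau\mathcal L)$-$(G\ltimes_\alpha\mathcal H)$-bimodule is $G\times W$ with $(g,l)\cdot(g',w)=(gg',l\,(gw))$, $(g',w)\cdot(g'',\eta)=(g'g'',w\,(g'\eta))$. For a groupoid $\mathcal G$, $Z^2(\mathcal G;U(1))$ is the group of continuous normalized $\chi:\mathcal G_2\to U(1)$ with $\chi(\gamma_2,\gamma_3)\chi(\gamma_1,\gamma_2\gamma_3)=\chi(\gamma_1\gamma_2,\gamma_3)\chi(\gamma_1,\gamma_2)$, and the $U(1)$-gerbe $U(1)\rtimes^\chi\mathcal G=(U(1)\times\mathcal G_1\rightrightarrows\mathcal G_0)$ has product $(\theta_1,\gamma_1)(\theta_2,\gamma_2)=(\theta_1\theta_2\chi(\gamma_1,\gamma_2),\gamma_1\gamma_2)$. A Morita equivalence with bimodule $R$ "extends" to one of $U(1)$-gerbes if there is a Morita bimodule for the gerbes on the space $U(1)\times R$ whose actions cover those on $R$ and in which the central $U(1)$'s act by multiplication on the $U(1)$-factor. "Subequivalence"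 means that restricting the bimodule $U(1)\times G\times W$ of (2) to $U(1)\times\{1\}\times W$, and the acting groupoids to $\{1\}\ltimes\mathcal L$ and $\{1\}\ltimes\mathcal H$ (with their $U(1)$-extensions), recovers the bimodule $U(1)\times W$ of (1). *)

theory Defs
  imports "HOL-Analysis.Analysis"
begin

section \<open>Topological groupoids with Haar system\<close>

text \<open>
  Arrow and unit spaces are subsets of topological types with the subspace topology.
  The composite \<open>cmp K a b\<close> is meaningful only if \<open>src K a = rng K b\<close>;
  \<open>haar K x\<close> is a Borel measure on the whole arrow type, concentrated on the range fibre
  of \<open>x\<close>.
\<close>

record ('a, 'x) groupoid =
  arr :: "'a set"
  obj :: "'x set"
  src :: "'a \<Rightarrow> 'x"
  rng :: "'a \<Rightarrow> 'x"
  idt :: "'x \<Rightarrow> 'a"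
  cmp :: "'a \<Rightarrow> 'a \<Rightarrow> 'a"
  ivt :: "'a \<Rightarrow> 'a"
  haar :: "'x \<Rightarrow> 'a measure"

definition composable :: "('a, 'x) groupoid \<Rightarrow> ('a \<times> 'a) set" where
  "composable K = {(a, b). a \<in> arr K \<and> b \<in> arr K \<and> src K a = rng K b}"

definition topological_groupoid ::
    "('a::topological_space, 'x::topological_space) groupoid \<Rightarrow> bool" where
  "topological_groupoid K \<longleftrightarrow>
     (\<forall>a\<in>arr K. src K a \<in> obj K \<and> rng K a \<in> obj K \<and> ivt K a \<in> arr K) \<and>
     (\<forall>x\<in>obj K. idt K x \<in> arr K \<and> src K (idt K x) = x \<and> rng K (idt K x) = x) \<and>
     (\<forall>(a, b)\<in>composable K. cmp K a b \<in> arr K \<and>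
        src K (cmp K a b) = src K b \<and> rng K (cmp K a b) = rng K a) \<and>
     (\<forall>a b c. (a, b) \<in> composable K \<and> (b, c) \<in> composable K \<longrightarrow>
        cmp K (cmp K a b) c = cmp K a (cmp K b c)) \<and>
     (\<forall>a\<in>arr K. cmp K (idt K (rng K a)) a = a \<and> cmp K a (idt K (src K a)) = a) \<and>
     (\<forall>a\<in>arr K. src K (ivt K a) = rng K a \<and> rng K (ivt K a) = src K a \<and>
        cmp K a (ivt K a) = idt K (rng K a) \<and> cmp K (ivt K a) a = idt K (src K a)) \<and>
     continuous_on (arr K) (src K) \<and>
     continuous_on (arr K) (rng K) \<and>
     continuous_on (obj K) (idt K) \<and>
     continuous_on (composable K) (\<lambda>(a, b). cmp K a b) \<and>
     continuous_on (arr K) (ivt K)"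

definition rfibre :: "('a, 'x) groupoid \<Rightarrow> 'x \<Rightarrow> 'a set" where
  "rfibre K x = {a \<in> arr K. rng K a = x}"

text \<open>Functions in \<open>Cc A\<close> are extended by zero outside of \<open>A\<close>.\<close>

definition Cc :: "'a::topological_space set \<Rightarrow> ('a \<Rightarrow> real) set" where
  "Cc A = {f. continuous_on A f \<and> (\<exists>C. compact C \<and> C \<subseteq> A \<and> (\<forall>a. a \<notin> C \<longrightarrow> f a = 0))}"

text \<open>
  On a second countable locally compact Hausdorff space a Borel measure that is finite on
  compact sets is automatically regular, hence Radon.  The last condition says that left
  multiplication by \<open>a\<close> maps \<open>haar K (src K a)\<close> to \<open>haar K (rng K a)\<close>; it is not written with
  \<open>distr\<close> because \<open>cmp K a b\<close> is unspecified for \<open>b\<close> off the range fibre of \<open>src K a\<close>.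
\<close>

definition left_haar_system :: "('a::topological_space, 'x::topological_space) groupoid \<Rightarrow> bool" where
  "left_haar_system K \<longleftrightarrow>
     (\<forall>x\<in>obj K.
        sets (haar K x) = sets borel \<and>
        (\<forall>C. compact C \<and> C \<subseteq> arr K \<longrightarrow> emeasure (haar K x) C < \<infinity>) \<and>
        (AE a in haar K x. a \<in> rfibre K x) \<and>
        (\<forall>U. open U \<and> U \<inter> rfibre K x \<noteq> {} \<longrightarrow> emeasure (haar K x) U > 0)) \<and>
     (\<forall>f\<in>Cc (arr K). continuous_on (obj K) (\<lambda>x. \<integral>a. f a \<partial>haar K x)) \<and>
     (\<forall>a\<in>arr K. \<forall>B\<in>sets borel.
        emeasure (haar K (src K a)) {b \<in> rfibre K (src K a). cmp K a b \<in> B} =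
        emeasure (haar K (rng K a)) B)"

definition groupoid :: "('a::topological_space, 'x::topological_space) groupoid \<Rightarrow> bool" where
  "groupoid K \<longleftrightarrow>
     topological_groupoid K \<and>
     locally_compact_space (top_of_set (arr K)) \<and>
     Hausdorff_space (top_of_set (arr K)) \<and>
     second_countable (top_of_set (arr K)) \<and>
     left_haar_system K"

section \<open>Groups acting on groupoids, crossed products, skew products\<close>

text \<open>
  The group \<open>G\<close> is a type of class \<open>topological_group_add\<close>.  This class is not commutative:
  \<open>gh\<close>, \<open>g\<^sup>-\<^sup>1\<close>, \<open>1\<close> are written \<open>g + h\<close>, \<open>- g\<close>, \<open>0\<close>, and the order of summands matters.
\<close>

definition left_haar_measure :: "'g::topological_group_add measure \<Rightarrow> bool" where
  "left_haar_measure \<mu> \<longleftrightarrow>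
     sets \<mu> = sets borel \<and>
     emeasure \<mu> UNIV \<noteq> 0 \<and>
     (\<forall>C. compact C \<longrightarrow> emeasure \<mu> C < \<infinity>) \<and>
     (\<forall>g. distr \<mu> borel (\<lambda>h. g + h) = \<mu>)"

definition continuous_action ::
    "'p::topological_space set \<Rightarrow> ('g::topological_group_add \<Rightarrow> 'p \<Rightarrow> 'p) \<Rightarrow> bool" where
  "continuous_action P act \<longleftrightarrow>
     (\<forall>g. \<forall>p\<in>P. act g p \<in> P) \<and>
     (\<forall>p\<in>P. act 0 p = p) \<and>
     (\<forall>g h. \<forall>p\<in>P. act (g + h) p = act g (act h p)) \<and>
     continuous_on (UNIV \<times> P) (\<lambda>(g, p). act g p)"

text \<open>The action on units induced by an action on arrows.\<close>

definition obj_act :: "('a, 'x) groupoid \<Rightarrow> ('g \<Rightarrow> 'a \<Rightarrow> 'a) \<Rightarrow> 'g \<Rightarrow> 'x \<Rightarrow> 'x" where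
  "obj_act K act g x = rng K (act g (idt K x))"

definition G_groupoid ::
    "('a::topological_space, 'x::topological_space) groupoid \<Rightarrow>
     ('g::topological_group_add \<Rightarrow> 'a \<Rightarrow> 'a) \<Rightarrow> bool" where
  "G_groupoid K act \<longleftrightarrow>
     groupoid K \<and>
     continuous_action (arr K) act \<and>
     (\<forall>g. \<forall>a\<in>arr K. src K (act g a) = obj_act K act g (src K a) \<and>
        rng K (act g a) = obj_act K act g (rng K a) \<and>
        act g (ivt K a) = ivt K (act g a)) \<and>
     (\<forall>g. \<forall>x\<in>obj K. act g (idt K x) = idt K (obj_act K act g x)) \<and>
     (\<forall>g. \<forall>(a, b)\<in>composable K. act g (cmp K a b) = cmp K (act g a) (act g b)) \<and>
     (\<forall>g. \<forall>x\<in>obj K. \<forall>B\<in>sets borel.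
        emeasure (haar K x) {a \<in> rfibre K x. act g a \<in> B} =
        emeasure (haar K (obj_act K act g x)) B)"

definition crossed_product ::
    "'g::topological_group_add measure \<Rightarrow> ('a, 'x) groupoid \<Rightarrow> ('g \<Rightarrow> 'a \<Rightarrow> 'a) \<Rightarrow>
     ('g \<times> 'a, 'x) groupoid" where
  "crossed_product \<mu> K act =
     \<lparr> arr = UNIV \<times> arr K,
       obj = obj K,
       src = (\<lambda>(g, a). src K (act (- g) a)),
       rng = (\<lambda>(g, a). rng K a),
       idt = (\<lambda>x. (0, idt K x)),
       cmp = (\<lambda>(g, a) (h, b). (g + h, cmp K a (act g b))),
       ivt = (\<lambda>(g, a). (- g, act (- g) (ivt K a))),
       haar = (\<lambda>x. \<mu> \<Otimes>\<^sub>M haar K x) \<rparr>"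

definition skew_product ::
    "('k \<Rightarrow> 'g::topological_group_add) \<Rightarrow> ('k::topological_space, 'x) groupoid \<Rightarrow>
     ('g \<times> 'k, 'g \<times> 'x) groupoid" where
  "skew_product q K =
     \<lparr> arr = UNIV \<times> arr K,
       obj = UNIV \<times> obj K,
       src = (\<lambda>(g, k). (g + q k, src K k)),
       rng = (\<lambda>(g, k). (g, rng K k)),
       idt = (\<lambda>(g, x). (g, idt K x)),
       cmp = (\<lambda>(g, k) (g', k'). (g, cmp K k k')),
       ivt = (\<lambda>(g, k). (g + q k, ivt K k)),
       haar = (\<lambda>(g, x). distr (haar K x) borel (\<lambda>k. (g, k))) \<rparr>"

definition translation :: "'g::topological_group_add \<Rightarrow> 'g \<times> 'k \<Rightarrow> 'g \<times> 'k" where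
  "translation g = (\<lambda>(g', k). (g + g', k))"

section \<open>Morita equivalence\<close>

text \<open>
  \<open>lact P k p\<close> is meaningful only if \<open>src K k = lmom P p\<close>, and \<open>ract P p h\<close> only if
  \<open>rmom P p = rng H h\<close>.
\<close>

record ('p, 'a, 'x, 'b, 'y) bimodule =
  pts :: "'p set"
  lmom :: "'p \<Rightarrow> 'x"
  rmom :: "'p \<Rightarrow> 'y"
  lact :: "'a \<Rightarrow> 'p \<Rightarrow> 'p"
  ract :: "'p \<Rightarrow> 'b \<Rightarrow> 'p"

definition lpairs :: "('a, 'x) groupoid \<Rightarrow> ('p, 'a, 'x, 'b, 'y) bimodule \<Rightarrow> ('a \<times> 'p) set" where
  "lpairs K P = {(k, p). k \<in> arr K \<and> p \<in> pts P \<and> src K k = lmom P p}"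

definition rpairs :: "('b, 'y) groupoid \<Rightarrow> ('p, 'a, 'x, 'b, 'y) bimodule \<Rightarrow> ('p \<times> 'b) set" where
  "rpairs H P = {(p, h). p \<in> pts P \<and> h \<in> arr H \<and> rmom P p = rng H h}"

definition left_action ::
    "('a::topological_space, 'x::topological_space) groupoid \<Rightarrow>
     ('p::topological_space, 'a, 'x, 'b, 'y) bimodule \<Rightarrow> bool" where
  "left_action K P \<longleftrightarrow>
     lmom P ` pts P \<subseteq> obj K \<and>
     (\<forall>(k, p)\<in>lpairs K P. lact P k p \<in> pts P \<and> lmom P (lact P k p) = rng K k) \<and>
     (\<forall>p\<in>pts P. lact P (idt K (lmom P p)) p = p) \<and>
     (\<forall>k k' p. (k, k') \<in> composable K \<and> (k', p) \<in> lpairs K P \<longrightarrow>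
        lact P (cmp K k k') p = lact P k (lact P k' p)) \<and>
     continuous_on (pts P) (lmom P) \<and>
     continuous_on (lpairs K P) (\<lambda>(k, p). lact P k p)"

definition right_action ::
    "('b::topological_space, 'y::topological_space) groupoid \<Rightarrow>
     ('p::topological_space, 'a, 'x, 'b, 'y) bimodule \<Rightarrow> bool" where
  "right_action H P \<longleftrightarrow>
     rmom P ` pts P \<subseteq> obj H \<and>
     (\<forall>(p, h)\<in>rpairs H P. ract P p h \<in> pts P \<and> rmom P (ract P p h) = src H h) \<and>
     (\<forall>p\<in>pts P. ract P p (idt H (rmom P p)) = p) \<and>
     (\<forall>p h h'. (p, h) \<in> rpairs H P \<and> (h, h') \<in> composable H \<longrightarrow>
        ract P p (cmp H h h') = ract P (ract P p h) h') \<and>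
     continuous_on (pts P) (rmom P) \<and>
     continuous_on (rpairs H P) (\<lambda>(p, h). ract P p h)"

definition commuting_actions ::
    "('a, 'x) groupoid \<Rightarrow> ('b, 'y) groupoid \<Rightarrow> ('p, 'a, 'x, 'b, 'y) bimodule \<Rightarrow> bool" where
  "commuting_actions K H P \<longleftrightarrow>
     (\<forall>(k, p)\<in>lpairs K P. rmom P (lact P k p) = rmom P p) \<and>
     (\<forall>(p, h)\<in>rpairs H P. lmom P (ract P p h) = lmom P p) \<and>
     (\<forall>k p h. (k, p) \<in> lpairs K P \<and> (p, h) \<in> rpairs H P \<longrightarrow>
        ract P (lact P k p) h = lact P k (ract P p h))"

definition free_proper_left ::
    "('a::topological_space, 'x) groupoid \<Rightarrow>
     ('p::topological_space, 'a, 'x, 'b, 'y) bimodule \<Rightarrow> bool" where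
  "free_proper_left K P \<longleftrightarrow>
     (\<forall>(k, p)\<in>lpairs K P. lact P k p = p \<longrightarrow> k = idt K (lmom P p)) \<and>
     proper_map (top_of_set (lpairs K P)) (top_of_set (pts P \<times> pts P))
       (\<lambda>(k, p). (lact P k p, p))"

definition free_proper_right ::
    "('b::topological_space, 'y) groupoid \<Rightarrow>
     ('p::topological_space, 'a, 'x, 'b, 'y) bimodule \<Rightarrow> bool" where
  "free_proper_right H P \<longleftrightarrow>
     (\<forall>(p, h)\<in>rpairs H P. ract P p h = p \<longrightarrow> h = idt H (rmom P p)) \<and>
     proper_map (top_of_set (rpairs H P)) (top_of_set (pts P \<times> pts P))
       (\<lambda>(p, h). (p, ract P p h))"

definition lorbit :: "('a, 'x) groupoid \<Rightarrow> ('p, 'a, 'x, 'b, 'y) bimodule \<Rightarrow> 'p \<Rightarrow> 'p set" where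
  "lorbit K P p = {lact P k p | k. (k, p) \<in> lpairs K P}"

definition rorbit :: "('b, 'y) groupoid \<Rightarrow> ('p, 'a, 'x, 'b, 'y) bimodule \<Rightarrow> 'p \<Rightarrow> 'p set" where
  "rorbit H P p = {ract P p h | h. (p, h) \<in> rpairs H P}"

definition quotient_space :: "'p::topological_space set \<Rightarrow> ('p \<Rightarrow> 'c) \<Rightarrow> 'c topology" where
  "quotient_space P c =
     topology (\<lambda>V. V \<subseteq> c ` P \<and> openin (top_of_set P) {p \<in> P. c p \<in> V})"

lemma istopology_quotient_space:
  "istopology (\<lambda>V. V \<subseteq> c ` P \<and> openin (top_of_set P) {p \<in> P. c p \<in> V})"
proof -
  have "{p \<in> P. c p \<in> V \<inter> V'} = {p \<in> P. c p \<in> V} \<inter> {p \<in> P. c p \<in> V'}" for V V'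
    by auto
  moreover have "{p \<in> P. c p \<in> \<Union>\<V>} = \<Union>((\<lambda>V. {p \<in> P. c p \<in> V}) ` \<V>)" for \<V>
    by auto
  ultimately show ?thesis
    unfolding istopology_def by (auto intro!: openin_Int openin_Union)
qed

text \<open>The map \<open>m\<close> descends to a homeomorphism from the quotient of \<open>P\<close> by \<open>c\<close> onto \<open>B\<close>.\<close>

definition induces_homeomorphism ::
    "'p::topological_space set \<Rightarrow> ('p \<Rightarrow> 'c) \<Rightarrow> ('p \<Rightarrow> 'x::topological_space) \<Rightarrow> 'x set \<Rightarrow> bool" where
  "induces_homeomorphism P c m B \<longleftrightarrow>
     (\<exists>f. homeomorphic_map (quotient_space P c) (top_of_set B) f \<and> (\<forall>p\<in>P. f (c p) = m p))"

definition morita_equivalence ::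
    "('a::topological_space, 'x::topological_space) groupoid \<Rightarrow>
     ('b::topological_space, 'y::topological_space) groupoid \<Rightarrow>
     ('p::topological_space, 'a, 'x, 'b, 'y) bimodule \<Rightarrow> bool" where
  "morita_equivalence K H P \<longleftrightarrow>
     groupoid K \<and> groupoid H \<and>
     left_action K P \<and> right_action H P \<and> commuting_actions K H P \<and>
     free_proper_left K P \<and> free_proper_right H P \<and>
     induces_homeomorphism (pts P) (rorbit H P) (lmom P) (obj K) \<and>
     induces_homeomorphism (pts P) (lorbit K P) (rmom P) (obj H)"

definition equivariant_bimodule ::
    "('a, 'x) groupoid \<Rightarrow> ('g::topological_group_add \<Rightarrow> 'a \<Rightarrow> 'a) \<Rightarrow>
     ('b, 'y) groupoid \<Rightarrow> ('g \<Rightarrow> 'b \<Rightarrow> 'b) \<Rightarrow>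
     ('p::topological_space, 'a, 'x, 'b, 'y) bimodule \<Rightarrow> ('g \<Rightarrow> 'p \<Rightarrow> 'p) \<Rightarrow> bool" where
  "equivariant_bimodule K actK H actH P actP \<longleftrightarrow>
     continuous_action (pts P) actP \<and>
     (\<forall>g. \<forall>p\<in>pts P. lmom P (actP g p) = obj_act K actK g (lmom P p) \<and>
        rmom P (actP g p) = obj_act H actH g (rmom P p)) \<and>
     (\<forall>g k p h. (k, p) \<in> lpairs K P \<and> (p, h) \<in> rpairs H P \<longrightarrow>
        actP g (ract P (lact P k p) h) =
        ract P (lact P (actK g k) (actP g p)) (actH g h))"

text \<open>
  The bimodule on \<open>G \<times> P\<close> for the crossed products; the moment maps are the ones for which
  \<open>l (g p)\<close> and \<open>p (g' \<eta>)\<close> are defined.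
\<close>

definition induced_bimodule ::
    "('b, 'y) groupoid \<Rightarrow> ('g::topological_group_add \<Rightarrow> 'b \<Rightarrow> 'b) \<Rightarrow>
     ('p, 'a, 'x, 'b, 'y) bimodule \<Rightarrow> ('g \<Rightarrow> 'p \<Rightarrow> 'p) \<Rightarrow>
     ('g \<times> 'p, 'g \<times> 'a, 'x, 'g \<times> 'b, 'y) bimodule" where
  "induced_bimodule H actH P actP =
     \<lparr> pts = UNIV \<times> pts P,
       lmom = (\<lambda>(g', p). lmom P p),
       rmom = (\<lambda>(g', p). obj_act H actH (- g') (rmom P p)),
       lact = (\<lambda>(g, l) (g', p). (g + g', lact P l (actP g p))),
       ract = (\<lambda>(g', p) (g'', \<eta>). (g' + g'', ract P p (actH g' \<eta>))) \<rparr>"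

definition W_bimodule ::
    "'g::topological_group_add measure \<Rightarrow> ('a::topological_space, 'x) groupoid \<Rightarrow> ('g \<Rightarrow> 'a \<Rightarrow> 'a) \<Rightarrow>
     ('g \<times> 'g \<times> 'a, 'g \<times> 'g \<times> 'a, 'g \<times> 'x, 'a, 'x) bimodule" where
  "W_bimodule \<mu> H \<alpha> =
     (let L = skew_product fst (crossed_product \<mu> H \<alpha>) in
      \<lparr> pts = {(g, - g, \<gamma>) | g \<gamma>. \<gamma> \<in> arr H},
        lmom = rng L,
        rmom = (\<lambda>w. snd (src L w)),
        lact = cmp L,
        ract = (\<lambda>w \<eta>. cmp L w (0, 0, \<eta>)) \<rparr>)"

definition W_act :: "'g::topological_group_add \<Rightarrow> 'g \<times> 'g \<times> 'a \<Rightarrow> 'g \<times> 'g \<times> 'a" where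
  "W_act g = (\<lambda>(h, h', \<gamma>). (g + h, - (g + h), \<gamma>))"

section \<open>Cocycles and gerbes\<close>

definition U1 :: "complex set" where
  "U1 = sphere 0 1"

definition U1_haar :: "complex measure" where
  "U1_haar = distr (uniform_measure lborel {0..1}) borel (\<lambda>t. cis (2 * pi * t))"

definition Z2 ::
    "('a::topological_space, 'x) groupoid \<Rightarrow> ('a \<Rightarrow> 'a \<Rightarrow> complex) set" where
  "Z2 K = {\<omega>.
     (\<forall>(a, b)\<in>composable K. \<omega> a b \<in> U1) \<and>
     continuous_on (composable K) (\<lambda>(a, b). \<omega> a b) \<and>
     (\<forall>a\<in>arr K. \<omega> (idt K (rng K a)) a = 1 \<and> \<omega> a (idt K (src K a)) = 1) \<and>
     (\<forall>a b c. (a, b) \<in> composable K \<and> (b, c) \<in> composable K \<longrightarrow>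
        \<omega> b c * \<omega> a (cmp K b c) = \<omega> (cmp K a b) c * \<omega> a b)}"

definition gerbe ::
    "('a \<Rightarrow> 'a \<Rightarrow> complex) \<Rightarrow> ('a, 'x) groupoid \<Rightarrow> (complex \<times> 'a, 'x) groupoid" where
  "gerbe \<omega> K =
     \<lparr> arr = U1 \<times> arr K,
       obj = obj K,
       src = (\<lambda>(\<theta>, a). src K a),
       rng = (\<lambda>(\<theta>, a). rng K a),
       idt = (\<lambda>x. (1, idt K x)),
       cmp = (\<lambda>(\<theta>, a) (\<theta>', b). (\<theta> * \<theta>' * \<omega> a b, cmp K a b)),
       ivt = (\<lambda>(\<theta>, a). (inverse (\<theta> * \<omega> a (ivt K a)), ivt K a)),
       haar = (\<lambda>x. U1_haar \<Otimes>\<^sub>M haar K x) \<rparr>"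

text \<open>
  \<open>E\<close> extends the Morita equivalence \<open>R\<close> to the gerbes.  As the cocycles are normalized, the
  central \<open>U(1)\<close>'s consist of the arrows \<open>(\<theta>, idt K x)\<close> and \<open>(\<theta>, idt H y)\<close>.
\<close>

definition extends_to_gerbes ::
    "('a::topological_space, 'x::topological_space) groupoid \<Rightarrow> ('a \<Rightarrow> 'a \<Rightarrow> complex) \<Rightarrow>
     ('b::topological_space, 'y::topological_space) groupoid \<Rightarrow> ('b \<Rightarrow> 'b \<Rightarrow> complex) \<Rightarrow>
     ('p::topological_space, 'a, 'x, 'b, 'y) bimodule \<Rightarrow>
     (complex \<times> 'p, complex \<times> 'a, 'x, complex \<times> 'b, 'y) bimodule \<Rightarrow> bool" where
  "extends_to_gerbes K \<omega> H \<sigma> R E \<longleftrightarrow>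
     \<omega> \<in> Z2 K \<and> \<sigma> \<in> Z2 H \<and> morita_equivalence K H R \<and>
     morita_equivalence (gerbe \<omega> K) (gerbe \<sigma> H) E \<and>
     pts E = U1 \<times> pts R \<and>
     (\<forall>\<theta>\<in>U1. \<forall>p\<in>pts R. lmom E (\<theta>, p) = lmom R p \<and> rmom E (\<theta>, p) = rmom R p) \<and>
     (\<forall>\<theta>\<in>U1. \<forall>\<theta>'\<in>U1. \<forall>(k, p)\<in>lpairs K R. snd (lact E (\<theta>, k) (\<theta>', p)) = lact R k p) \<and>
     (\<forall>\<theta>\<in>U1. \<forall>\<theta>'\<in>U1. \<forall>(p, h)\<in>rpairs H R. snd (ract E (\<theta>', p) (\<theta>, h)) = ract R p h) \<and>
     (\<forall>\<theta>\<in>U1. \<forall>\<theta>'\<in>U1. \<forall>p\<in>pts R.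
        lact E (\<theta>, idt K (lmom R p)) (\<theta>', p) = (\<theta> * \<theta>', p) \<and>
        ract E (\<theta>', p) (\<theta>, idt H (rmom R p)) = (\<theta>' * \<theta>, p))"

section \<open>Restriction of bimodules\<close>

text \<open>Haar systems are not compared: they do not restrict to subgroupoids.\<close>

definition groupoid_iso ::
    "('a::topological_space, 'x::topological_space) groupoid \<Rightarrow>
     ('b::topological_space, 'y::topological_space) groupoid \<Rightarrow>
     ('a \<Rightarrow> 'b) \<Rightarrow> ('x \<Rightarrow> 'y) \<Rightarrow> bool" where
  "groupoid_iso K K' f f0 \<longleftrightarrow>
     homeomorphic_map (top_of_set (arr K)) (top_of_set (arr K')) f \<and>
     homeomorphic_map (top_of_set (obj K)) (top_of_set (obj K')) f0 \<and>
     (\<forall>a\<in>arr K. src K' (f a) = f0 (src K a) \<and> rng K' (f a) = f0 (rng K a) \<and>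
        ivt K' (f a) = f (ivt K a)) \<and>
     (\<forall>x\<in>obj K. idt K' (f0 x) = f (idt K x)) \<and>
     (\<forall>(a, b)\<in>composable K. cmp K' (f a) (f b) = f (cmp K a b))"

definition bimodule_iso ::
    "('a::topological_space, 'x::topological_space) groupoid \<Rightarrow>
     ('b::topological_space, 'y::topological_space) groupoid \<Rightarrow>
     ('p::topological_space, 'a, 'x, 'b, 'y) bimodule \<Rightarrow>
     ('a'::topological_space, 'x'::topological_space) groupoid \<Rightarrow>
     ('b'::topological_space, 'y'::topological_space) groupoid \<Rightarrow>
     ('p'::topological_space, 'a', 'x', 'b', 'y') bimodule \<Rightarrow>
     ('a \<Rightarrow> 'a') \<Rightarrow> ('x \<Rightarrow> 'x') \<Rightarrow> ('b \<Rightarrow> 'b') \<Rightarrow> ('y \<Rightarrow> 'y') \<Rightarrow> ('p \<Rightarrow> 'p') \<Rightarrow> bool" where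
  "bimodule_iso K H P K' H' P' f f0 h h0 j \<longleftrightarrow>
     groupoid_iso K K' f f0 \<and> groupoid_iso H H' h h0 \<and>
     homeomorphic_map (top_of_set (pts P)) (top_of_set (pts P')) j \<and>
     (\<forall>p\<in>pts P. lmom P' (j p) = f0 (lmom P p) \<and> rmom P' (j p) = h0 (rmom P p)) \<and>
     (\<forall>(a, p)\<in>lpairs K P. lact P' (f a) (j p) = j (lact P a p)) \<and>
     (\<forall>(p, b)\<in>rpairs H P. ract P' (j p) (h b) = j (ract P p b))"

text \<open>
  \<open>E\<close> is a \<open>KE\<close>-\<open>HE\<close>-bimodule and \<open>F\<close> a \<open>KF\<close>-\<open>HF\<close>-bimodule, where \<open>KF\<close>, \<open>HF\<close>, \<open>F\<close> have one
  \<open>G\<close>-variable more, next to the \<open>U(1)\<close>-variable.  Restricting that variable to the neutral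
  element everywhere in \<open>KF\<close>, \<open>HF\<close>, \<open>F\<close> recovers \<open>KE\<close>, \<open>HE\<close>, \<open>E\<close>.
\<close>

definition subequivalence ::
    "(complex \<times> 'a::topological_space, 'x::topological_space) groupoid \<Rightarrow>
     (complex \<times> 'b::topological_space, 'y::topological_space) groupoid \<Rightarrow>
     (complex \<times> 'p::topological_space, complex \<times> 'a, 'x, complex \<times> 'b, 'y) bimodule \<Rightarrow>
     (complex \<times> 'g::topological_group_add \<times> 'a, 'x) groupoid \<Rightarrow>
     (complex \<times> 'g \<times> 'b, 'y) groupoid \<Rightarrow>
     (complex \<times> 'g \<times> 'p, complex \<times> 'g \<times> 'a, 'x, complex \<times> 'g \<times> 'b, 'y) bimodule \<Rightarrow> bool" where
  "subequivalence KE HE E KF HF F \<longleftrightarrow>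
     bimodule_iso KE HE E
       (KF\<lparr>arr := {(\<theta>, g, a). (\<theta>, g, a) \<in> arr KF \<and> g = 0}\<rparr>)
       (HF\<lparr>arr := {(\<theta>, g, b). (\<theta>, g, b) \<in> arr HF \<and> g = 0}\<rparr>)
       (F\<lparr>pts := {(\<theta>, g, p). (\<theta>, g, p) \<in> pts F \<and> g = 0}\<rparr>)
       (\<lambda>(\<theta>, a). (\<theta>, 0, a)) id (\<lambda>(\<theta>, b). (\<theta>, 0, b)) id (\<lambda>(\<theta>, p). (\<theta>, 0, p))"

end

theory Submission
  imports Defs
begin

text \<open>
  An action is free and proper with the fibres of the opposite moment map as
  orbits as soon as the quotient of two points of the same fibre exists, is unique and depends
  continuously on them.  A bimodule with such quotients on both sides and with continuous sections
  of both moment maps is therefore a Morita equivalence (\<open>division_morita_equivalence\<close>), and all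
  four bimodules of the theorem are treated in this way.

  The space \<open>W\<close> consists of the arrows of \<open>L\<close> with source over \<open>0\<close>, so that quotients are products
  \<open>w w'\<^sup>-\<^sup>1\<close> and \<open>w\<^sup>-\<^sup>1 w'\<close> in \<open>L\<close>; the latter begin and end over \<open>0\<close> and thus belong to \<open>\<H>\<close>
  (\<open>W_division_bimodule\<close>).  Quotients for an equivariant bimodule \<open>P\<close> give quotients for \<open>G \<times> P\<close>
  (\<open>induced_division_bimodule\<close>).

  For the gerbes, all arrows and all points are sent to arrows of \<open>G \<ltimes> \<H>\<close>.  The groupoids \<open>L\<close> and
  \<open>G \<ltimes> L\<close> map there by forgetting \<open>G\<close>-variables, \<open>\<H>\<close> is the slice over \<open>0\<close>, and the points map by
  \<open>(h, -h, c) \<mapsto> (-h, c)\<close> and \<open>(g, (h, -h, c)) \<mapsto> (-h + g, c)\<close>.  Both actions become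
  multiplications of arrows of \<open>G \<ltimes> \<H>\<close>, and the cocycles of the theorem are the pullbacks of \<open>chi\<close>.
  Twisting the actions on \<open>U(1) \<times> P\<close> by the values of \<open>chi\<close> on these pairs of arrows turns the two
  associativity laws and the commutation of the two actions into instances of the cocycle identity
  (\<open>gerbe_division_bimodule\<close>).  The second of the two maps of points restricts to the first one at
  \<open>g = 0\<close>; this gives the subequivalence.

  That every groupoid in sight carries a Haar system is a separate matter.  For crossed products and
  gerbes it is a product measure, and invariance is Tonelli's theorem
  (\<open>emeasure_twisted_product\<close>, \<open>product_left_haar_system\<close>); for skew products one has to integrate
  continuously with respect to a parameter in \<open>G\<close> (\<open>Cc_integral_jointly_continuous\<close>).
\<close>

section \<open>Locally compact spaces and Radon measures\<close>

lemma continuous_on_realI: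
  fixes f :: "'a::topological_space \<Rightarrow> real"
  assumes "\<And>x e. x \<in> A \<Longrightarrow> e > 0 \<Longrightarrow> \<exists>U. open U \<and> x \<in> U \<and> (\<forall>y\<in>U \<inter> A. \<bar>f y - f x\<bar> < e)"
  shows "continuous_on A f"
  unfolding continuous_on_def tendsto_iff eventually_at_topological dist_real_def
proof (intro ballI allI impI)
  fix x and e :: real assume "x \<in> A" "0 < e"
  then obtain U where "open U" "x \<in> U" "\<forall>y\<in>U \<inter> A. \<bar>f y - f x\<bar> < e"
    using assms by blast
  then show "\<exists>U. open U \<and> x \<in> U \<and> (\<forall>y\<in>U. y \<noteq> x \<longrightarrow> y \<in> A \<longrightarrow> \<bar>f y - f x\<bar> < e)"
    by blast
qed

lemma Hausdorff_top_of_set: "Hausdorff_space (top_of_set (A :: 'a::t2_space set))"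
proof (rule Hausdorff_space_subtopology)
  show "Hausdorff_space (euclidean :: 'a topology)"
    unfolding Hausdorff_space_def disjnt_def open_openin[symmetric] using hausdorff by blast
qed

lemma locally_compactD:
  assumes "locally_compact_space (top_of_set A)" "x \<in> A"
  obtains U K where "open U" "x \<in> U" "A \<inter> U \<subseteq> K" "compact K" "K \<subseteq> A"
proof -
  obtain U K where "openin (top_of_set A) U" "compactin (top_of_set A) K" "x \<in> U" "U \<subseteq> K"
    using assms unfolding locally_compact_space_def by (metis topspace_euclidean_subtopology)
  then show thesis
    using that unfolding openin_open compactin_subtopology compactin_euclidean_iff by blast
qed

lemma locally_compact_sigma_compact:
  fixes A :: "'a::second_countable_topology set"
  assumes lc: "locally_compact_space (top_of_set A)"
  obtains C :: "nat \<Rightarrow> 'a set" where "\<And>n. compact (C n)" "A = (\<Union>n. C n)"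
proof -
  define F where "F = {S. openin (top_of_set A) S \<and> (\<exists>K. compact K \<and> S \<subseteq> K \<and> K \<subseteq> A)}"
  obtain F' where F': "F' \<subseteq> F" "countable F'" "\<Union>F' = \<Union>F"
    using Lindelof_openin[of F A] unfolding F_def by blast
  have "A \<subseteq> \<Union>F"
  proof
    fix x assume x: "x \<in> A"
    obtain U K where "open U" "x \<in> U" "A \<inter> U \<subseteq> K" "compact K" "K \<subseteq> A"
      using locally_compactD[OF lc x] by blast
    then have "A \<inter> U \<in> F" "x \<in> A \<inter> U"
      using x unfolding F_def openin_open by auto
    then show "x \<in> \<Union>F" by blast
  qed
  have "\<forall>S\<in>F'. \<exists>K. compact K \<and> S \<subseteq> K \<and> K \<subseteq> A"
    using F'(1) unfolding F_def by blast
  then obtain k where k: "\<And>S. S \<in> F' \<Longrightarrow> compact (k S) \<and> S \<subseteq> k S \<and> k S \<subseteq> A"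
    by metis
  define C where "C = from_nat_into (insert {} (k ` F'))"
  have range: "range C = insert {} (k ` F')"
    unfolding C_def by (rule range_from_nat_into) (use F'(2) in auto)
  have "compact (C n)" for n
    using k range by (metis imageE insertE compact_empty rangeI)
  moreover have "A = \<Union>(range C)"
    unfolding range using k F'(3) \<open>A \<subseteq> \<Union>F\<close> by fastforce
  ultimately show thesis
    using that by blast
qed

lemma locally_compact_borel:
  fixes A :: "'a::{t2_space, second_countable_topology} set"
  assumes "locally_compact_space (top_of_set A)"
  shows "A \<in> sets borel"
proof -
  obtain C where C: "\<And>n. compact (C n)" "A = (\<Union>n::nat. C n)"
    using locally_compact_sigma_compact[OF assms] by blast
  show ?thesis
    unfolding C(2) using C(1) by (intro sets.countable_UN) (auto intro: borel_compact)
qed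

lemma locally_compact_Times:
  assumes "locally_compact_space (top_of_set A)" "locally_compact_space (top_of_set B)"
  shows "locally_compact_space (top_of_set (A \<times> B))"
  using assms locally_compact_space_prod_topology[of "top_of_set A" "top_of_set B"] by simp

lemma borel_continuous_preimage:
  assumes "continuous_on T f" "T \<in> sets borel" "S \<in> sets borel"
  shows "{x \<in> T. f x \<in> S} \<in> sets borel"
proof -
  have "f -` S \<inter> space (restrict_space borel T) \<in> sets (restrict_space borel T)"
    using borel_measurable_continuous_on_restrict[OF assms(1)] assms(3) by (rule measurable_sets)
  then have "f -` S \<inter> T \<in> sets borel"
    using assms(2) by (simp add: sets_restrict_space_iff space_restrict_space)
  moreover have "{x \<in> T. f x \<in> S} = f -` S \<inter> T" by auto
  ultimately show ?thesis by simp
qed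

lemma sets_pair_borel:
  fixes M :: "'a::second_countable_topology measure" and N :: "'b::second_countable_topology measure"
  assumes "sets M = sets borel" "sets N = sets borel"
  shows "sets (M \<Otimes>\<^sub>M N) = sets borel"
  using sets_pair_measure_cong[OF assms] unfolding borel_prod .

text \<open>The set \<open>A\<close> need not be the whole type, as arrow spaces are subsets; compact sets are tested
  inside of \<open>A\<close> only, and \<open>M\<close> does not charge the complement.\<close>

definition radon_on :: "'a::topological_space set \<Rightarrow> 'a measure \<Rightarrow> bool" where
  "radon_on A M \<longleftrightarrow> sets M = sets borel \<and>
     (\<forall>C. compact C \<and> C \<subseteq> A \<longrightarrow> emeasure M C < \<infinity>) \<and> (AE a in M. a \<in> A)"

lemma radon_onD:
  assumes "radon_on A M"
  shows "sets M = sets borel" "space M = UNIV"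
    "\<And>C. compact C \<Longrightarrow> C \<subseteq> A \<Longrightarrow> emeasure M C < \<infinity>" "AE a in M. a \<in> A"
  using assms sets_eq_imp_space_eq[of M borel] unfolding radon_on_def by auto

lemma AE_null_setE:
  assumes "AE a in M. P a" "space M = UNIV"
  obtains N where "N \<in> sets M" "emeasure M N = 0" "\<And>a. a \<notin> N \<Longrightarrow> P a"
proof -
  obtain N where N: "{a \<in> space M. \<not> P a} \<subseteq> N" "emeasure M N = 0" "N \<in> sets M"
    using AE_E[OF assms(1)] by blast
  moreover have "P a" if "a \<notin> N" for a
    using N(1) assms(2) that by blast
  ultimately show thesis using that by blast
qed

text \<open>The space \<open>A\<close> is a countable union of compact sets, and its complement is covered by a null
  set.\<close>

lemma radon_on_sigma_finite:
  fixes A :: "'a::{t2_space, second_countable_topology} set"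
  assumes M: "radon_on A M" and lc: "locally_compact_space (top_of_set A)"
  shows "sigma_finite_measure M"
proof -
  note Md = radon_onD[OF M]
  obtain C where C: "\<And>n. compact (C n)" "A = (\<Union>n::nat. C n)"
    using locally_compact_sigma_compact[OF lc] by blast
  obtain N where N: "N \<in> sets M" "emeasure M N = 0" "\<And>a. a \<notin> N \<Longrightarrow> a \<in> A"
    using AE_null_setE[OF Md(4,2)] by blast
  have "C n \<in> sets M" for n
    using C(1) Md(1) borel_compact by blast
  moreover have "emeasure M (C n) \<noteq> \<infinity>" for n
    using Md(3)[of "C n"] C by (auto simp: less_top)
  moreover have "N \<union> (\<Union>n. C n) = UNIV"
    using N(3) C(2) by blast
  ultimately show ?thesis
    unfolding sigma_finite_measure_def using N
    by (intro exI[of _ "insert N (range C)"]) (auto simp: Md(2))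
qed

lemma radon_on_pair:
  fixes A :: "'a::{t2_space, second_countable_topology} set"
    and B :: "'b::{t2_space, second_countable_topology} set"
  assumes M: "radon_on A M" and N: "radon_on B N"
    and lcA: "locally_compact_space (top_of_set A)" and lcB: "locally_compact_space (top_of_set B)"
  shows "radon_on (A \<times> B) (M \<Otimes>\<^sub>M N)"
proof -
  note Md = radon_onD[OF M] and Nd = radon_onD[OF N]
  interpret N: sigma_finite_measure N using radon_on_sigma_finite[OF N lcB] .
  have sets: "sets (M \<Otimes>\<^sub>M N) = sets borel"
    using sets_pair_borel[OF Md(1) Nd(1)] .
  have fin: "emeasure (M \<Otimes>\<^sub>M N) C < \<infinity>" if C: "compact C" "C \<subseteq> A \<times> B" for C
  proof -
    have c: "compact (fst ` C)" "compact (snd ` C)"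
      using C by (auto intro!: compact_continuous_image continuous_intros)
    have cs: "fst ` C \<subseteq> A" "snd ` C \<subseteq> B" using C(2) by auto
    have s: "fst ` C \<in> sets M" "snd ` C \<in> sets N"
      using c borel_compact Md(1) Nd(1) by auto
    have "emeasure (M \<Otimes>\<^sub>M N) C \<le> emeasure (M \<Otimes>\<^sub>M N) (fst ` C \<times> snd ` C)"
      by (rule emeasure_mono) (use s in \<open>auto intro: rev_image_eqI\<close>)
    also have "\<dots> = emeasure M (fst ` C) * emeasure N (snd ` C)"
      using s by (rule N.emeasure_pair_measure_Times)
    also have "\<dots> < \<infinity>"
      using Md(3)[OF c(1) cs(1)] Nd(3)[OF c(2) cs(2)] by (simp add: ennreal_mult_less_top)
    finally show ?thesis .
  qed
  obtain S where S: "S \<in> sets M" "emeasure M S = 0" "\<And>a. a \<notin> S \<Longrightarrow> a \<in> A"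
    using AE_null_setE[OF Md(4,2)] by blast
  obtain T where T: "T \<in> sets N" "emeasure N T = 0" "\<And>a. a \<notin> T \<Longrightarrow> a \<in> B"
    using AE_null_setE[OF Nd(4,2)] by blast
  have U: "UNIV \<in> sets M" "UNIV \<in> sets N"
    using Md(1) Nd(1) by auto
  have "emeasure (M \<Otimes>\<^sub>M N) (S \<times> UNIV \<union> UNIV \<times> T) \<le>
      emeasure (M \<Otimes>\<^sub>M N) (S \<times> UNIV) + emeasure (M \<Otimes>\<^sub>M N) (UNIV \<times> T)"
    using S(1) T(1) U by (intro emeasure_subadditive) auto
  also have "\<dots> = 0"
    using S(1,2) T(1,2) U by (simp add: N.emeasure_pair_measure_Times)
  finally have null: "emeasure (M \<Otimes>\<^sub>M N) (S \<times> UNIV \<union> UNIV \<times> T) = 0" by simp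
  have "x \<in> S \<times> UNIV \<union> UNIV \<times> T" if "x \<notin> A \<times> B" for x
    using S(3)[of "fst x"] T(3)[of "snd x"] that by (auto simp: mem_Times_iff)
  then have "{x \<in> space (M \<Otimes>\<^sub>M N). x \<notin> A \<times> B} \<subseteq> S \<times> UNIV \<union> UNIV \<times> T" by blast
  then have "AE x in M \<Otimes>\<^sub>M N. x \<in> A \<times> B"
    by (rule AE_I[OF _ null]) (use S(1) T(1) U in auto)
  with sets fin show ?thesis
    unfolding radon_on_def by blast
qed

subsection \<open>Compactly supported functions\<close>

lemma Cc_support:
  assumes "f \<in> Cc A"
  obtains C where "compact C" "C \<subseteq> A" "\<And>a. a \<notin> C \<Longrightarrow> f a = 0" "continuous_on A f"
  using assms unfolding Cc_def by blast

lemma Cc_borel_measurable: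
  fixes A :: "'a::t2_space set"
  assumes f: "f \<in> Cc A"
  shows "f \<in> borel_measurable borel"
proof -
  obtain C where C: "compact C" "C \<subseteq> A" "\<And>a. a \<notin> C \<Longrightarrow> f a = 0" "continuous_on A f"
    using Cc_support[OF f] by blast
  have "(\<lambda>x. indicator C x *\<^sub>R f x) \<in> borel_measurable borel"
    using C by (intro borel_measurable_continuous_on_indicator borel_compact)
      (auto intro: continuous_on_subset)
  moreover have "(\<lambda>x. indicator C x *\<^sub>R f x) = f"
    using C(3) by (auto simp: fun_eq_iff indicator_def)
  ultimately show ?thesis by simp
qed

lemma Cc_integrable:
  fixes A :: "'a::t2_space set"
  assumes f: "f \<in> Cc A" and M: "radon_on A M"
  shows "integrable M f"
proof -
  note Md = radon_onD[OF M]
  obtain C where C: "compact C" "C \<subseteq> A" "\<And>a. a \<notin> C \<Longrightarrow> f a = 0" "continuous_on A f"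
    using Cc_support[OF f] by blast
  have meas: "f \<in> borel_measurable M"
    using Cc_borel_measurable[OF f] Md(1) by (simp cong: measurable_cong_sets)
  have cont: "continuous_on C f" using C(2,4) continuous_on_subset by blast
  obtain B where B: "\<And>x. x \<in> C \<Longrightarrow> norm (f x) \<le> B"
    using compact_imp_bounded[OF compact_continuous_image[OF cont C(1)]]
    unfolding bounded_iff by auto
  show ?thesis
    by (rule integrableI_bounded_set[where A = C and B = B])
      (use meas C B Md borel_compact[OF C(1)] in auto)
qed

lemma Cc_slice:
  assumes "f \<in> Cc (A \<times> B)" "a \<in> A"
  shows "(\<lambda>b. f (a, b)) \<in> Cc B"
proof -
  obtain C where C: "compact C" "C \<subseteq> A \<times> B" "\<And>x. x \<notin> C \<Longrightarrow> f x = 0" "continuous_on (A \<times> B) f"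
    using Cc_support[OF assms(1)] by blast
  have "continuous_on B (\<lambda>b. f (a, b))"
    by (rule continuous_on_compose2[OF C(4)]) (use assms in \<open>auto intro!: continuous_intros\<close>)
  moreover have "compact (snd ` C)" "snd ` C \<subseteq> B"
    using C by (auto intro!: compact_continuous_image continuous_intros)
  moreover have "f (a, b) = 0" if "b \<notin> snd ` C" for b
    using that C(3) by force
  ultimately show ?thesis unfolding Cc_def by blast
qed

lemma Cc_swap:
  assumes "f \<in> Cc (A \<times> B)"
  shows "(\<lambda>(b, a). f (a, b)) \<in> Cc (B \<times> A)"
proof -
  obtain C where C: "compact C" "C \<subseteq> A \<times> B" "\<And>x. x \<notin> C \<Longrightarrow> f x = 0" "continuous_on (A \<times> B) f"
    using Cc_support[OF assms] by blast
  have "continuous_on (B \<times> A) (\<lambda>x. f (snd x, fst x))"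
    by (rule continuous_on_compose2[OF C(4)]) (auto intro!: continuous_intros)
  moreover have "compact ((\<lambda>x. (snd x, fst x)) ` C)" "(\<lambda>x. (snd x, fst x)) ` C \<subseteq> B \<times> A"
    using C by (auto intro!: compact_continuous_image continuous_intros)
  moreover have "f (snd x, fst x) = 0" if "x \<notin> (\<lambda>x. (snd x, fst x)) ` C" for x
    using that C(3) by (cases x) force
  ultimately show ?thesis unfolding Cc_def by (auto simp: case_prod_unfold)
qed

text \<open>By the tube lemma, as only the compact projection of the support to \<open>B\<close> matters.\<close>

lemma Cc_uniform:
  assumes f: "f \<in> Cc (A \<times> B)" and a: "a \<in> A" and e: "e > 0"
  obtains U where "open U" "a \<in> U" "\<And>a' b. a' \<in> U \<inter> A \<Longrightarrow> \<bar>f (a', b) - f (a, b)\<bar> \<le> e"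
proof -
  obtain C where C: "compact C" "C \<subseteq> A \<times> B" "\<And>x. x \<notin> C \<Longrightarrow> f x = 0" "continuous_on (A \<times> B) f"
    using Cc_support[OF f] by blast
  have s: "compact (snd ` C)" "snd ` C \<subseteq> B"
    using C by (auto intro!: compact_continuous_image continuous_intros)
  have "continuous_on (A \<times> snd ` C) f"
    by (rule continuous_on_subset[OF C(4)]) (use s in auto)
  then obtain U where U: "a \<in> U" "open U" "\<forall>x\<in>U \<inter> A. \<forall>t\<in>snd ` C. dist (f (x, t)) (f (a, t)) \<le> e"
    using continuous_on_prod_compactE[OF _ s(1) a e] by blast
  have "\<bar>f (a', b) - f (a, b)\<bar> \<le> e" if "a' \<in> U \<inter> A" for a' b
  proof (cases "b \<in> snd ` C")
    case True
    then show ?thesis using U(3) that by (auto simp: dist_real_def)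
  next
    case False
    then have "f (a', b) = 0" "f (a, b) = 0" using C(3) by force+
    then show ?thesis using e by simp
  qed
  then show thesis using that U by blast
qed

text \<open>The functions \<open>f (\<cdot>, b)\<close> vanish off one compact subset of \<open>A\<close>, whose measure bounds the
  difference of two integrals by the uniform distance of the integrands.\<close>

lemma Cc_marginal:
  fixes A :: "'a::t2_space set" and B :: "'b::t2_space set"
  assumes f: "f \<in> Cc (A \<times> B)" and M: "radon_on A M"
  shows "(\<lambda>b. \<integral>a. f (a, b) \<partial>M) \<in> Cc B"
proof -
  obtain C where C: "compact C" "C \<subseteq> A \<times> B" "\<And>x. x \<notin> C \<Longrightarrow> f x = 0" "continuous_on (A \<times> B) f"
    using Cc_support[OF f] by blast
  note Md = radon_onD[OF M]
  have s: "compact (snd ` C)" "snd ` C \<subseteq> B" "compact (fst ` C)" "fst ` C \<subseteq> A"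
    using C by (auto intro!: compact_continuous_image continuous_intros)
  have fs: "fst ` C \<in> sets M" "emeasure M (fst ` C) < \<infinity>"
    using s Md borel_compact by auto
  have f': "(\<lambda>(b, a). f (a, b)) \<in> Cc (B \<times> A)"
    using Cc_swap[OF f] .
  have int: "integrable M (\<lambda>a. f (a, b))" if "b \<in> B" for b
    using Cc_integrable[OF _ M] Cc_slice[OF f' that] by simp
  have "continuous_on B (\<lambda>b. \<integral>a. f (a, b) \<partial>M)"
  proof (rule continuous_on_realI)
    fix b and e :: real assume b: "b \<in> B" and e: "e > 0"
    define m where "m = measure M (fst ` C)"
    define d where "d = e / (m + 1)"
    have m: "m \<ge> 0" unfolding m_def by simp
    have d: "d > 0" "d * m < e"
      using m e unfolding d_def by (auto simp: field_simps)
    obtain U where U: "open U" "b \<in> U"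
        "\<And>b' a. b' \<in> U \<inter> B \<Longrightarrow> \<bar>(\<lambda>(b, a). f (a, b)) (b', a) - (\<lambda>(b, a). f (a, b)) (b, a)\<bar> \<le> d"
      using Cc_uniform[OF f' b d(1)] by blast
    have "\<bar>(\<integral>a. f (a, b') \<partial>M) - (\<integral>a. f (a, b) \<partial>M)\<bar> < e" if b': "b' \<in> U \<inter> B" for b'
    proof -
      have i: "integrable M (\<lambda>a. f (a, b') - f (a, b))"
        using int b b' by auto
      have "\<bar>(\<integral>a. f (a, b') \<partial>M) - (\<integral>a. f (a, b) \<partial>M)\<bar> = \<bar>\<integral>a. f (a, b') - f (a, b) \<partial>M\<bar>"
        using int b b' by (subst Bochner_Integration.integral_diff) auto
      also have "\<dots> \<le> (\<integral>a. \<bar>f (a, b') - f (a, b)\<bar> \<partial>M)"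
        by (rule integral_abs_bound)
      also have "\<dots> \<le> (\<integral>a. d * indicator (fst ` C) a \<partial>M)"
      proof (rule integral_mono)
        show "integrable M (\<lambda>a. \<bar>f (a, b') - f (a, b)\<bar>)"
          using i by (rule integrable_abs)
        show "integrable M (\<lambda>a. d * indicator (fst ` C) a)"
          using fs by (intro integrable_mult_right integrable_real_indicator) auto
        show "\<bar>f (a, b') - f (a, b)\<bar> \<le> d * indicator (fst ` C) a" for a
        proof (cases "a \<in> fst ` C")
          case True then show ?thesis using U(3)[OF b', of a] by simp
        next
          case False
          then have "f (a, b') = 0" "f (a, b) = 0" using C(3) by force+
          then show ?thesis using d by simp
        qed
      qed
      also have "\<dots> = d * m"
        using fs Md(2) unfolding m_def by simp
      finally show ?thesis using d by simp
    qed
    then show "\<exists>U. open U \<and> b \<in> U \<and>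
        (\<forall>y\<in>U \<inter> B. \<bar>(\<integral>a. f (a, y) \<partial>M) - (\<integral>a. f (a, b) \<partial>M)\<bar> < e)"
      using U by blast
  qed
  moreover have "(\<integral>a. f (a, b) \<partial>M) = 0" if "b \<notin> snd ` C" for b
  proof -
    have "f (a, b) = 0" for a using that C(3) by force
    then show ?thesis by simp
  qed
  ultimately show ?thesis
    unfolding Cc_def using s by blast
qed

lemma Cc_integral_pair:
  fixes A :: "'a::{t2_space, second_countable_topology} set"
    and B :: "'b::{t2_space, second_countable_topology} set"
  assumes f: "f \<in> Cc (A \<times> B)" and M: "radon_on A M" and N: "radon_on B N"
    and lcA: "locally_compact_space (top_of_set A)" and lcB: "locally_compact_space (top_of_set B)"
  shows "(\<integral>x. f x \<partial>(M \<Otimes>\<^sub>M N)) = (\<integral>b. (\<integral>a. f (a, b) \<partial>M) \<partial>N)"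
proof -
  interpret M: sigma_finite_measure M using radon_on_sigma_finite[OF M lcA] .
  interpret N: sigma_finite_measure N using radon_on_sigma_finite[OF N lcB] .
  interpret pair_sigma_finite M N ..
  have "integrable (M \<Otimes>\<^sub>M N) f"
    by (rule Cc_integrable[OF f radon_on_pair[OF M N lcA lcB]])
  then show ?thesis
    using integral_snd[of "\<lambda>a b. f (a, b)"] by (simp add: case_prod_unfold)
qed

text \<open>Complete regularity provides such functions near each point of \<open>C\<close>, and a finite sum of them
  serves for all of \<open>C\<close>.\<close>

lemma Cc_bump:
  fixes A :: "'a::t2_space set"
  assumes lc: "locally_compact_space (top_of_set A)" and C: "compact C" "C \<subseteq> A"
  obtains f where "f \<in> Cc A" "\<And>a. 0 \<le> f a" "\<And>a. a \<in> C \<Longrightarrow> 1 \<le> f a"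
proof -
  have "completely_regular_space (top_of_set A)"
    by (rule locally_compact_regular_imp_completely_regular_space[OF lc])
      (simp add: Hausdorff_top_of_set)
  then have cr: "\<exists>g. continuous_map (top_of_set A) (top_of_set {0..1::real}) g \<and> g x = 0 \<and> g ` S \<subseteq> {1}"
    if "closedin (top_of_set A) S" "x \<in> A - S" for S x
    using that unfolding completely_regular_space_def by simp
  have "\<exists>f T. f \<in> Cc A \<and> (\<forall>a. 0 \<le> f a) \<and> open T \<and> c \<in> T \<and> (\<forall>a\<in>A \<inter> T. 1 \<le> f a)" if c: "c \<in> C" for c
  proof -
    have "c \<in> A" using c C by blast
    obtain U K where U: "open U" "c \<in> U" "A \<inter> U \<subseteq> K" "compact K" "K \<subseteq> A"
      using locally_compactD[OF lc \<open>c \<in> A\<close>] by blast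
    have cl: "closedin (top_of_set A) (A - U)"
      using U(1) by (metis closedin_closed Diff_eq closed_Compl)
    obtain g where g: "continuous_map (top_of_set A) (top_of_set {0..1::real}) g" "g c = 0" "g ` (A - U) \<subseteq> {1}"
      using cr[OF cl, of c] \<open>c \<in> A\<close> \<open>c \<in> U\<close> by auto
    have gc: "continuous_on A g" and g1: "\<And>a. a \<in> A \<Longrightarrow> g a \<le> 1"
      using g(1) by (auto simp: continuous_map_in_subtopology Pi_iff image_subset_iff)
    \<comment> \<open>The factor \<open>2\<close> makes \<open>f\<close> exceed \<open>1\<close> on a neighbourhood of \<open>c\<close> and not just at \<open>c\<close>.\<close>
    define f where "f a = (if a \<in> A then 2 * (1 - g a) else 0)" for a
    have fc: "continuous_on A f"
      by (rule continuous_on_eq[where f = "\<lambda>a. 2 * (1 - g a)"])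
        (auto simp: f_def intro!: continuous_intros gc)
    have "f a = 0" if "a \<notin> K" for a
      using that U g(3) unfolding f_def by auto
    then have 1: "f \<in> Cc A" using fc U unfolding Cc_def by blast
    obtain T where T: "open T" "T \<inter> A = f -` {1<..} \<inter> A"
      using fc unfolding continuous_on_open_invariant by (metis open_greaterThan)
    have "c \<in> f -` {1<..} \<inter> A" using g(2) \<open>c \<in> A\<close> unfolding f_def by auto
    then have "c \<in> T" using T(2) by blast
    moreover have "1 \<le> f a" if "a \<in> A \<inter> T" for a
    proof -
      have "a \<in> f -` {1<..} \<inter> A" using that T(2) by blast
      then show ?thesis by simp
    qed
    moreover have "0 \<le> f a" for a using g1 unfolding f_def by auto
    ultimately show ?thesis using 1 T by blast
  qed
  then obtain F T where FT: "\<And>c. c \<in> C \<Longrightarrow> F c \<in> Cc A \<and> (\<forall>a. 0 \<le> F c a) \<and> open (T c) \<and> c \<in> T c \<and>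
      (\<forall>a\<in>A \<inter> T c. 1 \<le> F c a)"
    by metis
  obtain D where D: "D \<subseteq> C" "finite D" "C \<subseteq> (\<Union>c\<in>D. T c)"
    using compactE_image[OF C(1), of C T] FT by (metis UN_I subsetI)
  define f where "f a = (\<Sum>c\<in>D. F c a)" for a
  have "\<forall>c\<in>D. \<exists>K. compact K \<and> K \<subseteq> A \<and> (\<forall>a. a \<notin> K \<longrightarrow> F c a = 0)"
    using FT D unfolding Cc_def by blast
  then obtain K where K: "\<And>c. c \<in> D \<Longrightarrow> compact (K c) \<and> K c \<subseteq> A \<and> (\<forall>a. a \<notin> K c \<longrightarrow> F c a = 0)"
    by metis
  have "continuous_on A f"
    unfolding f_def using FT D by (intro continuous_on_sum) (auto simp: Cc_def)
  moreover have "compact (\<Union>c\<in>D. K c)" "(\<Union>c\<in>D. K c) \<subseteq> A"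
    using K D by (auto intro!: compact_UN)
  moreover have "f a = 0" if "a \<notin> (\<Union>c\<in>D. K c)" for a
    unfolding f_def by (rule sum.neutral) (use K that in auto)
  ultimately have "f \<in> Cc A" unfolding Cc_def by blast
  moreover have "0 \<le> f a" for a
    unfolding f_def by (rule sum_nonneg) (use FT D in auto)
  moreover have "1 \<le> f a" if a: "a \<in> C" for a
  proof -
    obtain c where c: "c \<in> D" "a \<in> T c" using D a by blast
    have "1 \<le> F c a" using FT c D a C by blast
    also have "\<dots> \<le> f a"
      unfolding f_def by (rule member_le_sum) (use FT D c in auto)
    finally show ?thesis .
  qed
  ultimately show thesis using that by blast
qed

text \<open>Near \<open>a\<close> all the functions \<open>f (a', \<cdot>)\<close> vanish off one compact set, so that their uniform
  distance to \<open>f (a, \<cdot>)\<close> controls the distance of the integrals once the mass of that set is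
  bounded locally uniformly in \<open>x\<close>.  The bump function provides this bound.\<close>

lemma Cc_integral_jointly_continuous:
  fixes A :: "'a::topological_space set" and B :: "'b::t2_space set" and X :: "'x::topological_space set"
  assumes lc: "locally_compact_space (top_of_set B)"
    and N: "\<And>x. x \<in> X \<Longrightarrow> radon_on B (N x)"
    and cont: "\<And>f. f \<in> Cc B \<Longrightarrow> continuous_on X (\<lambda>x. \<integral>b. f b \<partial>N x)"
    and f: "f \<in> Cc (A \<times> B)"
  shows "continuous_on (A \<times> X) (\<lambda>(a, x). \<integral>b. f (a, b) \<partial>N x)"
proof (rule continuous_on_realI, clarify)
  fix a x and e :: real assume a: "a \<in> A" and x: "x \<in> X" and e: "e > 0"
  obtain C where C: "compact C" "C \<subseteq> A \<times> B" "\<And>x. x \<notin> C \<Longrightarrow> f x = 0" "continuous_on (A \<times> B) f"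
    using Cc_support[OF f] by blast
  have s: "compact (snd ` C)" "snd ` C \<subseteq> B"
    using C by (auto intro!: compact_continuous_image continuous_intros)
  obtain \<phi> where \<phi>: "\<phi> \<in> Cc B" "\<And>b. 0 \<le> \<phi> b" "\<And>b. b \<in> snd ` C \<Longrightarrow> 1 \<le> \<phi> b"
    using Cc_bump[OF lc s] by blast
  define I where "I = (\<integral>b. \<phi> b \<partial>N x)"
  have I: "I \<ge> 0" unfolding I_def using \<phi>(2) by (intro integral_nonneg_AE) auto
  define d where "d = e / (2 * (I + 1))"
  have d: "d > 0" "d * (I + 1) = e / 2" using I e unfolding d_def by (auto simp: field_simps)
  obtain U where U: "open U" "a \<in> U" "\<And>a' b. a' \<in> U \<inter> A \<Longrightarrow> \<bar>f (a', b) - f (a, b)\<bar> \<le> d"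
    using Cc_uniform[OF f a d(1)] by blast
  have near: "\<exists>V. open V \<and> x \<in> V \<and> (\<forall>y\<in>V \<inter> X. \<bar>(\<integral>b. h b \<partial>N y) - (\<integral>b. h b \<partial>N x)\<bar> < r)"
    if "h \<in> Cc B" "r > 0" for h r
    using cont[OF that(1)] x that(2)
    unfolding continuous_on_def tendsto_iff eventually_at_topological dist_real_def
    by (metis IntE abs_zero diff_self)
  obtain V1 where V1: "open V1" "x \<in> V1" "\<And>y. y \<in> V1 \<inter> X \<Longrightarrow> \<bar>(\<integral>b. \<phi> b \<partial>N y) - I\<bar> < 1"
    using near[OF \<phi>(1), of 1] unfolding I_def by auto
  obtain V2 where V2: "open V2" "x \<in> V2"
      "\<And>y. y \<in> V2 \<inter> X \<Longrightarrow> \<bar>(\<integral>b. f (a, b) \<partial>N y) - (\<integral>b. f (a, b) \<partial>N x)\<bar> < e / 2"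
    using near[OF Cc_slice[OF f a], of "e / 2"] e by auto
  have "\<bar>(\<integral>b. f (a', b) \<partial>N y) - (\<integral>b. f (a, b) \<partial>N x)\<bar> < e"
    if a': "a' \<in> U \<inter> A" and y: "y \<in> V1 \<inter> V2 \<inter> X" for a' y
  proof -
    have i: "integrable (N y) (\<lambda>b. f (a', b))" "integrable (N y) (\<lambda>b. f (a, b))" "integrable (N y) \<phi>"
      using Cc_integrable[OF Cc_slice[OF f] N] Cc_integrable[OF \<phi>(1) N] a' a y by auto
    have "\<bar>(\<integral>b. f (a', b) \<partial>N y) - (\<integral>b. f (a, b) \<partial>N y)\<bar> = \<bar>\<integral>b. f (a', b) - f (a, b) \<partial>N y\<bar>"
      using i by (subst Bochner_Integration.integral_diff) auto
    also have "\<dots> \<le> (\<integral>b. \<bar>f (a', b) - f (a, b)\<bar> \<partial>N y)"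
      by (rule integral_abs_bound)
    also have "\<dots> \<le> (\<integral>b. d * \<phi> b \<partial>N y)"
    proof (rule integral_mono)
      show "integrable (N y) (\<lambda>b. \<bar>f (a', b) - f (a, b)\<bar>)" "integrable (N y) (\<lambda>b. d * \<phi> b)"
        using i by auto
      show "\<bar>f (a', b) - f (a, b)\<bar> \<le> d * \<phi> b" for b
      proof (cases "b \<in> snd ` C")
        case True
        then have "d * 1 \<le> d * \<phi> b" using \<phi>(3) d by (intro mult_left_mono) auto
        then show ?thesis using U(3)[OF a', of b] by simp
      next
        case False
        then have "f (a', b) = 0" "f (a, b) = 0" using C(3) by force+
        then show ?thesis using d \<phi>(2) by simp
      qed
    qed
    also have "\<dots> = d * (\<integral>b. \<phi> b \<partial>N y)" by simp
    also have "\<dots> \<le> d * (I + 1)"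
    proof (rule mult_left_mono)
      show "(\<integral>b. \<phi> b \<partial>N y) \<le> I + 1" using V1(3)[of y] y by auto
    qed (use d in simp)
    finally have "\<bar>(\<integral>b. f (a', b) \<partial>N y) - (\<integral>b. f (a, b) \<partial>N y)\<bar> \<le> e / 2" using d by simp
    moreover have "\<bar>(\<integral>b. f (a, b) \<partial>N y) - (\<integral>b. f (a, b) \<partial>N x)\<bar> < e / 2"
      using V2(3) y by blast
    ultimately show ?thesis by linarith
  qed
  then show "\<exists>W. open W \<and> (a, x) \<in> W \<and> (\<forall>z\<in>W \<inter> A \<times> X.
      \<bar>(case z of (a, x) \<Rightarrow> \<integral>b. f (a, b) \<partial>N x) - (\<integral>b. f (a, b) \<partial>N x)\<bar> < e)"
    using U V1 V2 by (intro exI[of _ "U \<times> (V1 \<inter> V2)"]) (auto intro!: open_Times open_Int)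
qed

subsection \<open>Translations of product measures\<close>

text \<open>By Tonelli's theorem, a map of \<open>A \<times> F\<close> which moves the first coordinate, in dependence on
  the second one, by transformations preserving \<open>M\<close> acts on a product measure through the second
  coordinate alone.\<close>

lemma emeasure_twisted_product:
  fixes M :: "'a::{t2_space, second_countable_topology} measure"
    and N N' :: "'b::{t2_space, second_countable_topology} measure"
  assumes M: "radon_on A M" and N: "radon_on B N" "radon_on B N'"
    and lc: "locally_compact_space (top_of_set A)" "locally_compact_space (top_of_set B)"
    and ne: "A \<noteq> {}" and F: "F \<in> sets borel" "AE b in N. b \<in> F"
    and cont: "continuous_on (A \<times> F) (\<lambda>(h, b). (u b h, v b))"
    and u: "\<And>b S. b \<in> F \<Longrightarrow> S \<in> sets borel \<Longrightarrow> emeasure M {h \<in> A. u b h \<in> S} = emeasure M S"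
    and v: "\<And>S. S \<in> sets borel \<Longrightarrow> emeasure N {b \<in> F. v b \<in> S} = emeasure N' S"
    and S: "S \<in> sets borel"
  shows "emeasure (M \<Otimes>\<^sub>M N) {(h, b) \<in> A \<times> F. (u b h, v b) \<in> S} = emeasure (M \<Otimes>\<^sub>M N') S"
proof -
  note Md = radon_onD[OF M] and Nd = radon_onD[OF N(1)] and N'd = radon_onD[OF N(2)]
  interpret M: sigma_finite_measure M using radon_on_sigma_finite[OF M lc(1)] .
  interpret N: sigma_finite_measure N using radon_on_sigma_finite[OF N(1) lc(2)] .
  interpret N': sigma_finite_measure N' using radon_on_sigma_finite[OF N(2) lc(2)] .
  interpret MN: pair_sigma_finite M N ..
  interpret MN': pair_sigma_finite M N' ..
  have AF: "A \<times> F \<in> sets borel"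
    using locally_compact_borel[OF lc(1)] F(1) by (simp add: borel_prod[symmetric])
  have "{x \<in> A \<times> F. (case x of (h, b) \<Rightarrow> (u b h, v b)) \<in> S} \<in> sets borel"
    by (rule borel_continuous_preimage[OF cont AF S])
  then have D: "{(h, b) \<in> A \<times> F. (u b h, v b) \<in> S} \<in> sets (M \<Otimes>\<^sub>M N)"
    using sets_pair_borel[OF Md(1) Nd(1)] by (simp add: case_prod_unfold mem_Times_iff conj_assoc)
  have S': "S \<in> sets (M \<Otimes>\<^sub>M N')"
    using sets_pair_borel[OF Md(1) N'd(1)] S by simp
  obtain h0 where h0: "h0 \<in> A" using ne by blast
  have vc: "continuous_on F v"
  proof -
    have "continuous_on F (\<lambda>b. snd ((\<lambda>(h, b). (u b h, v b)) (h0, b)))"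
      by (intro continuous_on_snd continuous_on_compose2[OF cont] continuous_intros) (use h0 in auto)
    then show ?thesis by simp
  qed
  define c0 where "c0 = v (SOME b. b \<in> F)"
  define v' where "v' b = (if b \<in> F then v b else c0)" for b
  have v'm: "v' \<in> measurable N borel"
  proof (rule measurableI)
    fix T :: "'b set" assume T: "T \<in> sets borel"
    have "v' -` T \<inter> space N = {b \<in> F. v b \<in> T} \<union> (if c0 \<in> T then - F else {})"
      unfolding v'_def using Nd(2) by (auto split: if_splits)
    then show "v' -` T \<inter> space N \<in> sets N"
      using borel_continuous_preimage[OF vc F(1) T] F(1) Nd(1) by auto
  qed simp
  have N'eq: "N' = distr N borel v'"
  proof (rule measure_eqI)
    fix T assume "T \<in> sets N'"
    then have T: "T \<in> sets borel" using N'd by simp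
    have "emeasure (distr N borel v') T = emeasure N (v' -` T \<inter> space N)"
      using v'm T by (rule emeasure_distr)
    also have "\<dots> = emeasure N {b \<in> F. v b \<in> T}"
    proof (rule emeasure_eq_AE)
      show "AE b in N. (b \<in> v' -` T \<inter> space N) = (b \<in> {b \<in> F. v b \<in> T})"
        using F(2) by eventually_elim (auto simp: v'_def Nd(2))
      show "v' -` T \<inter> space N \<in> sets N" using v'm T by (rule measurable_sets)
      show "{b \<in> F. v b \<in> T} \<in> sets N"
        using borel_continuous_preimage[OF vc F(1) T] Nd(1) by simp
    qed
    finally show "emeasure N' T = emeasure (distr N borel v') T" using v[OF T] by simp
  qed (use N'd in simp)
  have slice: "(\<lambda>x. (x, c)) -` S \<in> sets borel" for c
    using sets_Pair2[OF S'] Md(1) by simp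
  define \<phi> where "\<phi> c = emeasure M ((\<lambda>x. (x, c)) -` S)" for c
  have "\<phi> \<in> borel_measurable N'"
    unfolding \<phi>_def using MN'.measurable_emeasure_Pair2[OF S'] .
  then have \<phi>m: "\<phi> \<in> borel_measurable borel"
    using N'd(1) by (simp cong: measurable_cong_sets)
  have "emeasure (M \<Otimes>\<^sub>M N) {(h, b) \<in> A \<times> F. (u b h, v b) \<in> S} =
      (\<integral>\<^sup>+b. emeasure M ((\<lambda>h. (h, b)) -` {(h, b) \<in> A \<times> F. (u b h, v b) \<in> S}) \<partial>N)"
    using D by (rule MN.emeasure_pair_measure_alt2)
  also have "\<dots> = (\<integral>\<^sup>+b. \<phi> (v' b) \<partial>N)"
  proof (rule nn_integral_cong_AE)
    show "AE b in N. emeasure M ((\<lambda>h. (h, b)) -` {(h, b) \<in> A \<times> F. (u b h, v b) \<in> S}) = \<phi> (v' b)"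
      using F(2)
    proof eventually_elim
      case (elim b)
      have "(\<lambda>h. (h, b)) -` {(h, b) \<in> A \<times> F. (u b h, v b) \<in> S} =
          {h \<in> A. u b h \<in> (\<lambda>x. (x, v b)) -` S}"
        using elim by auto
      then show ?case
        using u[OF elim slice] elim by (simp add: \<phi>_def v'_def)
    qed
  qed
  also have "\<dots> = (\<integral>\<^sup>+c. \<phi> c \<partial>N')"
    unfolding N'eq using v'm \<phi>m by (subst nn_integral_distr) auto
  also have "\<dots> = emeasure (M \<Otimes>\<^sub>M N') S"
    unfolding \<phi>_def using S' by (rule MN'.emeasure_pair_measure_alt2[symmetric])
  finally show ?thesis .
qed

subsection \<open>Haar measures of the group and of the circle\<close>

lemma left_haar_measure_radon:
  assumes "left_haar_measure \<mu>"
  shows "radon_on UNIV \<mu>"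
  using assms unfolding left_haar_measure_def radon_on_def by auto

lemma left_haar_measure_translate:
  assumes \<mu>: "left_haar_measure (\<mu> :: 'g::topological_group_add measure)" and S: "S \<in> sets borel"
  shows "emeasure \<mu> {h. g + h \<in> S} = emeasure \<mu> S"
proof -
  have \<mu>d: "sets \<mu> = sets borel" "distr \<mu> borel (\<lambda>h. g + h) = \<mu>"
    using \<mu> unfolding left_haar_measure_def by auto
  have sp: "space \<mu> = UNIV" using sets_eq_imp_space_eq[OF \<mu>d(1)] by simp
  have "(\<lambda>h. g + h) \<in> borel_measurable borel"
    by (intro borel_measurable_continuous_onI continuous_intros)
  then have m: "(\<lambda>h. g + h) \<in> measurable \<mu> borel"
    using \<mu>d(1) by (simp cong: measurable_cong_sets)
  have "emeasure \<mu> S = emeasure (distr \<mu> borel (\<lambda>h. g + h)) S" using \<mu>d(2) by simp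
  also have "\<dots> = emeasure \<mu> ((\<lambda>h. g + h) -` S \<inter> space \<mu>)"
    using m S by (rule emeasure_distr)
  finally show ?thesis by (simp add: sp vimage_def)
qed

text \<open>Otherwise countably many translates of \<open>U\<close>, all of them null sets, would cover the group.\<close>

lemma left_haar_measure_open_pos:
  assumes \<mu>: "left_haar_measure (\<mu> :: 'g::{topological_group_add, second_countable_topology} measure)"
    and U: "open U" "U \<noteq> {}"
  shows "emeasure \<mu> U > 0"
proof (rule ccontr)
  assume "\<not> emeasure \<mu> U > 0"
  then have U0: "emeasure \<mu> U = 0" by simp
  define T where "T g = {h. g + h \<in> U}" for g
  have op: "open (T g)" for g
  proof -
    have "continuous_on UNIV (\<lambda>h. g + h)" by (intro continuous_intros)
    then show ?thesis
      using open_vimage[OF U(1), of "\<lambda>h. g + h"] unfolding T_def vimage_def by simp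
  qed
  have T0: "emeasure \<mu> (T g) = 0" for g
    using left_haar_measure_translate[OF \<mu>, of U g] U0 U(1) unfolding T_def by simp
  obtain u where u: "u \<in> U" using U(2) by blast
  obtain F where F: "F \<subseteq> range T" "countable F" "\<Union>F = \<Union>(range T)"
    using Lindelof[of "range T"] op by blast
  have "h \<in> T (u - h)" for h
    unfolding T_def using u by simp
  then have "\<Union>F = UNIV" using F(3) by blast
  moreover have "(\<Union>S\<in>F. S) \<in> null_sets \<mu>"
  proof (rule null_sets_UN'[OF F(2)])
    fix S assume "S \<in> F"
    then obtain g where "S = T g" using F(1) by blast
    then show "S \<in> null_sets \<mu>"
      using T0 op \<mu> by (auto simp: null_sets_def left_haar_measure_def)
  qed
  ultimately show False
    using \<mu> by (auto simp: null_sets_def left_haar_measure_def)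
qed

lemma cis_2pi_add: "cis (2 * pi * (t + s)) = cis (2 * pi * t) * cis (2 * pi * s)"
  by (simp add: cis_mult ring_distribs)

lemma cis_2pi_borel_measurable: "(\<lambda>t::real. cis (2 * pi * t)) \<in> borel_measurable borel"
  by (intro borel_measurable_continuous_onI continuous_intros)

text \<open>The point \<open>1\<close> is left out so that the interval is a fundamental domain for the period \<open>1\<close>.\<close>

lemma U1_haar_emeasure:
  assumes "S \<in> sets borel"
  shows "emeasure U1_haar S = emeasure lborel ({0..<1} \<inter> {t. cis (2 * pi * t) \<in> S})"
proof -
  have m: "(\<lambda>t::real. cis (2 * pi * t)) \<in> measurable (uniform_measure lborel {0..1}) borel"
    using cis_2pi_borel_measurable by (simp cong: measurable_cong_sets)
  have P: "{t::real. cis (2 * pi * t) \<in> S} \<in> sets borel"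
    using measurable_sets[OF cis_2pi_borel_measurable assms] by (simp add: vimage_def)
  have "emeasure U1_haar S = emeasure (uniform_measure lborel {0..1}) {t::real. cis (2 * pi * t) \<in> S}"
    unfolding U1_haar_def using emeasure_distr[OF m assms] by (simp add: vimage_def)
  also have "\<dots> = emeasure lborel ({0..1} \<inter> {t::real. cis (2 * pi * t) \<in> S})"
    using P by (subst emeasure_uniform_measure) (auto simp: divide_ennreal_def)
  also have "\<dots> = emeasure lborel ({0..<1} \<inter> {t::real. cis (2 * pi * t) \<in> S})"
  proof (rule emeasure_eq_AE)
    show "AE t in lborel. (t \<in> {0..1} \<inter> {t::real. cis (2 * pi * t) \<in> S}) =
        (t \<in> {0..<1} \<inter> {t::real. cis (2 * pi * t) \<in> S})"
      using AE_lborel_singleton[of "1::real"] by eventually_elim auto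
  qed (use P in auto)
  finally show ?thesis .
qed

lemma U1_haar_radon: "radon_on U1 U1_haar"
proof -
  have "emeasure U1_haar C < \<infinity>" if "compact C" for C
  proof -
    have "C \<in> sets borel" using that by (rule borel_compact)
    then have "emeasure U1_haar C = emeasure lborel ({0..<1} \<inter> {t. cis (2 * pi * t) \<in> C})"
      by (rule U1_haar_emeasure)
    also have "\<dots> \<le> emeasure lborel {0..<1::real}"
      by (rule emeasure_mono) auto
    finally have "emeasure U1_haar C \<le> emeasure lborel {0..<1::real}" .
    then show ?thesis by (simp add: order_le_less_trans)
  qed
  moreover have "AE z in U1_haar. z \<in> U1"
  proof (rule AE_I[where N = "- U1"])
    have b: "- U1 \<in> sets borel" unfolding U1_def by (intro borel_comp borel_closed) auto
    then show "- U1 \<in> sets U1_haar" by (simp add: U1_haar_def)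
    show "emeasure U1_haar (- U1) = 0"
      by (subst U1_haar_emeasure[OF b]) (simp add: U1_def dist_norm)
  qed auto
  ultimately show ?thesis
    unfolding radon_on_def by (simp add: U1_haar_def)
qed

text \<open>Rotation by \<open>cis (2 * pi * s)\<close> moves the fundamental domain to \<open>[s, s + 1)\<close>; by periodicity
  the piece beyond \<open>1\<close> can be moved back to \<open>[0, s)\<close>.\<close>

lemma U1_haar_rotate:
  assumes z: "z \<in> U1" and S: "S \<in> sets borel"
  shows "emeasure U1_haar {w \<in> U1. z * w \<in> S} = emeasure U1_haar S"
proof -
  define s where "s = frac (Arg2pi z / (2 * pi))"
  define E where "E = {t::real. cis (2 * pi * t) \<in> S}"
  have s: "0 \<le> s" "s < 1" unfolding s_def by (auto simp: frac_lt_1)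
  have norm_z: "norm z = 1" using z unfolding U1_def by simp
  have zs: "z = cis (2 * pi * s)"
  proof -
    have "z = cis (Arg2pi z)"
      using Arg2pi_eq[of z] norm_z by (simp add: cis_conv_exp)
    moreover have "Arg2pi z / (2 * pi) < 1" "0 \<le> Arg2pi z / (2 * pi)"
      using Arg2pi_lt_2pi[of z] Arg2pi_ge_0[of z] by (auto simp: divide_simps)
    ultimately show ?thesis unfolding s_def by (simp add: frac_eq)
  qed
  have Eb: "E \<in> sets borel"
    using measurable_sets[OF cis_2pi_borel_measurable S] by (simp add: E_def vimage_def)
  have per: "t + 1 \<in> E \<longleftrightarrow> t \<in> E" for t
    unfolding E_def by (simp add: cis_2pi_add)
  have shift: "emeasure lborel {t. c + t \<in> X} = emeasure lborel X" if "X \<in> sets borel" for c :: real and X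
  proof -
    have "emeasure lborel X = emeasure (distr lborel borel ((+) c)) X" by (simp add: lborel_distr_plus)
    also have "\<dots> = emeasure lborel {t. c + t \<in> X}"
      using that by (subst emeasure_distr) (auto simp: vimage_def)
    finally show ?thesis by simp
  qed
  have R: "{w \<in> U1. z * w \<in> S} \<in> sets borel"
    by (rule borel_continuous_preimage[OF _ _ S]) (auto simp: U1_def intro!: continuous_intros)
  have "emeasure U1_haar {w \<in> U1. z * w \<in> S} =
      emeasure lborel ({0..<1} \<inter> {t. cis (2 * pi * t) \<in> {w \<in> U1. z * w \<in> S}})"
    by (rule U1_haar_emeasure[OF R])
  also have "{0..<1} \<inter> {t. cis (2 * pi * t) \<in> {w \<in> U1. z * w \<in> S}} = {t. s + t \<in> {s..<s+1} \<inter> E}"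
    by (auto simp: U1_def E_def zs cis_2pi_add)
  also have "emeasure lborel \<dots> = emeasure lborel ({s..<s+1} \<inter> E)"
    by (rule shift) (use Eb in auto)
  also have "\<dots> = emeasure lborel ({s..<1} \<inter> E \<union> {1..<1+s} \<inter> E)"
    by (rule arg_cong[where f = "emeasure lborel"]) (use s in auto)
  also have "\<dots> = emeasure lborel ({s..<1} \<inter> E) + emeasure lborel ({1..<1+s} \<inter> E)"
    by (rule plus_emeasure[symmetric]) (use Eb in auto)
  also have "emeasure lborel ({1..<1+s} \<inter> E) = emeasure lborel {t. 1 + t \<in> {1..<1+s} \<inter> E}"
    by (rule shift[symmetric]) (use Eb in auto)
  also have "{t. 1 + t \<in> {1..<1+s} \<inter> E} = {0..<s} \<inter> E"
    using per by (auto simp: add.commute)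
  also have "emeasure lborel ({s..<1} \<inter> E) + emeasure lborel ({0..<s} \<inter> E) =
      emeasure lborel ({s..<1} \<inter> E \<union> {0..<s} \<inter> E)"
    by (rule plus_emeasure) (use Eb in auto)
  also have "{s..<1} \<inter> E \<union> {0..<s} \<inter> E = {0..<1} \<inter> E"
    using s by auto
  also have "emeasure lborel ({0..<1} \<inter> E) = emeasure U1_haar S"
    unfolding E_def by (rule U1_haar_emeasure[OF S, symmetric])
  finally show ?thesis .
qed

lemma U1_haar_open_pos:
  assumes V: "open V" "V \<inter> U1 \<noteq> {}"
  shows "emeasure U1_haar V > 0"
proof -
  obtain z where z: "z \<in> V" "z \<in> U1" using V by blast
  define E where "E = {t::real. cis (2 * pi * t) \<in> V}"
  define t0 where "t0 = Arg2pi z / (2 * pi)"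
  have t0: "0 \<le> t0" "t0 < 1"
    unfolding t0_def using Arg2pi_lt_2pi[of z] Arg2pi_ge_0[of z] by (auto simp: divide_simps)
  have "z = cis (2 * pi * t0)"
    using Arg2pi_eq[of z] z(2) unfolding U1_def t0_def by (simp add: cis_conv_exp)
  then have t0E: "t0 \<in> E" using z(1) unfolding E_def by simp
  have oE: "open E"
  proof -
    have "continuous_on UNIV (\<lambda>t. cis (2 * pi * t))" by (intro continuous_intros)
    then show ?thesis
      using open_vimage[OF V(1), of "\<lambda>t. cis (2 * pi * t)"] unfolding E_def vimage_def by simp
  qed
  obtain e where e: "e > 0" "\<And>t. dist t t0 < e \<Longrightarrow> t \<in> E"
    using oE t0E unfolding open_dist by blast
  define d where "d = min e (1 - t0)"
  have d: "d > 0" "d \<le> e" "t0 + d \<le> 1" unfolding d_def using e t0 by auto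
  have "{t0..<t0 + d} \<subseteq> {0..<1} \<inter> E"
    using d t0 e(2) by (auto simp: dist_real_def)
  then have "emeasure lborel {t0..<t0 + d} \<le> emeasure lborel ({0..<1} \<inter> E)"
    using oE by (intro emeasure_mono) auto
  moreover have "emeasure lborel {t0..<t0 + d} > 0" using d by simp
  ultimately have "emeasure lborel ({0..<1} \<inter> E) > 0" by (rule less_le_trans[rotated])
  then show ?thesis
    unfolding E_def using U1_haar_emeasure[of V] V(1) by simp
qed

lemma U1_locally_compact: "locally_compact_space (top_of_set U1)"
  unfolding U1_def by (rule compact_imp_locally_compact_space) (simp add: compact_space_subtopology)

section \<open>Topological groupoids\<close>

lemma composable_iff:
  "(a, b) \<in> composable K \<longleftrightarrow> a \<in> arr K \<and> b \<in> arr K \<and> src K a = rng K b"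
  by (simp add: composable_def)

locale top_groupoid =
  fixes K :: "('a::topological_space, 'x::topological_space) groupoid"
  assumes topological_groupoid: "topological_groupoid K"
begin

lemma
  shows src_obj [simp]: "a \<in> arr K \<Longrightarrow> src K a \<in> obj K"
    and rng_obj [simp]: "a \<in> arr K \<Longrightarrow> rng K a \<in> obj K"
    and ivt_arr [simp]: "a \<in> arr K \<Longrightarrow> ivt K a \<in> arr K"
    and idt_arr [simp]: "x \<in> obj K \<Longrightarrow> idt K x \<in> arr K"
    and src_idt [simp]: "x \<in> obj K \<Longrightarrow> src K (idt K x) = x"
    and rng_idt [simp]: "x \<in> obj K \<Longrightarrow> rng K (idt K x) = x"
    and idt_cmp: "a \<in> arr K \<Longrightarrow> cmp K (idt K (rng K a)) a = a"
    and cmp_idt: "a \<in> arr K \<Longrightarrow> cmp K a (idt K (src K a)) = a"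
    and src_ivt [simp]: "a \<in> arr K \<Longrightarrow> src K (ivt K a) = rng K a"
    and rng_ivt [simp]: "a \<in> arr K \<Longrightarrow> rng K (ivt K a) = src K a"
    and cmp_ivt [simp]: "a \<in> arr K \<Longrightarrow> cmp K a (ivt K a) = idt K (rng K a)"
    and ivt_cmp [simp]: "a \<in> arr K \<Longrightarrow> cmp K (ivt K a) a = idt K (src K a)"
  using topological_groupoid unfolding topological_groupoid_def by auto

lemma
  assumes "a \<in> arr K" "b \<in> arr K" "src K a = rng K b"
  shows cmp_arr [simp]: "cmp K a b \<in> arr K"
    and src_cmp [simp]: "src K (cmp K a b) = src K b"
    and rng_cmp [simp]: "rng K (cmp K a b) = rng K a"
  using topological_groupoid assms unfolding topological_groupoid_def composable_def by auto

lemma cmp_assoc: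
  assumes "a \<in> arr K" "b \<in> arr K" "c \<in> arr K" "src K a = rng K b" "src K b = rng K c"
  shows "cmp K (cmp K a b) c = cmp K a (cmp K b c)"
  using topological_groupoid assms unfolding topological_groupoid_def composable_def by blast

lemma idt_cmp' [simp]: "a \<in> arr K \<Longrightarrow> x = rng K a \<Longrightarrow> cmp K (idt K x) a = a"
  and cmp_idt' [simp]: "a \<in> arr K \<Longrightarrow> x = src K a \<Longrightarrow> cmp K a (idt K x) = a"
  by (simp_all add: idt_cmp cmp_idt)

lemma ivt_cmp_cancel [simp]:
  assumes "a \<in> arr K" "b \<in> arr K" "src K a = rng K b"
  shows "cmp K (ivt K a) (cmp K a b) = b"
  using assms cmp_assoc[of "ivt K a" a b] by simp

lemma cmp_ivt_cancel [simp]: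
  assumes "a \<in> arr K" "b \<in> arr K" "rng K a = rng K b"
  shows "cmp K a (cmp K (ivt K a) b) = b"
  using assms cmp_assoc[of a "ivt K a" b] by simp

lemma cmp_cancel_ivt [simp]:
  assumes "a \<in> arr K" "b \<in> arr K" "src K a = rng K b"
  shows "cmp K (cmp K a b) (ivt K b) = a"
  using assms cmp_assoc[of a b "ivt K b"] by simp

lemma ivt_cancel_cmp [simp]:
  assumes "a \<in> arr K" "b \<in> arr K" "src K a = src K b"
  shows "cmp K (cmp K a (ivt K b)) b = a"
  using assms cmp_assoc[of a "ivt K b" b] by simp

lemma idt_inj: "x \<in> obj K \<Longrightarrow> y \<in> obj K \<Longrightarrow> idt K x = idt K y \<Longrightarrow> x = y"
  by (metis src_idt)

lemma
  shows src_cont: "continuous_on S f \<Longrightarrow> f ` S \<subseteq> arr K \<Longrightarrow> continuous_on S (\<lambda>s. src K (f s))"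
    and rng_cont: "continuous_on S f \<Longrightarrow> f ` S \<subseteq> arr K \<Longrightarrow> continuous_on S (\<lambda>s. rng K (f s))"
    and ivt_cont: "continuous_on S f \<Longrightarrow> f ` S \<subseteq> arr K \<Longrightarrow> continuous_on S (\<lambda>s. ivt K (f s))"
    and idt_cont: "continuous_on S g \<Longrightarrow> g ` S \<subseteq> obj K \<Longrightarrow> continuous_on S (\<lambda>s. idt K (g s))"
  using topological_groupoid unfolding topological_groupoid_def
  by (auto elim: continuous_on_compose2)

lemma cmp_cont:
  assumes "continuous_on S f" "continuous_on S g" "\<And>s. s \<in> S \<Longrightarrow> (f s, g s) \<in> composable K"
  shows "continuous_on S (\<lambda>s. cmp K (f s) (g s))"
proof -
  have "continuous_on (composable K) (\<lambda>(a, b). cmp K a b)"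
    using topological_groupoid unfolding topological_groupoid_def by blast
  then have "continuous_on S (\<lambda>s. (\<lambda>(a, b). cmp K a b) (f s, g s))"
    by (rule continuous_on_compose2) (use assms in \<open>auto intro!: continuous_on_Pair\<close>)
  then show ?thesis by simp
qed

end

lemma topological_groupoidI:
  assumes "\<And>a. a \<in> arr K \<Longrightarrow> src K a \<in> obj K \<and> rng K a \<in> obj K \<and> ivt K a \<in> arr K"
    and "\<And>x. x \<in> obj K \<Longrightarrow> idt K x \<in> arr K \<and> src K (idt K x) = x \<and> rng K (idt K x) = x"
    and "\<And>a b. a \<in> arr K \<Longrightarrow> b \<in> arr K \<Longrightarrow> src K a = rng K b \<Longrightarrow>
      cmp K a b \<in> arr K \<and> src K (cmp K a b) = src K b \<and> rng K (cmp K a b) = rng K a"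
    and "\<And>a b c. a \<in> arr K \<Longrightarrow> b \<in> arr K \<Longrightarrow> c \<in> arr K \<Longrightarrow> src K a = rng K b \<Longrightarrow> src K b = rng K c \<Longrightarrow>
      cmp K (cmp K a b) c = cmp K a (cmp K b c)"
    and "\<And>a. a \<in> arr K \<Longrightarrow> cmp K (idt K (rng K a)) a = a \<and> cmp K a (idt K (src K a)) = a"
    and "\<And>a. a \<in> arr K \<Longrightarrow> src K (ivt K a) = rng K a \<and> rng K (ivt K a) = src K a \<and>
      cmp K a (ivt K a) = idt K (rng K a) \<and> cmp K (ivt K a) a = idt K (src K a)"
    and "continuous_on (arr K) (src K)" "continuous_on (arr K) (rng K)" "continuous_on (obj K) (idt K)"
      "continuous_on (composable K) (\<lambda>(a, b). cmp K a b)" "continuous_on (arr K) (ivt K)"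
  shows "topological_groupoid K"
  unfolding topological_groupoid_def composable_def
  using assms unfolding composable_def by auto

lemma continuous_on_pair_action:
  assumes "continuous_on (UNIV \<times> P) (\<lambda>(g, p). act g p)"
    and "continuous_on S f" "continuous_on S k" "k ` S \<subseteq> P"
  shows "continuous_on S (\<lambda>s. act (f s) (k s))"
proof -
  have "continuous_on S (\<lambda>s. (\<lambda>(g, p). act g p) (f s, k s))"
    using assms(1) by (rule continuous_on_compose2) (use assms in \<open>auto intro!: continuous_on_Pair\<close>)
  then show ?thesis by simp
qed

locale acted_groupoid =
  fixes K :: "('a::topological_space, 'x::topological_space) groupoid"
    and act :: "'g::topological_group_add \<Rightarrow> 'a \<Rightarrow> 'a"
  assumes G_groupoid: "G_groupoid K act"
begin

abbreviation oact :: "'g \<Rightarrow> 'x \<Rightarrow> 'x" where "oact \<equiv> obj_act K act"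

lemma groupoid: "groupoid K"
  using G_groupoid unfolding G_groupoid_def by blast

sublocale top_groupoid K
  using groupoid unfolding groupoid_def by unfold_locales blast

lemma
  assumes "a \<in> arr K"
  shows act_arr [simp]: "act g a \<in> arr K"
    and act_0 [simp]: "act 0 a = a"
    and act_act [simp]: "act g (act h a) = act (g + h) a"
    and src_act [simp]: "src K (act g a) = oact g (src K a)"
    and rng_act [simp]: "rng K (act g a) = oact g (rng K a)"
    and act_ivt: "act g (ivt K a) = ivt K (act g a)"
  using G_groupoid assms unfolding G_groupoid_def continuous_action_def by auto

lemma act_cmp: "a \<in> arr K \<Longrightarrow> b \<in> arr K \<Longrightarrow> src K a = rng K b \<Longrightarrow>
    act g (cmp K a b) = cmp K (act g a) (act g b)"
  using G_groupoid unfolding G_groupoid_def composable_def by blast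

lemma act_idt: "x \<in> obj K \<Longrightarrow> act g (idt K x) = idt K (oact g x)"
  using G_groupoid unfolding G_groupoid_def by blast

lemma oact_obj [simp]: "x \<in> obj K \<Longrightarrow> oact g x \<in> obj K"
  unfolding obj_act_def by (intro rng_obj act_arr idt_arr)

lemma oact_0 [simp]: "x \<in> obj K \<Longrightarrow> oact 0 x = x"
  unfolding obj_act_def by simp

lemma oact_oact [simp]: "x \<in> obj K \<Longrightarrow> oact g (oact h x) = oact (g + h) x"
  by (metis act_act act_idt idt_arr oact_obj rng_idt)

lemma oact_eq_iff: "x \<in> obj K \<Longrightarrow> y \<in> obj K \<Longrightarrow> oact (- g) x = y \<longleftrightarrow> x = oact g y"
  by auto

lemma act_cont:
  "continuous_on S f \<Longrightarrow> continuous_on S k \<Longrightarrow> k ` S \<subseteq> arr K \<Longrightarrow> continuous_on S (\<lambda>s. act (f s) (k s))"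
  using G_groupoid unfolding G_groupoid_def continuous_action_def
  by (blast intro: continuous_on_pair_action)

lemma oact_cont:
  "continuous_on S f \<Longrightarrow> continuous_on S k \<Longrightarrow> k ` S \<subseteq> obj K \<Longrightarrow> continuous_on S (\<lambda>s. oact (f s) (k s))"
  unfolding obj_act_def by (intro rng_cont act_cont idt_cont) (auto simp: image_subset_iff)

lemma haar_act:
  "x \<in> obj K \<Longrightarrow> B \<in> sets borel \<Longrightarrow>
    emeasure (haar K x) {a \<in> rfibre K x. act g a \<in> B} = emeasure (haar K (oact g x)) B"
  using G_groupoid unfolding G_groupoid_def by blast

end

section \<open>Haar systems\<close>

lemma second_countable_top_of_set:
  "second_countable (top_of_set (A :: 'a::second_countable_topology set))"
proof (rule second_countable_subtopology)
  obtain B :: "'a set set" where B: "countable B" "topological_basis B"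
    using ex_countable_basis by blast
  show "second_countable (euclidean :: 'a topology)"
    unfolding second_countable_def
  proof (intro exI[of _ B] conjI)
    show "\<forall>V\<in>B. openin euclidean V"
      using B(2) by (auto simp: topological_basis_open)
    show "\<forall>U x. openin euclidean U \<and> x \<in> U \<longrightarrow> (\<exists>V\<in>B. x \<in> V \<and> V \<subseteq> U)"
      using B(2) unfolding open_openin[symmetric] by (meson topological_basisE)
  qed (rule B(1))
qed

lemma groupoidI:
  fixes K :: "('a::{t2_space, second_countable_topology}, 'x::topological_space) groupoid"
  assumes "topological_groupoid K" "locally_compact_space (top_of_set (arr K))" "left_haar_system K"
  shows "groupoid K"
  unfolding groupoid_def using assms by (simp add: Hausdorff_top_of_set second_countable_top_of_set)

lemma groupoidD:
  assumes "groupoid K"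
  shows "topological_groupoid K" "locally_compact_space (top_of_set (arr K))" "left_haar_system K"
  using assms unfolding groupoid_def by auto

text \<open>The unit \<open>x\<close> is told apart from other units by its identity arrow, which is a closed point of
  the Hausdorff space of arrows.\<close>

lemma rfibre_borel:
  fixes K :: "('a::t2_space, 'x::topological_space) groupoid"
  assumes tg: "topological_groupoid K" and arr: "arr K \<in> sets borel" and x: "x \<in> obj K"
  shows "rfibre K x \<in> sets borel"
proof -
  interpret top_groupoid K using tg by unfold_locales
  have c: "continuous_on (arr K) (\<lambda>a. idt K (rng K a))"
    by (intro idt_cont rng_cont continuous_on_id) auto
  have "{a \<in> arr K. idt K (rng K a) \<in> {idt K x}} \<in> sets borel"
    by (rule borel_continuous_preimage[OF c arr]) (rule borel_closed, simp)
  moreover have "rfibre K x = {a \<in> arr K. idt K (rng K a) \<in> {idt K x}}"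
    unfolding rfibre_def using x idt_inj by auto
  ultimately show ?thesis by simp
qed

lemma left_haar_systemD:
  assumes "left_haar_system K"
  shows "\<And>x. x \<in> obj K \<Longrightarrow> radon_on (arr K) (haar K x)"
    and "\<And>x. x \<in> obj K \<Longrightarrow> AE a in haar K x. a \<in> rfibre K x"
    and "\<And>x U. x \<in> obj K \<Longrightarrow> open U \<Longrightarrow> U \<inter> rfibre K x \<noteq> {} \<Longrightarrow> emeasure (haar K x) U > 0"
    and "\<And>f. f \<in> Cc (arr K) \<Longrightarrow> continuous_on (obj K) (\<lambda>x. \<integral>a. f a \<partial>haar K x)"
    and "\<And>a B. a \<in> arr K \<Longrightarrow> B \<in> sets borel \<Longrightarrow>
      emeasure (haar K (src K a)) {b \<in> rfibre K (src K a). cmp K a b \<in> B} =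
      emeasure (haar K (rng K a)) B"
proof -
  show "AE a in haar K x. a \<in> rfibre K x" if "x \<in> obj K" for x
    using assms that unfolding left_haar_system_def by blast
  then show "radon_on (arr K) (haar K x)" if "x \<in> obj K" for x
    using assms that unfolding left_haar_system_def radon_on_def
    by (auto simp: rfibre_def elim!: eventually_mono)
qed (use assms in \<open>unfold left_haar_system_def, blast+\<close>)

lemma left_haar_systemI:
  fixes K :: "('a::topological_space, 'x::topological_space) groupoid"
  assumes "\<And>x. x \<in> obj K \<Longrightarrow> radon_on (arr K) (haar K x)"
    and "\<And>x. x \<in> obj K \<Longrightarrow> AE a in haar K x. a \<in> rfibre K x"
    and "\<And>x U. x \<in> obj K \<Longrightarrow> open U \<Longrightarrow> U \<inter> rfibre K x \<noteq> {} \<Longrightarrow> emeasure (haar K x) U > 0"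
    and "\<And>f. f \<in> Cc (arr K) \<Longrightarrow> continuous_on (obj K) (\<lambda>x. \<integral>a. f a \<partial>haar K x)"
    and "\<And>a B. a \<in> arr K \<Longrightarrow> B \<in> sets borel \<Longrightarrow>
      emeasure (haar K (src K a)) {b \<in> rfibre K (src K a). cmp K a b \<in> B} =
      emeasure (haar K (rng K a)) B"
  shows "left_haar_system K"
  unfolding left_haar_system_def
proof (intro conjI ballI allI impI)
  fix x assume x: "x \<in> obj K"
  show "sets (haar K x) = sets borel" by (rule radon_onD(1)[OF assms(1)[OF x]])
  show "AE a in haar K x. a \<in> rfibre K x" by (rule assms(2)[OF x])
  show "emeasure (haar K x) C < \<infinity>" if "compact C \<and> C \<subseteq> arr K" for C
    using that by (intro radon_onD(3)[OF assms(1)[OF x]]) auto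
  show "emeasure (haar K x) U > 0" if "open U \<and> U \<inter> rfibre K x \<noteq> {}" for U
    using that by (intro assms(3)[OF x]) auto
next
  fix f assume "f \<in> Cc (arr K)"
  then show "continuous_on (obj K) (\<lambda>x. \<integral>a. f a \<partial>haar K x)" by (rule assms(4))
next
  fix a and B :: "'a set" assume "a \<in> arr K" "B \<in> sets borel"
  then show "emeasure (haar K (src K a)) {b \<in> rfibre K (src K a). cmp K a b \<in> B} =
      emeasure (haar K (rng K a)) B" by (rule assms(5))
qed

text \<open>Crossed products and gerbes both have arrow space \<open>A \<times> arr K\<close> and product measures, and in
  both a left translation is twisted in the sense of the lemma on twisted products: it moves the
  first coordinate by a translation of \<open>A\<close> that may depend on the second coordinate.\<close>

lemma product_left_haar_system:
  fixes K :: "('a::{t2_space, second_countable_topology}, 'x::topological_space) groupoid"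
    and K' :: "('h::{t2_space, second_countable_topology} \<times> 'a, 'x) groupoid"
  assumes K: "groupoid K"
    and A: "radon_on A M" "locally_compact_space (top_of_set A)" "A \<noteq> {}"
    and pos: "\<And>U. open U \<Longrightarrow> U \<inter> A \<noteq> {} \<Longrightarrow> emeasure M U > 0"
    and fields: "arr K' = A \<times> arr K" "obj K' = obj K" "\<And>h a. rng K' (h, a) = rng K a"
      "\<And>x. haar K' x = M \<Otimes>\<^sub>M haar K x"
    and tg: "topological_groupoid K'"
    and cmp: "\<And>k h b. k \<in> arr K' \<Longrightarrow> h \<in> A \<Longrightarrow> b \<in> rfibre K (src K' k) \<Longrightarrow>
      cmp K' k (h, b) = (u k b h, v k b)"
    and u: "\<And>k b S. k \<in> arr K' \<Longrightarrow> b \<in> rfibre K (src K' k) \<Longrightarrow> S \<in> sets borel \<Longrightarrow>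
      emeasure M {h \<in> A. u k b h \<in> S} = emeasure M S"
    and v: "\<And>k S. k \<in> arr K' \<Longrightarrow> S \<in> sets borel \<Longrightarrow>
      emeasure (haar K (src K' k)) {b \<in> rfibre K (src K' k). v k b \<in> S} = emeasure (haar K (rng K' k)) S"
  shows "left_haar_system K'"
proof -
  note lc = groupoidD(2)[OF K] and H = left_haar_systemD[OF groupoidD(3)[OF K]]
  interpret K: top_groupoid K using groupoidD(1)[OF K] by unfold_locales
  interpret K': top_groupoid K' using tg by unfold_locales
  have fib: "rfibre K' x = A \<times> rfibre K x" for x
    unfolding rfibre_def using fields by auto
  have rad: "radon_on (arr K') (haar K' x)" if "x \<in> obj K'" for x
    unfolding fields using A(1) H(1) A(2) lc that fields by (intro radon_on_pair) auto
  show ?thesis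
  proof (rule left_haar_systemI)
    fix x assume x: "x \<in> obj K'"
    then have xo: "x \<in> obj K" using fields by simp
    show "radon_on (arr K') (haar K' x)" using rad x .
    interpret sigma_finite_measure "haar K x"
      using radon_on_sigma_finite[OF H(1)[OF xo] lc] .
    note Md = radon_onD[OF A(1)] and Hd = radon_onD[OF H(1)[OF xo]]
    show "AE a in haar K' x. a \<in> rfibre K' x"
    proof -
      obtain T where T: "T \<in> sets (haar K x)" "emeasure (haar K x) T = 0" "\<And>a. a \<notin> T \<Longrightarrow> a \<in> rfibre K x"
        using AE_null_setE[OF H(2)[OF xo] Hd(2)] by blast
      have U: "UNIV \<in> sets M" using Md(1) by auto
      have "AE a in haar K' x. snd a \<in> rfibre K x"
      proof (rule AE_I[where N = "UNIV \<times> T"])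
        show "emeasure (haar K' x) (UNIV \<times> T) = 0"
          unfolding fields using T U by (simp add: emeasure_pair_measure_Times)
        show "UNIV \<times> T \<in> sets (haar K' x)" unfolding fields using T U by auto
      qed (auto, metis T(3))
      moreover have "AE a in haar K' x. a \<in> arr K'" using radon_onD(4)[OF rad[OF x]] .
      ultimately show ?thesis
        by eventually_elim (use fields in \<open>auto simp: fib\<close>)
    qed
    fix W assume W: "open W" "W \<inter> rfibre K' x \<noteq> {}"
    then obtain h a where ha: "(h, a) \<in> W" "h \<in> A" "a \<in> rfibre K x" unfolding fib by auto
    obtain U V where UV: "open U" "open V" "(h, a) \<in> U \<times> V" "U \<times> V \<subseteq> W"
      using open_prod_elim[OF W(1) ha(1)] by blast
    have "0 < emeasure M U * emeasure (haar K x) V"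
      using pos[of U] H(3)[OF xo, of V] UV ha by (auto simp: ennreal_zero_less_mult_iff)
    also have "\<dots> = emeasure (haar K' x) (U \<times> V)"
      unfolding fields using UV Md(1) Hd(1) by (subst emeasure_pair_measure_Times) auto
    also have "\<dots> \<le> emeasure (haar K' x) W"
      by (rule emeasure_mono) (use UV W rad[OF x] in \<open>auto simp: radon_on_def\<close>)
    finally show "emeasure (haar K' x) W > 0" .
  next
    fix f assume f: "f \<in> Cc (arr K')"
    then have f': "f \<in> Cc (A \<times> arr K)" using fields by simp
    have "continuous_on (obj K) (\<lambda>x. \<integral>a. (\<integral>h. f (h, a) \<partial>M) \<partial>haar K x)"
      by (rule H(4)[OF Cc_marginal[OF f' A(1)]])
    then have "continuous_on (obj K) (\<lambda>x. \<integral>y. f y \<partial>haar K' x)"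
      unfolding fields
      by (rule continuous_on_eq) (rule Cc_integral_pair[OF f' A(1) H(1) A(2) lc, symmetric])
    then show "continuous_on (obj K') (\<lambda>x. \<integral>y. f y \<partial>haar K' x)" using fields by simp
  next
    fix k and B :: "('h \<times> 'a) set" assume k: "k \<in> arr K'" and B: "B \<in> sets borel"
    define F where "F = rfibre K (src K' k)"
    have so: "src K' k \<in> obj K" and ro: "rng K' k \<in> obj K"
      using k K'.src_obj K'.rng_obj fields by auto
    have Fb: "F \<in> sets borel"
      unfolding F_def by (rule rfibre_borel[OF groupoidD(1)[OF K] locally_compact_borel[OF lc] so])
    have "continuous_on (A \<times> F) (\<lambda>x. cmp K' k x)"
      by (rule K'.cmp_cont) (use k in \<open>auto simp: F_def rfibre_def fields composable_iff intro!: continuous_intros\<close>)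
    then have c: "continuous_on (A \<times> F) (\<lambda>(h, b). (u k b h, v k b))"
      by (rule continuous_on_eq) (use cmp[OF k] in \<open>auto simp: F_def\<close>)
    have "emeasure (M \<Otimes>\<^sub>M haar K (src K' k)) {(h, b) \<in> A \<times> F. (u k b h, v k b) \<in> B} =
        emeasure (M \<Otimes>\<^sub>M haar K (rng K' k)) B"
      by (rule emeasure_twisted_product[OF A(1) H(1)[OF so] H(1)[OF ro] A(2) lc A(3) Fb _ c _ _ B])
        (use H(2)[OF so] u[OF k] v[OF k] in \<open>auto simp: F_def\<close>)
    moreover have "{(h, b) \<in> A \<times> F. (u k b h, v k b) \<in> B} =
        {b \<in> rfibre K' (src K' k). cmp K' k b \<in> B}"
      unfolding fib F_def using cmp[OF k] by auto
    ultimately show "emeasure (haar K' (src K' k)) {b \<in> rfibre K' (src K' k). cmp K' k b \<in> B} =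
        emeasure (haar K' (rng K' k)) B"
      unfolding fields by simp
  qed
qed

section \<open>Crossed products\<close>

lemma crossed_product_simps [simp]:
  "arr (crossed_product \<mu> K act) = UNIV \<times> arr K"
  "obj (crossed_product \<mu> K act) = obj K"
  "src (crossed_product \<mu> K act) (g, a) = src K (act (- g) a)"
  "rng (crossed_product \<mu> K act) (g, a) = rng K a"
  "idt (crossed_product \<mu> K act) x = (0, idt K x)"
  "cmp (crossed_product \<mu> K act) (g, a) (h, b) = (g + h, cmp K a (act g b))"
  "ivt (crossed_product \<mu> K act) (g, a) = (- g, act (- g) (ivt K a))"
  "haar (crossed_product \<mu> K act) x = \<mu> \<Otimes>\<^sub>M haar K x"
  by (simp_all add: crossed_product_def)

context acted_groupoid
begin

lemma crossed_product_topological: "topological_groupoid (crossed_product \<mu> K act)"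
  (is "topological_groupoid ?X")
proof (rule topological_groupoidI)
  \<comment> \<open>Without differences, associativity and the inversion of sums normalize words in the group.\<close>
  note [simp del] = add_uminus_conv_diff
  note [simp] = minus_add add.assoc
  fix k l m assume k: "k \<in> arr ?X" and l: "l \<in> arr ?X" and kl: "src ?X k = rng ?X l"
  obtain g a where ga: "k = (g, a)" "a \<in> arr K" using k by auto
  obtain h b where hb: "l = (h, b)" "b \<in> arr K" using l by auto
  have s: "src K a = oact g (rng K b)"
    using kl ga hb oact_eq_iff[of "src K a" "rng K b" g] by simp
  then show "cmp ?X k l \<in> arr ?X \<and> src ?X (cmp ?X k l) = src ?X l \<and> rng ?X (cmp ?X k l) = rng ?X k"
    using ga hb by simp
  assume m: "m \<in> arr ?X" and lm: "src ?X l = rng ?X m"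
  obtain i c where ic: "m = (i, c)" "c \<in> arr K" using m by auto
  have t: "src K b = oact h (rng K c)"
    using lm hb ic oact_eq_iff[of "src K b" "rng K c" h] by simp
  show "cmp ?X (cmp ?X k l) m = cmp ?X k (cmp ?X l m)"
    using s t ga hb ic cmp_assoc[of a "act g b" "act (g + h) c"] by (simp add: act_cmp)
next
  fix k assume "k \<in> arr ?X"
  then obtain g a where ga: "k = (g, a)" "a \<in> arr K" by auto
  show "src ?X k \<in> obj ?X \<and> rng ?X k \<in> obj ?X \<and> ivt ?X k \<in> arr ?X"
    using ga by simp
  show "cmp ?X (idt ?X (rng ?X k)) k = k \<and> cmp ?X k (idt ?X (src ?X k)) = k"
    using ga by (simp add: act_idt)
  show "src ?X (ivt ?X k) = rng ?X k \<and> rng ?X (ivt ?X k) = src ?X k \<and>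
      cmp ?X k (ivt ?X k) = idt ?X (rng ?X k) \<and> cmp ?X (ivt ?X k) k = idt ?X (src ?X k)"
    using ga by (simp add: act_ivt act_cmp[symmetric] act_idt[symmetric])
next
  show "continuous_on (arr ?X) (src ?X)"
    unfolding crossed_product_def
    by (auto simp: case_prod_unfold intro!: src_cont act_cont continuous_intros)
  show "continuous_on (arr ?X) (rng ?X)"
    unfolding crossed_product_def
    by (auto simp: case_prod_unfold intro!: rng_cont continuous_intros)
  show "continuous_on (obj ?X) (idt ?X)"
    unfolding crossed_product_def
    by (auto intro!: idt_cont continuous_intros)
  show "continuous_on (arr ?X) (ivt ?X)"
    unfolding crossed_product_def
    by (auto simp: case_prod_unfold intro!: act_cont ivt_cont continuous_intros)
  have "continuous_on (composable ?X) (\<lambda>x. cmp K (snd (fst x)) (act (fst (fst x)) (snd (snd x))))"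
    by (rule cmp_cont)
      (auto simp: composable_iff oact_eq_iff intro!: act_cont continuous_intros)
  then have "continuous_on (composable ?X) (\<lambda>x. (fst (fst x) + fst (snd x),
      cmp K (snd (fst x)) (act (fst (fst x)) (snd (snd x)))))"
    by (intro continuous_intros)
  then show "continuous_on (composable ?X) (\<lambda>(k, l). cmp ?X k l)"
    by (rule continuous_on_eq) (auto simp: composable_iff)
qed auto

end

lemma crossed_product_groupoid:
  fixes K :: "('a::{t2_space, second_countable_topology}, 'x::topological_space) groupoid"
    and act :: "'g::{topological_group_add, t2_space, second_countable_topology} \<Rightarrow> 'a \<Rightarrow> 'a"
  assumes G: "G_groupoid K act" and \<mu>: "left_haar_measure \<mu>"
    and lc: "locally_compact_space (euclidean :: 'g topology)"
  shows "groupoid (crossed_product \<mu> K act)" (is "groupoid ?X")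
proof (rule groupoidI)
  interpret acted_groupoid K act using G by unfold_locales
  note lcK = groupoidD(2)[OF groupoid] and H = left_haar_systemD[OF groupoidD(3)[OF groupoid]]
  have lc': "locally_compact_space (top_of_set (UNIV :: 'g set))"
    using lc by simp
  show tg: "topological_groupoid (crossed_product \<mu> K act)"
    by (rule crossed_product_topological)
  show "locally_compact_space (top_of_set (arr (crossed_product \<mu> K act)))"
    unfolding crossed_product_simps by (rule locally_compact_Times[OF lc' lcK])
  \<comment> \<open>The action carries the measure over \<open>y = src K (act (- g) a)\<close> to the one over \<open>src K a\<close>, on whose fibre \<open>a\<close> acts.\<close>
  have v: "emeasure (haar K (src K (act (- g) a))) {b \<in> rfibre K (src K (act (- g) a)). cmp K a (act g b) \<in> S} =
      emeasure (haar K (rng K a)) S"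
    if a: "a \<in> arr K" and S: "S \<in> sets borel" for g a S
  proof -
    define y where "y = src K (act (- g) a)"
    have y: "y \<in> obj K" "oact g y = src K a" unfolding y_def using a by auto
    have T: "{b \<in> rfibre K (src K a). cmp K a b \<in> S} \<in> sets borel"
      by (rule borel_continuous_preimage)
        (use a S in \<open>auto simp: rfibre_def composable_iff intro!: cmp_cont continuous_intros
          rfibre_borel[OF groupoidD(1)[OF groupoid] locally_compact_borel[OF lcK], unfolded rfibre_def]\<close>)
    have "{b \<in> rfibre K y. cmp K a (act g b) \<in> S} =
        {b \<in> rfibre K y. act g b \<in> {b \<in> rfibre K (src K a). cmp K a b \<in> S}}"
      using y by (auto simp: rfibre_def)
    also have "emeasure (haar K y) \<dots> = emeasure (haar K (src K a)) {b \<in> rfibre K (src K a). cmp K a b \<in> S}"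
      using haar_act[OF y(1) T] y(2) by simp
    also have "\<dots> = emeasure (haar K (rng K a)) S" by (rule H(5)[OF a S])
    finally show ?thesis unfolding y_def .
  qed
  show "left_haar_system (crossed_product \<mu> K act)"
  proof (rule product_left_haar_system[where A = UNIV and M = \<mu> and K = K
        and u = "\<lambda>k b h. fst k + h" and v = "\<lambda>k b. cmp K (snd k) (act (fst k) b)"])
    show "emeasure \<mu> U > 0" if "open U" "U \<inter> UNIV \<noteq> {}" for U
      using left_haar_measure_open_pos[OF \<mu>] that by auto
    show "emeasure \<mu> {h \<in> UNIV. fst k + h \<in> S} = emeasure \<mu> S" if "S \<in> sets borel" for k :: "'g \<times> 'a" and S
      using left_haar_measure_translate[OF \<mu> that] by simp
    show "emeasure (haar K (src ?X k)) {b \<in> rfibre K (src ?X k). cmp K (snd k) (act (fst k) b) \<in> S} =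
        emeasure (haar K (rng ?X k)) S" if "k \<in> arr ?X" "S \<in> sets borel" for k S
      using v[of "snd k" S "fst k"] that by (cases k) simp
    show "cmp ?X k (h, b) = (fst k + h, cmp K (snd k) (act (fst k) b))" for k h b
      by (cases k) simp
  qed (use groupoid left_haar_measure_radon[OF \<mu>] lc' tg in simp_all)
qed

section \<open>Skew products\<close>

lemma skew_product_simps [simp]:
  "arr (skew_product q K) = UNIV \<times> arr K"
  "obj (skew_product q K) = UNIV \<times> obj K"
  "src (skew_product q K) (g, k) = (g + q k, src K k)"
  "rng (skew_product q K) (g, k) = (g, rng K k)"
  "idt (skew_product q K) (g, x) = (g, idt K x)"
  "cmp (skew_product q K) (g, k) (g', k') = (g, cmp K k k')"
  "ivt (skew_product q K) (g, k) = (g + q k, ivt K k)"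
  "haar (skew_product q K) (g, x) = distr (haar K x) borel (\<lambda>k. (g, k))"
  by (simp_all add: skew_product_def)

text \<open>Continuous functors to the group, which is a groupoid with one unit.\<close>

locale groupoid_cocycle = top_groupoid K
  for K :: "('k::topological_space, 'x::topological_space) groupoid" +
  fixes q :: "'k \<Rightarrow> 'g::topological_group_add"
  assumes q_cont: "continuous_on (arr K) q"
    and q_cmp: "k \<in> arr K \<Longrightarrow> l \<in> arr K \<Longrightarrow> src K k = rng K l \<Longrightarrow> q (cmp K k l) = q k + q l"
begin

lemma q_idt: "x \<in> obj K \<Longrightarrow> q (idt K x) = 0"
  using q_cmp[of "idt K x" "idt K x"] by simp (metis add_left_cancel add.right_neutral)

lemma q_ivt: "k \<in> arr K \<Longrightarrow> q (ivt K k) = - q k"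
  using q_cmp[of k "ivt K k"] q_idt[of "rng K k"] by (simp add: eq_neg_iff_add_eq_0 minus_unique)

lemma skew_product_topological: "topological_groupoid (skew_product q K)"
  (is "topological_groupoid ?X")
proof (rule topological_groupoidI)
  note qc = continuous_on_compose2[OF q_cont]
  show "continuous_on (arr ?X) (src ?X)" "continuous_on (arr ?X) (rng ?X)"
    "continuous_on (obj ?X) (idt ?X)" "continuous_on (arr ?X) (ivt ?X)"
    unfolding skew_product_def
    by (auto simp: case_prod_unfold intro!: src_cont rng_cont idt_cont ivt_cont qc continuous_intros)
  have "continuous_on (composable ?X) (\<lambda>x. (fst (fst x), cmp K (snd (fst x)) (snd (snd x))))"
    by (intro continuous_on_Pair cmp_cont) (auto simp: composable_iff intro!: continuous_intros)
  then show "continuous_on (composable ?X) (\<lambda>(k, l). cmp ?X k l)"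
    by (rule continuous_on_eq) (auto simp: composable_iff)
qed (auto simp: q_cmp q_idt q_ivt cmp_assoc add.assoc simp del: add_uminus_conv_diff)

end

lemma emeasure_distr_Pair:
  fixes M :: "'k::topological_space measure" and S :: "('g::topological_space \<times> 'k) set"
  assumes "sets M = sets borel" "S \<in> sets borel"
  shows "emeasure (distr M borel (Pair g)) S = emeasure M {k. (g, k) \<in> S}"
proof -
  have sp: "space M = UNIV" using sets_eq_imp_space_eq[OF assms(1)] by simp
  have "Pair g \<in> borel_measurable (borel :: 'k measure)"
    by (intro borel_measurable_continuous_onI continuous_intros)
  then have "Pair g \<in> measurable M borel"
    using assms(1) by (simp cong: measurable_cong_sets)
  then show ?thesis
    using assms(2) by (simp add: emeasure_distr sp vimage_def)
qed

lemma skew_product_rfibre: "rfibre (skew_product q K) (g, x) = {g} \<times> rfibre K x"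
  unfolding rfibre_def by auto

text \<open>Over \<open>(g, x)\<close> the measure is a copy of the one over \<open>x\<close>, and \<open>(g, k)\<close> acts like \<open>k\<close>.  The only
  new point is continuity in \<open>g\<close>.\<close>

lemma skew_product_groupoid:
  fixes K :: "('k::{t2_space, second_countable_topology}, 'x::topological_space) groupoid"
    and q :: "'k \<Rightarrow> 'g::{topological_group_add, t2_space, second_countable_topology}"
  assumes K: "groupoid K" and q: "groupoid_cocycle K q"
    and lc: "locally_compact_space (euclidean :: 'g topology)"
  shows "groupoid (skew_product q K)" (is "groupoid ?X")
proof (rule groupoidI)
  interpret groupoid_cocycle K q by (rule q)
  note lcK = groupoidD(2)[OF K] and H = left_haar_systemD[OF groupoidD(3)[OF K]]
  have lc': "locally_compact_space (top_of_set (UNIV :: 'g set))"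
    using lc by simp
  show tg: "topological_groupoid ?X" by (rule skew_product_topological)
  show lcX: "locally_compact_space (top_of_set (arr ?X))"
    unfolding skew_product_simps by (rule locally_compact_Times[OF lc' lcK])
  interpret X: top_groupoid ?X using tg by unfold_locales
  have Pc: "continuous_on UNIV (Pair g :: 'k \<Rightarrow> 'g \<times> 'k)" for g
    by (intro continuous_intros)
  show "left_haar_system ?X"
  proof (rule left_haar_systemI)
    fix gx assume gx: "gx \<in> obj ?X"
    then obtain g x where x: "gx = (g, x)" "x \<in> obj K" by auto
    note Hd = radon_onD[OF H(1)[OF x(2)]]
    note em = emeasure_distr_Pair[OF Hd(1)]
    have Pm: "Pair g \<in> measurable (haar K x) (borel :: ('g \<times> 'k) measure)"
      using borel_measurable_continuous_onI[OF Pc] Hd(1) by (simp cong: measurable_cong_sets)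
    have "AE k in haar K x. (g, k) \<in> rfibre ?X gx"
      using H(2)[OF x(2)] unfolding x(1) skew_product_rfibre by (auto elim!: eventually_mono)
    then show AE: "AE k in haar ?X gx. k \<in> rfibre ?X gx"
      unfolding x(1) skew_product_simps using rfibre_borel[OF tg locally_compact_borel[OF lcX] gx]
      by (subst AE_distr_iff[OF Pm]) (auto simp: x(1))
    show "radon_on (arr ?X) (haar ?X gx)"
      unfolding radon_on_def
    proof (intro conjI allI impI)
      show "sets (haar ?X gx) = sets borel" unfolding x(1) by simp
      show "AE a in haar ?X gx. a \<in> arr ?X" using AE by eventually_elim (simp add: rfibre_def)
      fix C assume C: "compact C \<and> C \<subseteq> arr ?X"
      have s: "compact (snd ` C)" "snd ` C \<subseteq> arr K"
        using C by (auto intro!: compact_continuous_image continuous_intros)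
      have "emeasure (haar ?X gx) C = emeasure (haar K x) {k. (g, k) \<in> C}"
        unfolding x(1) skew_product_simps using C by (intro em borel_compact) auto
      also have "\<dots> \<le> emeasure (haar K x) (snd ` C)"
        by (rule emeasure_mono) (use s Hd(1) in \<open>auto intro: borel_compact rev_image_eqI\<close>)
      also have "\<dots> < \<infinity>" using Hd(3)[OF s] .
      finally show "emeasure (haar ?X gx) C < \<infinity>" .
    qed
    fix U assume U: "open U" "U \<inter> rfibre ?X gx \<noteq> {}"
    have "open {k. (g, k) \<in> U}"
      using open_vimage[OF U(1) Pc[of g]] unfolding vimage_def .
    moreover have "{k. (g, k) \<in> U} \<inter> rfibre K x \<noteq> {}"
      using U(2) unfolding x(1) skew_product_rfibre by auto
    ultimately have "emeasure (haar K x) {k. (g, k) \<in> U} > 0" by (rule H(3)[OF x(2)])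
    then show "emeasure (haar ?X gx) U > 0"
      unfolding x(1) skew_product_simps using U(1) by (subst em) auto
  next
    fix f assume f: "f \<in> Cc (arr ?X)"
    have c: "continuous_on (UNIV \<times> obj K) (\<lambda>(g, x). \<integral>k. f (g, k) \<partial>haar K x)"
      by (rule Cc_integral_jointly_continuous[OF lcK]) (use f H in auto)
    have "continuous_on (UNIV \<times> obj K) (\<lambda>gx. \<integral>k. f k \<partial>haar ?X gx)"
    proof (rule continuous_on_eq[OF c], clarify)
      fix g x assume x: "x \<in> obj K"
      note Hd = radon_onD[OF H(1)[OF x]]
      have Pm: "Pair g \<in> measurable (haar K x) (borel :: ('g \<times> 'k) measure)"
        using borel_measurable_continuous_onI[OF Pc] Hd(1) by (simp cong: measurable_cong_sets)
      have fm: "f \<in> borel_measurable borel"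
        using f by (rule Cc_borel_measurable)
      show "(\<integral>k. f (g, k) \<partial>haar K x) = (\<integral>k. f k \<partial>haar ?X (g, x))"
        unfolding skew_product_simps by (rule integral_distr[OF Pm fm, symmetric])
    qed
    then show "continuous_on (obj ?X) (\<lambda>gx. \<integral>k. f k \<partial>haar ?X gx)" by simp
  next
    fix gk and B :: "('g \<times> 'k) set" assume gk: "gk \<in> arr ?X" and B: "B \<in> sets borel"
    then obtain g k where k: "gk = (g, k)" "k \<in> arr K" by auto
    have so: "src ?X gk \<in> obj ?X" using gk by (rule X.src_obj)
    have sets: "sets (haar K (src K k)) = sets borel" "sets (haar K (rng K k)) = sets borel"
      using radon_onD(1)[OF H(1)] k by auto
    have "{l \<in> rfibre ?X (src ?X gk). cmp ?X gk l \<in> B} \<in> sets borel"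
      by (rule borel_continuous_preimage[OF _ rfibre_borel[OF tg locally_compact_borel[OF lcX] so] B])
        (use gk in \<open>auto simp: rfibre_def composable_iff intro!: X.cmp_cont continuous_intros\<close>)
    then have "emeasure (haar ?X (src ?X gk)) {l \<in> rfibre ?X (src ?X gk). cmp ?X gk l \<in> B} =
        emeasure (haar K (src K k)) {l. (g + q k, l) \<in> {l \<in> rfibre ?X (src ?X gk). cmp ?X gk l \<in> B}}"
      unfolding k(1) skew_product_simps by (rule emeasure_distr_Pair[OF sets(1)])
    also have "{l. (g + q k, l) \<in> {l \<in> rfibre ?X (src ?X gk). cmp ?X gk l \<in> B}} =
        {l \<in> rfibre K (src K k). cmp K k l \<in> {l. (g, l) \<in> B}}"
      by (auto simp: k(1) skew_product_rfibre)
    also have "emeasure (haar K (src K k)) \<dots> = emeasure (haar K (rng K k)) {l. (g, l) \<in> B}"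
    proof (rule H(5)[OF k(2)])
      show "{l. (g, l) \<in> B} \<in> sets borel"
        using measurable_sets[OF borel_measurable_continuous_onI[OF Pc] B, of g] by (simp add: vimage_def)
    qed
    also have "\<dots> = emeasure (haar ?X (rng ?X gk)) B"
      unfolding k(1) skew_product_simps by (rule emeasure_distr_Pair[OF sets(2) B, symmetric])
    finally show "emeasure (haar ?X (src ?X gk)) {l \<in> rfibre ?X (src ?X gk). cmp ?X gk l \<in> B} =
        emeasure (haar ?X (rng ?X gk)) B" .
  qed
qed

lemma translation_simp [simp]: "translation g (h, k) = (g + h, k)"
  by (simp add: translation_def)

lemma skew_product_obj_act [simp]:
  "obj_act (skew_product q K) translation g (h, x) = (g + h, rng K (idt K x))"
  by (simp add: obj_act_def)

lemma skew_product_G_groupoid: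
  fixes K :: "('k::{t2_space, second_countable_topology}, 'x::topological_space) groupoid"
    and q :: "'k \<Rightarrow> 'g::{topological_group_add, t2_space, second_countable_topology}"
  assumes K: "groupoid K" and q: "groupoid_cocycle K q"
    and lc: "locally_compact_space (euclidean :: 'g topology)"
  shows "G_groupoid (skew_product q K) translation" (is "G_groupoid ?X _")
proof -
  interpret groupoid_cocycle K q by (rule q)
  note H = left_haar_systemD[OF groupoidD(3)[OF K]]
  have X: "groupoid ?X" using skew_product_groupoid[OF K q lc] .
  have "emeasure (haar ?X gx) {a \<in> rfibre ?X gx. translation g a \<in> B} =
      emeasure (haar ?X (obj_act ?X translation g gx)) B"
    if gx: "gx \<in> obj ?X" and B: "B \<in> sets borel" for g gx B
  proof -
    obtain h x where x: "gx = (h, x)" "x \<in> obj K" using gx by auto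
    note Hd = radon_onD[OF H(1)[OF x(2)]]
    have c: "continuous_on S (translation g :: 'g \<times> 'k \<Rightarrow> 'g \<times> 'k)" for S
      unfolding translation_def by (auto simp: case_prod_unfold intro!: continuous_intros)
    have Pb: "{k. (g + h, k) \<in> B} \<in> sets borel"
    proof -
      have "Pair (g + h) \<in> borel_measurable (borel :: 'k measure)"
        by (intro borel_measurable_continuous_onI continuous_intros)
      from measurable_sets[OF this B] show ?thesis by (simp add: vimage_def)
    qed
    have Fb: "rfibre K x \<in> sets borel"
      by (rule rfibre_borel[OF groupoidD(1)[OF K] locally_compact_borel[OF groupoidD(2)[OF K]] x(2)])
    have "{a \<in> rfibre ?X gx. translation g a \<in> B} \<in> sets borel"
      by (rule borel_continuous_preimage[OF c
            rfibre_borel[OF groupoidD(1)[OF X] locally_compact_borel[OF groupoidD(2)[OF X]] gx] B])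
    then have "emeasure (haar ?X gx) {a \<in> rfibre ?X gx. translation g a \<in> B} =
        emeasure (haar K x) {k. (h, k) \<in> {a \<in> rfibre ?X gx. translation g a \<in> B}}"
      unfolding x(1) skew_product_simps by (rule emeasure_distr_Pair[OF Hd(1)])
    also have "{k. (h, k) \<in> {a \<in> rfibre ?X gx. translation g a \<in> B}} = rfibre K x \<inter> {k. (g + h, k) \<in> B}"
      by (auto simp: x(1) skew_product_rfibre)
    also have "emeasure (haar K x) \<dots> = emeasure (haar K x) {k. (g + h, k) \<in> B}"
    proof (rule emeasure_eq_AE)
      show "AE k in haar K x. (k \<in> rfibre K x \<inter> {k. (g + h, k) \<in> B}) = (k \<in> {k. (g + h, k) \<in> B})"
        using H(2)[OF x(2)] by eventually_elim auto
    qed (use Pb Fb Hd(1) in auto)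
    also have "\<dots> = emeasure (haar ?X (obj_act ?X translation g gx)) B"
      using emeasure_distr_Pair[OF Hd(1) B, of "g + h"] x by simp
    finally show ?thesis .
  qed
  moreover have "continuous_action (arr ?X) translation"
    unfolding continuous_action_def translation_def
    by (auto simp: add.assoc case_prod_unfold intro!: continuous_intros)
  ultimately show ?thesis
    unfolding G_groupoid_def using X by (auto simp: composable_iff add.assoc)
qed

section \<open>Cocycles and gerbes\<close>

lemma U1_iff: "z \<in> U1 \<longleftrightarrow> norm z = 1"
  by (simp add: U1_def)

lemma U1_simps [simp]:
  "1 \<in> U1" "z \<in> U1 \<Longrightarrow> w \<in> U1 \<Longrightarrow> z * w \<in> U1" "z \<in> U1 \<Longrightarrow> inverse z \<in> U1"
  "z \<in> U1 \<Longrightarrow> w \<in> U1 \<Longrightarrow> z / w \<in> U1"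
  by (auto simp: U1_iff norm_mult norm_inverse norm_divide)

lemma U1_nonzero: "z \<in> U1 \<Longrightarrow> z \<noteq> 0"
  by (auto simp: U1_iff)

lemma gerbe_simps [simp]:
  "arr (gerbe \<omega> K) = U1 \<times> arr K"
  "obj (gerbe \<omega> K) = obj K"
  "src (gerbe \<omega> K) (\<theta>, a) = src K a"
  "rng (gerbe \<omega> K) (\<theta>, a) = rng K a"
  "idt (gerbe \<omega> K) x = (1, idt K x)"
  "cmp (gerbe \<omega> K) (\<theta>, a) (\<theta>', b) = (\<theta> * \<theta>' * \<omega> a b, cmp K a b)"
  "ivt (gerbe \<omega> K) (\<theta>, a) = (inverse (\<theta> * \<omega> a (ivt K a)), ivt K a)"
  "haar (gerbe \<omega> K) x = U1_haar \<Otimes>\<^sub>M haar K x"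
  by (simp_all add: gerbe_def)

locale twisted_groupoid = top_groupoid K
  for K :: "('a::topological_space, 'x::topological_space) groupoid" +
  fixes \<omega> :: "'a \<Rightarrow> 'a \<Rightarrow> complex"
  assumes Z2: "\<omega> \<in> Z2 K"
begin

lemma
  shows \<omega>_U1 [simp]: "a \<in> arr K \<Longrightarrow> b \<in> arr K \<Longrightarrow> src K a = rng K b \<Longrightarrow> \<omega> a b \<in> U1"
    and \<omega>_idt_left [simp]: "a \<in> arr K \<Longrightarrow> x = rng K a \<Longrightarrow> \<omega> (idt K x) a = 1"
    and \<omega>_idt_right [simp]: "a \<in> arr K \<Longrightarrow> x = src K a \<Longrightarrow> \<omega> a (idt K x) = 1"
    and \<omega>_cocycle: "a \<in> arr K \<Longrightarrow> b \<in> arr K \<Longrightarrow> c \<in> arr K \<Longrightarrow> src K a = rng K b \<Longrightarrow> src K b = rng K c \<Longrightarrow>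
      \<omega> b c * \<omega> a (cmp K b c) = \<omega> (cmp K a b) c * \<omega> a b"
  using Z2 unfolding Z2_def composable_def by auto

lemma \<omega>_cont:
  assumes "continuous_on S f" "continuous_on S g" "\<And>s. s \<in> S \<Longrightarrow> (f s, g s) \<in> composable K"
  shows "continuous_on S (\<lambda>s. \<omega> (f s) (g s))"
proof -
  have "continuous_on (composable K) (\<lambda>(a, b). \<omega> a b)"
    using Z2 unfolding Z2_def by blast
  then have "continuous_on S (\<lambda>s. (\<lambda>(a, b). \<omega> a b) (f s, g s))"
    by (rule continuous_on_compose2) (use assms in \<open>auto intro!: continuous_on_Pair\<close>)
  then show ?thesis by simp
qed

text \<open>The cocycle identity for \<open>a\<close>, \<open>a\<^sup>-\<^sup>1\<close>, \<open>a\<close>.  It makes inverses in the gerbe two-sided.\<close>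

lemma \<omega>_ivt: "a \<in> arr K \<Longrightarrow> \<omega> (ivt K a) a = \<omega> a (ivt K a)"
  using \<omega>_cocycle[of a "ivt K a" a] by simp

lemma gerbe_topological: "topological_groupoid (gerbe \<omega> K)" (is "topological_groupoid ?X")
proof (rule topological_groupoidI)
  fix k l m assume "k \<in> arr ?X" "l \<in> arr ?X" "m \<in> arr ?X" and s: "src ?X k = rng ?X l" "src ?X l = rng ?X m"
  then obtain \<theta> a \<theta>' b \<theta>'' c where k: "k = (\<theta>, a)" "l = (\<theta>', b)" "m = (\<theta>'', c)"
      and abc: "a \<in> arr K" "b \<in> arr K" "c \<in> arr K" by auto
  show "cmp ?X (cmp ?X k l) m = cmp ?X k (cmp ?X l m)"
    using s abc \<omega>_cocycle[of a b c] by (simp add: k cmp_assoc mult_ac)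
next
  fix k assume "k \<in> arr ?X"
  then obtain \<theta> a where k: "k = (\<theta>, a)" "\<theta> \<in> U1" "a \<in> arr K" by auto
  have nz: "\<theta> \<noteq> 0" "\<omega> a (ivt K a) \<noteq> 0" using k U1_nonzero[of \<theta>] U1_nonzero[of "\<omega> a (ivt K a)"] by auto
  show "src ?X (ivt ?X k) = rng ?X k \<and> rng ?X (ivt ?X k) = src ?X k \<and>
      cmp ?X k (ivt ?X k) = idt ?X (rng ?X k) \<and> cmp ?X (ivt ?X k) k = idt ?X (src ?X k)"
    using k nz by (simp add: \<omega>_ivt field_simps)
next
  show "continuous_on (arr ?X) (src ?X)" "continuous_on (arr ?X) (rng ?X)" "continuous_on (obj ?X) (idt ?X)"
    unfolding gerbe_def
    by (auto simp: case_prod_unfold intro!: src_cont rng_cont idt_cont continuous_intros)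
  have "continuous_on (U1 \<times> arr K) (\<lambda>x. (inverse (fst x * \<omega> (snd x) (ivt K (snd x))), ivt K (snd x)))"
    by (intro continuous_on_Pair continuous_on_inverse continuous_on_mult \<omega>_cont ivt_cont)
      (auto simp: composable_iff U1_nonzero intro!: continuous_intros)
  then show "continuous_on (arr ?X) (ivt ?X)"
    unfolding gerbe_simps by (rule continuous_on_eq) auto
  have "continuous_on (composable ?X) (\<lambda>x. (fst (fst x) * fst (snd x) * \<omega> (snd (fst x)) (snd (snd x)),
      cmp K (snd (fst x)) (snd (snd x))))"
    by (intro continuous_on_Pair continuous_on_mult cmp_cont \<omega>_cont)
      (auto simp: composable_iff intro!: continuous_intros)
  then show "continuous_on (composable ?X) (\<lambda>(k, l). cmp ?X k l)"
    by (rule continuous_on_eq) (auto simp: composable_iff)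
qed auto

end

lemma gerbe_groupoid:
  fixes K :: "('a::{t2_space, second_countable_topology}, 'x::topological_space) groupoid"
  assumes K: "groupoid K" and \<omega>: "\<omega> \<in> Z2 K"
  shows "groupoid (gerbe \<omega> K)" (is "groupoid ?X")
proof (rule groupoidI)
  interpret twisted_groupoid K \<omega>
    using groupoidD(1)[OF K] \<omega> by unfold_locales
  note H = left_haar_systemD[OF groupoidD(3)[OF K]]
  show tg: "topological_groupoid ?X" by (rule gerbe_topological)
  show "locally_compact_space (top_of_set (arr ?X))"
    unfolding gerbe_simps by (rule locally_compact_Times[OF U1_locally_compact groupoidD(2)[OF K]])
  show "left_haar_system ?X"
  proof (rule product_left_haar_system[where A = U1 and M = U1_haar and K = K
        and u = "\<lambda>k b h. fst k * h * \<omega> (snd k) b" and v = "\<lambda>k b. cmp K (snd k) b"])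
    show "U1 \<noteq> {}" using U1_simps(1) by blast
    show "emeasure U1_haar {h \<in> U1. fst k * h * \<omega> (snd k) b \<in> S} = emeasure U1_haar S"
      if "k \<in> arr ?X" "b \<in> rfibre K (src ?X k)" "S \<in> sets borel" for k b S
    proof -
      have "fst k * \<omega> (snd k) b \<in> U1" using that by (auto simp: rfibre_def)
      from U1_haar_rotate[OF this that(3)] show ?thesis by (simp add: mult_ac)
    qed
    show "emeasure (haar K (src ?X k)) {b \<in> rfibre K (src ?X k). cmp K (snd k) b \<in> S} =
        emeasure (haar K (rng ?X k)) S" if "k \<in> arr ?X" "S \<in> sets borel" for k S
      using that H(5) by auto
  qed (use K U1_haar_radon U1_locally_compact U1_haar_open_pos tg in auto)
qed

text \<open>Here \<open>f\<close> is a continuous functor with unit map \<open>f0\<close>: composable pairs go to composable pairs,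
  and each condition on a cocycle of \<open>K\<close> becomes one for \<open>M\<close>.\<close>

lemma Z2_pullback:
  assumes K: "topological_groupoid K" and M: "\<omega> \<in> Z2 M"
    and f: "continuous_on (arr K) f" "f ` arr K \<subseteq> arr M"
    and f0: "\<And>a. a \<in> arr K \<Longrightarrow> src M (f a) = f0 (src K a) \<and> rng M (f a) = f0 (rng K a)"
    and idt: "\<And>x. x \<in> obj K \<Longrightarrow> f (idt K x) = idt M (f0 x)"
    and cmp: "\<And>a b. a \<in> arr K \<Longrightarrow> b \<in> arr K \<Longrightarrow> src K a = rng K b \<Longrightarrow>
      f (cmp K a b) = cmp M (f a) (f b)"
  shows "(\<lambda>a b. \<omega> (f a) (f b)) \<in> Z2 K"
proof -
  interpret top_groupoid K using K by unfold_locales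
  have comp: "(f a, f b) \<in> composable M" if "(a, b) \<in> composable K" for a b
    using that f f0 by (auto simp: composable_iff)
  have c: "continuous_on (composable M) (\<lambda>(a, b). \<omega> a b)"
    using M unfolding Z2_def by blast
  have "continuous_on (composable K) (\<lambda>x. (\<lambda>(a, b). \<omega> a b) (f (fst x), f (snd x)))"
  proof (rule continuous_on_compose2[OF c])
    show "continuous_on (composable K) (\<lambda>x. (f (fst x), f (snd x)))"
      by (intro continuous_on_Pair continuous_on_compose2[OF f(1)] continuous_intros)
        (auto simp: composable_iff)
  qed (use comp in auto)
  then have "continuous_on (composable K) (\<lambda>(a, b). \<omega> (f a) (f b))"
    by (simp add: case_prod_unfold)
  moreover have "\<omega> (f b) (f c) * \<omega> (f a) (f (cmp K b c)) = \<omega> (f (cmp K a b)) (f c) * \<omega> (f a) (f b)"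
    if "(a, b) \<in> composable K" "(b, c) \<in> composable K" for a b c
    using that M comp[OF that(1)] comp[OF that(2)] cmp unfolding Z2_def by (auto simp: composable_iff)
  moreover have "\<omega> (f (idt K (rng K a))) (f a) = 1 \<and> \<omega> (f a) (f (idt K (src K a))) = 1"
    if "a \<in> arr K" for a
  proof -
    have "f a \<in> arr M" using f that by blast
    then have "\<omega> (idt M (rng M (f a))) (f a) = 1 \<and> \<omega> (f a) (idt M (src M (f a))) = 1"
      using M unfolding Z2_def by blast
    then show ?thesis using that idt f0 by simp
  qed
  moreover have "\<omega> (f a) (f b) \<in> U1" if "(a, b) \<in> composable K" for a b
    using M comp[OF that] unfolding Z2_def by blast
  ultimately show ?thesis unfolding Z2_def by blast
qed

section \<open>Bimodules with division maps\<close>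

text \<open>Such an \<open>f\<close> is a homeomorphism onto a closed subspace.\<close>

lemma proper_map_left_inverse:
  fixes f :: "'a::topological_space \<Rightarrow> 'b::topological_space"
  assumes f: "continuous_on X f" and cl: "closedin (top_of_set Y) (f ` X)"
    and g: "continuous_on (f ` X) g" and gf: "\<And>x. x \<in> X \<Longrightarrow> g (f x) = x"
  shows "proper_map (top_of_set X) (top_of_set Y) f"
proof (rule closed_injective_imp_proper_map)
  show "inj_on f (topspace (top_of_set X))"
    using gf by (metis inj_on_def topspace_euclidean_subtopology)
  show "closed_map (top_of_set X) (top_of_set Y) f"
    unfolding closed_map_def
  proof (intro allI impI)
    fix C assume C: "closedin (top_of_set X) C"
    then have "C \<subseteq> X" by (rule closedin_imp_subset)
    then have "f ` C = f ` X \<inter> g -` C" using gf by force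
    moreover have "closedin (top_of_set (f ` X)) (f ` X \<inter> g -` C)"
      by (rule continuous_closedin_preimage_gen[OF g _ C]) (use gf in auto)
    ultimately show "closedin (top_of_set Y) (f ` C)"
      using closedin_trans cl by metis
  qed
qed

lemma closedin_equalizer:
  fixes f g :: "'a::topological_space \<Rightarrow> 'b::t2_space"
  assumes "continuous_on S f" "continuous_on S g"
  shows "closedin (top_of_set S) {x \<in> S. f x = g x}"
proof -
  have "closedin (top_of_set S) (S \<inter> (\<lambda>x. (f x, g x)) -` {y. \<exists>x. y = (x, x)})"
    by (intro continuous_closedin_preimage continuous_on_Pair assms closed_diagonal)
  moreover have "S \<inter> (\<lambda>x. (f x, g x)) -` {y. \<exists>x. y = (x, x)} = {x \<in> S. f x = g x}" by auto
  ultimately show ?thesis by simp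
qed

lemma openin_quotient_space:
  "openin (quotient_space P c) V \<longleftrightarrow> V \<subseteq> c ` P \<and> openin (top_of_set P) {p \<in> P. c p \<in> V}"
  unfolding quotient_space_def topology_inverse'[OF istopology_quotient_space] ..

lemma topspace_quotient_space: "topspace (quotient_space P c) = c ` P"
proof
  show "topspace (quotient_space P c) \<subseteq> c ` P"
    using openin_topspace[of "quotient_space P c"] unfolding openin_quotient_space by blast
  have "{p \<in> P. c p \<in> c ` P} = P" by auto
  then have "openin (quotient_space P c) (c ` P)"
    unfolding openin_quotient_space by simp
  then show "c ` P \<subseteq> topspace (quotient_space P c)" by (rule openin_subset)
qed

text \<open>The section provides the inverse map, \<open>x \<mapsto> c (s x)\<close>.\<close>

lemma induces_homeomorphismI:
  fixes m :: "'p::topological_space \<Rightarrow> 'x::topological_space"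
  assumes m: "continuous_on P m" "m ` P \<subseteq> B"
    and s: "continuous_on B s" "\<And>x. x \<in> B \<Longrightarrow> s x \<in> P \<and> m (s x) = x"
    and c: "\<And>p p'. p \<in> P \<Longrightarrow> p' \<in> P \<Longrightarrow> c p = c p' \<longleftrightarrow> m p = m p'"
  shows "induces_homeomorphism P c m B"
proof -
  define f where "f z = m (SOME p. p \<in> P \<and> c p = z)" for z
  have f: "f (c p) = m p" if "p \<in> P" for p
  proof -
    have "\<exists>p'. p' \<in> P \<and> c p' = c p" using that by blast
    then have "(SOME p'. p' \<in> P \<and> c p' = c p) \<in> P \<and> c (SOME p'. p' \<in> P \<and> c p' = c p) = c p"
      by (rule someI_ex)
    then show ?thesis unfolding f_def using c[OF _ that] by blast
  qed
  have "homeomorphic_maps (quotient_space P c) (top_of_set B) f (\<lambda>x. c (s x))"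
    unfolding homeomorphic_maps_def topspace_quotient_space
  proof (intro conjI ballI)
    show "continuous_map (quotient_space P c) (top_of_set B) f"
      unfolding continuous_map_def topspace_quotient_space
    proof (intro conjI allI impI)
      show "f \<in> c ` P \<rightarrow> topspace (top_of_set B)" using f m(2) by auto
      fix U assume U: "openin (top_of_set B) U"
      have "c p \<in> {z \<in> c ` P. f z \<in> U} \<longleftrightarrow> m p \<in> U" if "p \<in> P" for p
        using f[OF that] that by simp
      then have "{p \<in> P. c p \<in> {z \<in> c ` P. f z \<in> U}} = P \<inter> m -` U" by blast
      moreover have "openin (top_of_set P) (P \<inter> m -` U)"
        by (rule continuous_openin_preimage[OF m(1) _ U]) (use m(2) in auto)
      ultimately show "openin (quotient_space P c) {z \<in> c ` P. f z \<in> U}"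
        unfolding openin_quotient_space by auto
    qed
    show "continuous_map (top_of_set B) (quotient_space P c) (\<lambda>x. c (s x))"
      unfolding continuous_map_def topspace_quotient_space
    proof (intro conjI allI impI)
      show "(\<lambda>x. c (s x)) \<in> topspace (top_of_set B) \<rightarrow> c ` P" using s(2) by auto
      fix V assume V: "openin (quotient_space P c) V"
      have "{x \<in> topspace (top_of_set B). c (s x) \<in> V} = B \<inter> s -` {p \<in> P. c p \<in> V}" using s(2) by auto
      moreover have "openin (top_of_set B) (B \<inter> s -` {p \<in> P. c p \<in> V})"
        using V unfolding openin_quotient_space
        by (intro continuous_openin_preimage[OF s(1), where T = P]) (use s(2) in auto)
      ultimately show "openin (top_of_set B) {x \<in> topspace (top_of_set B). c (s x) \<in> V}" by simp
    qed
    show "c (s (f z)) = z" if "z \<in> c ` P" for z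
      using that f c m(2) s(2) by (auto simp: image_subset_iff)
    show "f (c (s x)) = x" if "x \<in> topspace (top_of_set B)" for x
      using that f s(2) by auto
  qed
  then show ?thesis
    unfolding induces_homeomorphism_def homeomorphic_map_maps using f by blast
qed

text \<open>If \<open>p = k p'\<close>, then \<open>k\<close> is the left quotient \<open>dl p p'\<close>.  Continuity of the quotient makes
  the left action free and proper; its existence for all \<open>p\<close>, \<open>p'\<close> with the same right moment makes
  the map from left orbits to right moments injective, and the section \<open>sr\<close> gives the inverse
  homeomorphism.  The right action is treated in the same way, with \<open>p' = p h\<close> for \<open>h = dr p p'\<close>.\<close>

locale division_bimodule = K: top_groupoid K + H: top_groupoid H
  for K :: "('a::topological_space, 'x::topological_space) groupoid"
    and H :: "('b::topological_space, 'y::topological_space) groupoid" +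
  fixes P :: "('p::topological_space, 'a, 'x, 'b, 'y) bimodule"
    and dl :: "'p \<Rightarrow> 'p \<Rightarrow> 'a" and dr :: "'p \<Rightarrow> 'p \<Rightarrow> 'b" and sl :: "'x \<Rightarrow> 'p" and sr :: "'y \<Rightarrow> 'p"
  assumes lmom_obj [simp]: "p \<in> pts P \<Longrightarrow> lmom P p \<in> obj K"
    and rmom_obj [simp]: "p \<in> pts P \<Longrightarrow> rmom P p \<in> obj H"
    and lact_type: "k \<in> arr K \<Longrightarrow> p \<in> pts P \<Longrightarrow> src K k = lmom P p \<Longrightarrow>
      lact P k p \<in> pts P \<and> lmom P (lact P k p) = rng K k \<and> rmom P (lact P k p) = rmom P p"
    and ract_type: "p \<in> pts P \<Longrightarrow> h \<in> arr H \<Longrightarrow> rmom P p = rng H h \<Longrightarrow>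
      ract P p h \<in> pts P \<and> rmom P (ract P p h) = src H h \<and> lmom P (ract P p h) = lmom P p"
    and lact_idt: "p \<in> pts P \<Longrightarrow> lact P (idt K (lmom P p)) p = p"
    and ract_idt: "p \<in> pts P \<Longrightarrow> ract P p (idt H (rmom P p)) = p"
    and lact_cmp: "k \<in> arr K \<Longrightarrow> k' \<in> arr K \<Longrightarrow> p \<in> pts P \<Longrightarrow> src K k = rng K k' \<Longrightarrow> src K k' = lmom P p \<Longrightarrow>
      lact P (cmp K k k') p = lact P k (lact P k' p)"
    and ract_cmp: "p \<in> pts P \<Longrightarrow> h \<in> arr H \<Longrightarrow> h' \<in> arr H \<Longrightarrow> rmom P p = rng H h \<Longrightarrow> src H h = rng H h' \<Longrightarrow>
      ract P p (cmp H h h') = ract P (ract P p h) h'"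
    and lact_ract: "k \<in> arr K \<Longrightarrow> p \<in> pts P \<Longrightarrow> h \<in> arr H \<Longrightarrow> src K k = lmom P p \<Longrightarrow> rmom P p = rng H h \<Longrightarrow>
      ract P (lact P k p) h = lact P k (ract P p h)"
    and dl: "p \<in> pts P \<Longrightarrow> p' \<in> pts P \<Longrightarrow> rmom P p = rmom P p' \<Longrightarrow>
      dl p p' \<in> arr K \<and> src K (dl p p') = lmom P p' \<and> lact P (dl p p') p' = p"
    and dl_lact: "k \<in> arr K \<Longrightarrow> p \<in> pts P \<Longrightarrow> src K k = lmom P p \<Longrightarrow> dl (lact P k p) p = k"
    and dr: "p \<in> pts P \<Longrightarrow> p' \<in> pts P \<Longrightarrow> lmom P p = lmom P p' \<Longrightarrow>
      dr p p' \<in> arr H \<and> rng H (dr p p') = rmom P p \<and> ract P p (dr p p') = p'"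
    and dr_ract: "p \<in> pts P \<Longrightarrow> h \<in> arr H \<Longrightarrow> rmom P p = rng H h \<Longrightarrow> dr p (ract P p h) = h"
    and sl: "x \<in> obj K \<Longrightarrow> sl x \<in> pts P \<and> lmom P (sl x) = x"
    and sr: "y \<in> obj H \<Longrightarrow> sr y \<in> pts P \<and> rmom P (sr y) = y"
    and lmom_continuous: "continuous_on (pts P) (lmom P)"
    and rmom_continuous: "continuous_on (pts P) (rmom P)"
    and lact_continuous: "continuous_on (lpairs K P) (\<lambda>x. lact P (fst x) (snd x))"
    and ract_continuous: "continuous_on (rpairs H P) (\<lambda>x. ract P (fst x) (snd x))"
    and dl_continuous: "continuous_on {x \<in> pts P \<times> pts P. rmom P (fst x) = rmom P (snd x)} (\<lambda>x. dl (fst x) (snd x))"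
    and dr_continuous: "continuous_on {x \<in> pts P \<times> pts P. lmom P (fst x) = lmom P (snd x)} (\<lambda>x. dr (fst x) (snd x))"
    and sl_continuous: "continuous_on (obj K) sl"
    and sr_continuous: "continuous_on (obj H) sr"
begin

lemma
  assumes "k \<in> arr K" "p \<in> pts P" "src K k = lmom P p"
  shows lact_pts [simp]: "lact P k p \<in> pts P"
    and lmom_lact [simp]: "lmom P (lact P k p) = rng K k"
    and rmom_lact [simp]: "rmom P (lact P k p) = rmom P p"
  using lact_type assms by auto

lemma
  assumes "p \<in> pts P" "h \<in> arr H" "rmom P p = rng H h"
  shows ract_pts [simp]: "ract P p h \<in> pts P"
    and rmom_ract [simp]: "rmom P (ract P p h) = src H h"
    and lmom_ract [simp]: "lmom P (ract P p h) = lmom P p"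
  using ract_type assms by auto

lemma
  assumes "p \<in> pts P" "p' \<in> pts P" "rmom P p = rmom P p'"
  shows dl_arr [simp]: "dl p p' \<in> arr K" and src_dl [simp]: "src K (dl p p') = lmom P p'"
    and lact_dl [simp]: "lact P (dl p p') p' = p"
  using dl assms by auto

lemma
  assumes "p \<in> pts P" "p' \<in> pts P" "lmom P p = lmom P p'"
  shows dr_arr [simp]: "dr p p' \<in> arr H" and rng_dr [simp]: "rng H (dr p p') = rmom P p"
    and ract_dr [simp]: "ract P p (dr p p') = p'"
  using dr assms by auto

lemma lmom_cont: "continuous_on S f \<Longrightarrow> f ` S \<subseteq> pts P \<Longrightarrow> continuous_on S (\<lambda>s. lmom P (f s))"
  using lmom_continuous by (rule continuous_on_compose2)

lemma rmom_cont: "continuous_on S f \<Longrightarrow> f ` S \<subseteq> pts P \<Longrightarrow> continuous_on S (\<lambda>s. rmom P (f s))"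
  using rmom_continuous by (rule continuous_on_compose2)

lemma lact_cont:
  assumes "continuous_on S f" "continuous_on S p" "\<And>s. s \<in> S \<Longrightarrow> f s \<in> arr K \<and> p s \<in> pts P \<and> src K (f s) = lmom P (p s)"
  shows "continuous_on S (\<lambda>s. lact P (f s) (p s))"
  using continuous_on_compose2[OF lact_continuous continuous_on_Pair[OF assms(1,2)]] assms(3)
  by (auto simp: lpairs_def)

lemma ract_cont:
  assumes "continuous_on S p" "continuous_on S f" "\<And>s. s \<in> S \<Longrightarrow> p s \<in> pts P \<and> f s \<in> arr H \<and> rmom P (p s) = rng H (f s)"
  shows "continuous_on S (\<lambda>s. ract P (p s) (f s))"
  using continuous_on_compose2[OF ract_continuous continuous_on_Pair[OF assms(1,2)]] assms(3)
  by (auto simp: rpairs_def)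

lemma dl_cont:
  assumes "continuous_on S p" "continuous_on S p'" "\<And>s. s \<in> S \<Longrightarrow> p s \<in> pts P \<and> p' s \<in> pts P \<and> rmom P (p s) = rmom P (p' s)"
  shows "continuous_on S (\<lambda>s. dl (p s) (p' s))"
proof -
  have "(\<lambda>s. (p s, p' s)) ` S \<subseteq> {x \<in> pts P \<times> pts P. rmom P (fst x) = rmom P (snd x)}"
    using assms(3) by auto
  from continuous_on_compose2[OF dl_continuous continuous_on_Pair[OF assms(1,2)] this] show ?thesis by simp
qed

lemma dr_cont:
  assumes "continuous_on S p" "continuous_on S p'" "\<And>s. s \<in> S \<Longrightarrow> p s \<in> pts P \<and> p' s \<in> pts P \<and> lmom P (p s) = lmom P (p' s)"
  shows "continuous_on S (\<lambda>s. dr (p s) (p' s))"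
proof -
  have "(\<lambda>s. (p s, p' s)) ` S \<subseteq> {x \<in> pts P \<times> pts P. lmom P (fst x) = lmom P (snd x)}"
    using assms(3) by auto
  from continuous_on_compose2[OF dr_continuous continuous_on_Pair[OF assms(1,2)] this] show ?thesis by simp
qed

lemma rorbit_eq: "p \<in> pts P \<Longrightarrow> rorbit H P p = {p' \<in> pts P. lmom P p' = lmom P p}"
  unfolding rorbit_def rpairs_def
proof (intro set_eqI iffI)
  fix x assume p: "p \<in> pts P" and "x \<in> {p' \<in> pts P. lmom P p' = lmom P p}"
  then have "x = ract P p (dr p x)" "dr p x \<in> arr H" "rmom P p = rng H (dr p x)" by auto
  then show "x \<in> {ract P p h |h. (p, h) \<in> {(p, h). p \<in> pts P \<and> h \<in> arr H \<and> rmom P p = rng H h}}"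
    using p by blast
qed auto

lemma lorbit_eq: "p \<in> pts P \<Longrightarrow> lorbit K P p = {p' \<in> pts P. rmom P p' = rmom P p}"
  unfolding lorbit_def lpairs_def
proof (intro set_eqI iffI)
  fix x assume p: "p \<in> pts P" and "x \<in> {p' \<in> pts P. rmom P p' = rmom P p}"
  then have "x = lact P (dl x p) p" "dl x p \<in> arr K" "src K (dl x p) = lmom P p" by auto
  then show "x \<in> {lact P k p |k. (k, p) \<in> {(k, p). k \<in> arr K \<and> p \<in> pts P \<and> src K k = lmom P p}}"
    using p by blast
qed auto

end

lemma (in division_bimodule) left_action: "left_action K P"
  unfolding left_action_def
  using lact_idt lact_cmp lmom_continuous lact_continuous
  by (auto simp: lpairs_def composable_iff case_prod_unfold)

lemma (in division_bimodule) right_action: "right_action H P"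
  unfolding right_action_def
  using ract_idt ract_cmp rmom_continuous ract_continuous
  by (auto simp: rpairs_def composable_iff case_prod_unfold)

lemma (in division_bimodule) commuting_actions: "commuting_actions K H P"
  unfolding commuting_actions_def using lact_ract by (auto simp: lpairs_def rpairs_def)

text \<open>The map \<open>(k, p) \<mapsto> (k p, p)\<close> has the continuous inverse \<open>(p, p') \<mapsto> (dl p p', p')\<close> on the set of
  pairs with the same right moment, which is closed since it is defined by an equation between
  identity arrows.\<close>

lemma division_morita_equivalence:
  fixes K :: "('a::t2_space, 'x::topological_space) groupoid"
    and H :: "('b::t2_space, 'y::topological_space) groupoid"
    and P :: "('p::topological_space, 'a, 'x, 'b, 'y) bimodule"
  assumes P: "division_bimodule K H P dl dr sl sr" and gK: "groupoid K" and gH: "groupoid H"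
  shows "morita_equivalence K H P"
proof -
  interpret division_bimodule K H P dl dr sl sr by (rule P)
  define R where "R = {x \<in> pts P \<times> pts P. rmom P (fst x) = rmom P (snd x)}"
  define Q where "Q = {x \<in> pts P \<times> pts P. lmom P (fst x) = lmom P (snd x)}"
  have "free_proper_left K P"
    unfolding free_proper_left_def
  proof (intro conjI)
    show "\<forall>(k, p)\<in>lpairs K P. lact P k p = p \<longrightarrow> k = idt K (lmom P p)"
      using dl_lact lact_idt by (clarsimp simp: lpairs_def) (metis K.idt_arr K.src_idt lmom_obj)
    have im: "(\<lambda>(k, p). (lact P k p, p)) ` lpairs K P = R"
    proof
      show "(\<lambda>(k, p). (lact P k p, p)) ` lpairs K P \<subseteq> R"
        by (auto simp: lpairs_def R_def)
      show "R \<subseteq> (\<lambda>(k, p). (lact P k p, p)) ` lpairs K P"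
      proof
        fix x assume x: "x \<in> R"
        then have "x = (\<lambda>(k, p). (lact P k p, p)) (dl (fst x) (snd x), snd x)"
          "(dl (fst x) (snd x), snd x) \<in> lpairs K P"
          by (auto simp: R_def lpairs_def)
        then show "x \<in> (\<lambda>(k, p). (lact P k p, p)) ` lpairs K P" by blast
      qed
    qed
    have "R = {x \<in> pts P \<times> pts P. idt H (rmom P (fst x)) = idt H (rmom P (snd x))}"
      unfolding R_def using H.idt_inj by auto
    then have cl: "closedin (top_of_set (pts P \<times> pts P)) R"
      by (simp, intro closedin_equalizer H.idt_cont rmom_cont continuous_intros) auto
    show "proper_map (top_of_set (lpairs K P)) (top_of_set (pts P \<times> pts P)) (\<lambda>(k, p). (lact P k p, p))"
    proof (rule proper_map_left_inverse[where g = "\<lambda>x. (dl (fst x) (snd x), snd x)"])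
      show "continuous_on (lpairs K P) (\<lambda>(k, p). (lact P k p, p))"
        unfolding case_prod_unfold by (intro continuous_on_Pair lact_continuous continuous_intros)
      show "continuous_on ((\<lambda>(k, p). (lact P k p, p)) ` lpairs K P) (\<lambda>x. (dl (fst x) (snd x), snd x))"
        unfolding im unfolding R_def by (intro continuous_on_Pair dl_continuous continuous_intros)
    qed (use cl im dl_lact in \<open>auto simp: lpairs_def\<close>)
  qed
  moreover have "free_proper_right H P"
    unfolding free_proper_right_def
  proof (intro conjI)
    show "\<forall>(p, h)\<in>rpairs H P. ract P p h = p \<longrightarrow> h = idt H (rmom P p)"
      using dr_ract ract_idt by (clarsimp simp: rpairs_def) (metis H.idt_arr H.rng_idt rmom_obj)
    have im: "(\<lambda>(p, h). (p, ract P p h)) ` rpairs H P = Q"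
    proof
      show "(\<lambda>(p, h). (p, ract P p h)) ` rpairs H P \<subseteq> Q"
        by (auto simp: rpairs_def Q_def)
      show "Q \<subseteq> (\<lambda>(p, h). (p, ract P p h)) ` rpairs H P"
      proof
        fix x assume x: "x \<in> Q"
        then have "x = (\<lambda>(p, h). (p, ract P p h)) (fst x, dr (fst x) (snd x))"
          "(fst x, dr (fst x) (snd x)) \<in> rpairs H P"
          by (auto simp: Q_def rpairs_def)
        then show "x \<in> (\<lambda>(p, h). (p, ract P p h)) ` rpairs H P" by blast
      qed
    qed
    have "Q = {x \<in> pts P \<times> pts P. idt K (lmom P (fst x)) = idt K (lmom P (snd x))}"
      unfolding Q_def using K.idt_inj by auto
    then have cl: "closedin (top_of_set (pts P \<times> pts P)) Q"
      by (simp, intro closedin_equalizer K.idt_cont lmom_cont continuous_intros) auto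
    show "proper_map (top_of_set (rpairs H P)) (top_of_set (pts P \<times> pts P)) (\<lambda>(p, h). (p, ract P p h))"
    proof (rule proper_map_left_inverse[where g = "\<lambda>x. (fst x, dr (fst x) (snd x))"])
      show "continuous_on (rpairs H P) (\<lambda>(p, h). (p, ract P p h))"
        unfolding case_prod_unfold by (intro continuous_on_Pair ract_continuous continuous_intros)
      show "continuous_on ((\<lambda>(p, h). (p, ract P p h)) ` rpairs H P) (\<lambda>x. (fst x, dr (fst x) (snd x)))"
        unfolding im unfolding Q_def by (intro continuous_on_Pair dr_continuous continuous_intros)
    qed (use cl im dr_ract in \<open>auto simp: rpairs_def\<close>)
  qed
  moreover have "induces_homeomorphism (pts P) (rorbit H P) (lmom P) (obj K)"
    by (rule induces_homeomorphismI[OF lmom_continuous _ sl_continuous sl]) (auto simp: rorbit_eq)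
  moreover have "induces_homeomorphism (pts P) (lorbit K P) (rmom P) (obj H)"
    by (rule induces_homeomorphismI[OF rmom_continuous _ sr_continuous sr]) (auto simp: lorbit_eq)
  ultimately show ?thesis
    unfolding morita_equivalence_def
    using gK gH left_action right_action commuting_actions by blast
qed

section \<open>The bimodule induced by an equivariant bimodule\<close>

lemma induced_bimodule_simps [simp]:
  "pts (induced_bimodule H actH P actP) = UNIV \<times> pts P"
  "lmom (induced_bimodule H actH P actP) (g, p) = lmom P p"
  "rmom (induced_bimodule H actH P actP) (g, p) = obj_act H actH (- g) (rmom P p)"
  "lact (induced_bimodule H actH P actP) (g, k) (g', p) = (g + g', lact P k (actP g p))"
  "ract (induced_bimodule H actH P actP) (g', p) (g, h) = (g' + g, ract P p (actH g' h))"
  by (simp_all add: induced_bimodule_def)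

locale equivariant_division_bimodule = division_bimodule K H P dl dr sl sr +
  KA: acted_groupoid K actK + HA: acted_groupoid H actH
  for K :: "('a::topological_space, 'x::topological_space) groupoid"
    and H :: "('b::topological_space, 'y::topological_space) groupoid"
    and P :: "('p::topological_space, 'a, 'x, 'b, 'y) bimodule"
    and dl dr sl sr
    and actK :: "'g::topological_group_add \<Rightarrow> 'a \<Rightarrow> 'a" and actH :: "'g \<Rightarrow> 'b \<Rightarrow> 'b" +
  fixes actP :: "'g \<Rightarrow> 'p \<Rightarrow> 'p"
  assumes equivariant: "equivariant_bimodule K actK H actH P actP"
begin

lemma
  assumes "p \<in> pts P"
  shows actP_pts [simp]: "actP g p \<in> pts P"
    and actP_0 [simp]: "actP 0 p = p"
    and actP_actP [simp]: "actP g (actP h p) = actP (g + h) p"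
    and lmom_actP [simp]: "lmom P (actP g p) = obj_act K actK g (lmom P p)"
    and rmom_actP [simp]: "rmom P (actP g p) = obj_act H actH g (rmom P p)"
  using equivariant assms unfolding equivariant_bimodule_def continuous_action_def by auto

lemma actP_cont:
  "continuous_on S f \<Longrightarrow> continuous_on S k \<Longrightarrow> k ` S \<subseteq> pts P \<Longrightarrow> continuous_on S (\<lambda>s. actP (f s) (k s))"
  using equivariant unfolding equivariant_bimodule_def continuous_action_def
  by (blast intro: continuous_on_pair_action)

text \<open>The two lemmas below split the joint equivariance of the actions by letting an identity arrow
  act on one side.\<close>

lemma actP_lact:
  assumes "k \<in> arr K" "p \<in> pts P" "src K k = lmom P p"
  shows "actP g (lact P k p) = lact P (actK g k) (actP g p)"
proof -
  have "actP g (ract P (lact P k p) (idt H (rmom P p))) =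
      ract P (lact P (actK g k) (actP g p)) (actH g (idt H (rmom P p)))"
    using equivariant assms unfolding equivariant_bimodule_def lpairs_def rpairs_def by simp
  then show ?thesis
    using assms ract_idt[of "lact P k p"] ract_idt[of "lact P (actK g k) (actP g p)"] by (simp add: HA.act_idt)
qed

lemma actP_ract:
  assumes "p \<in> pts P" "h \<in> arr H" "rmom P p = rng H h"
  shows "actP g (ract P p h) = ract P (actP g p) (actH g h)"
proof -
  have "actP g (ract P (lact P (idt K (lmom P p)) p) h) =
      ract P (lact P (actK g (idt K (lmom P p))) (actP g p)) (actH g h)"
    using equivariant assms unfolding equivariant_bimodule_def lpairs_def rpairs_def by simp
  then show ?thesis
    using assms lact_idt[of p] lact_idt[of "actP g p"] by (simp add: KA.act_idt)
qed

text \<open>If \<open>(g, p) = (i, l) (g', p')\<close>, then \<open>i = g - g'\<close> and \<open>p = l (i p')\<close>, so that \<open>l\<close> is the left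
  quotient of \<open>p\<close> and \<open>i p'\<close>.  If \<open>(g', p') = (g, p) (i, h)\<close>, then \<open>i = - g + g'\<close> and \<open>p' = p (g h)\<close>,
  so that \<open>g h\<close> is the right quotient of \<open>p\<close> and \<open>p'\<close>.\<close>

lemma induced_division_bimodule:
  "division_bimodule (crossed_product \<mu> K actK) (crossed_product \<nu> H actH) (induced_bimodule H actH P actP)
     (\<lambda>(g, p) (g', p'). (g + - g', dl p (actP (g + - g') p')))
     (\<lambda>(g, p) (g', p'). (- g + g', actH (- g) (dr p p')))
     (\<lambda>x. (0, sl x)) (\<lambda>y. (0, sr y))"
  (is "division_bimodule ?K ?H ?P ?dl ?dr _ _")
proof -
  \<comment> \<open>Without differences, associativity and the inversion of sums normalize words in the group.\<close>
  note [simp del] = add_uminus_conv_diff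
  note [simp] = minus_add add.assoc
  interpret K': top_groupoid ?K by unfold_locales (rule KA.crossed_product_topological)
  interpret H': top_groupoid ?H by unfold_locales (rule HA.crossed_product_topological)
  have L: "src K k = obj_act K actK g (lmom P p)"
    if "k \<in> arr K" "p \<in> pts P" "src ?K (g, k) = lmom ?P (g', p)" for g k g' p
    using that KA.oact_eq_iff[of "src K k" "lmom P p" g] by simp
  have R: "rmom P p = obj_act H actH g' (rng H h)"
    if "h \<in> arr H" "p \<in> pts P" "rmom ?P (g', p) = rng ?H (g, h)" for g h g' p
    using that HA.oact_eq_iff[of "rmom P p" "rng H h" g'] by simp
  have D: "rmom P p = obj_act H actH (g + - g') (rmom P p')"
    if "p \<in> pts P" "p' \<in> pts P" "rmom ?P (g, p) = rmom ?P (g', p')" for g p g' p'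
    using that HA.oact_eq_iff[of "rmom P p" "obj_act H actH (- g') (rmom P p')" g] by simp
  show ?thesis
  proof unfold_locales
    fix p assume "p \<in> pts ?P"
    then obtain g q where p: "p = (g, q)" "q \<in> pts P" by auto
    show "lmom ?P p \<in> obj ?K" "rmom ?P p \<in> obj ?H" using p by auto
    show "lact ?P (idt ?K (lmom ?P p)) p = p" "ract ?P p (idt ?H (rmom ?P p)) = p"
      using p by (auto simp: lact_idt ract_idt HA.act_idt)
    fix p' assume "p' \<in> pts ?P"
    then obtain g' q' where p': "p' = (g', q')" "q' \<in> pts P" by auto
    show "?dl p p' \<in> arr ?K \<and> src ?K (?dl p p') = lmom ?P p' \<and> lact ?P (?dl p p') p' = p"
      if "rmom ?P p = rmom ?P p'"
      using D[OF p(2) p'(2)] that p p' by simp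
    show "?dr p p' \<in> arr ?H \<and> rng ?H (?dr p p') = rmom ?P p \<and> ract ?P p (?dr p p') = p'"
      if "lmom ?P p = lmom ?P p'"
      using that p p' by simp
  next
    fix k p assume "k \<in> arr ?K" "p \<in> pts ?P" and kp: "src ?K k = lmom ?P p"
    then obtain g l g' q where k: "k = (g, l)" "l \<in> arr K" and p: "p = (g', q)" "q \<in> pts P" by auto
    note s = L[OF k(2) p(2) kp[unfolded k(1) p(1)]]
    show "lact ?P k p \<in> pts ?P \<and> lmom ?P (lact ?P k p) = rng ?K k \<and> rmom ?P (lact ?P k p) = rmom ?P p"
      using s k p by simp
    show "?dl (lact ?P k p) p = k"
      using s k p by (simp add: dl_lact)
    fix h assume "h \<in> arr ?H" and ph: "rmom ?P p = rng ?H h"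
    then obtain i m where h: "h = (i, m)" "m \<in> arr H" by auto
    note t = R[OF h(2) p(2) ph[unfolded h(1) p(1)]]
    show "ract ?P (lact ?P k p) h = lact ?P k (ract ?P p h)"
      using s t k p h by (simp add: actP_ract lact_ract)
  next
    fix p h assume "p \<in> pts ?P" "h \<in> arr ?H" and ph: "rmom ?P p = rng ?H h"
    then obtain g' q i m where h: "h = (i, m)" "m \<in> arr H" and p: "p = (g', q)" "q \<in> pts P" by auto
    note t = R[OF h(2) p(2) ph[unfolded h(1) p(1)]]
    show "ract ?P p h \<in> pts ?P \<and> rmom ?P (ract ?P p h) = src ?H h \<and> lmom ?P (ract ?P p h) = lmom ?P p"
      using t p h by simp
    show "?dr p (ract ?P p h) = h"
      using t p h by (simp add: dr_ract)
    fix h' assume "h' \<in> arr ?H" and hh': "src ?H h = rng ?H h'"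
    then obtain i' m' where h': "h' = (i', m')" "m' \<in> arr H" by auto
    have "src H m = obj_act H actH i (rng H m')"
      using hh' h h' HA.oact_eq_iff[of "src H m" "rng H m'" i] by simp
    then show "ract ?P p (cmp ?H h h') = ract ?P (ract ?P p h) h'"
      using t p h h' by (simp add: HA.act_cmp ract_cmp)
  next
    fix k k' p assume "k \<in> arr ?K" "k' \<in> arr ?K" "p \<in> pts ?P"
      and kk': "src ?K k = rng ?K k'" and kp: "src ?K k' = lmom ?P p"
    then obtain g l g' l' i q where k: "k = (g, l)" "l \<in> arr K" and k': "k' = (g', l')" "l' \<in> arr K"
      and p: "p = (i, q)" "q \<in> pts P" by auto
    note s = L[OF k'(2) p(2) kp[unfolded k'(1) p(1)]]
    have "src K l = obj_act K actK g (rng K l')"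
      using kk' k k' KA.oact_eq_iff[of "src K l" "rng K l'" g] by simp
    then show "lact ?P (cmp ?K k k') p = lact ?P k (lact ?P k' p)"
      using s p k k' by (simp add: actP_lact lact_cmp)
  next
    show "continuous_on (pts ?P) (lmom ?P)" "continuous_on (pts ?P) (rmom ?P)"
      unfolding induced_bimodule_def
      by (auto simp: case_prod_unfold intro!: lmom_cont rmom_cont HA.oact_cont continuous_intros)
    have "continuous_on (lpairs ?K ?P) (\<lambda>x. (fst (fst x) + fst (snd x), lact P (snd (fst x)) (actP (fst (fst x)) (snd (snd x)))))"
      by (intro continuous_intros lact_cont actP_cont) (auto simp: lpairs_def KA.oact_eq_iff)
    then show "continuous_on (lpairs ?K ?P) (\<lambda>x. lact ?P (fst x) (snd x))"
      by (simp add: induced_bimodule_def case_prod_unfold)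
    have "continuous_on (rpairs ?H ?P) (\<lambda>x. (fst (fst x) + fst (snd x), ract P (snd (fst x)) (actH (fst (fst x)) (snd (snd x)))))"
      by (intro continuous_intros ract_cont HA.act_cont) (auto simp: rpairs_def HA.oact_eq_iff)
    then show "continuous_on (rpairs ?H ?P) (\<lambda>x. ract ?P (fst x) (snd x))"
      by (simp add: induced_bimodule_def case_prod_unfold)
    have "continuous_on {x \<in> pts ?P \<times> pts ?P. rmom ?P (fst x) = rmom ?P (snd x)}
        (\<lambda>x. (fst (fst x) + - fst (snd x), dl (snd (fst x)) (actP (fst (fst x) + - fst (snd x)) (snd (snd x)))))"
      by (intro continuous_intros dl_cont actP_cont) (auto dest: D)
    then show "continuous_on {x \<in> pts ?P \<times> pts ?P. rmom ?P (fst x) = rmom ?P (snd x)} (\<lambda>x. ?dl (fst x) (snd x))"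
      by (simp add: case_prod_unfold)
    have "continuous_on {x \<in> pts ?P \<times> pts ?P. lmom ?P (fst x) = lmom ?P (snd x)}
        (\<lambda>x. (- fst (fst x) + fst (snd x), actH (- fst (fst x)) (dr (snd (fst x)) (snd (snd x)))))"
      by (intro continuous_intros HA.act_cont dr_cont) auto
    then show "continuous_on {x \<in> pts ?P \<times> pts ?P. lmom ?P (fst x) = lmom ?P (snd x)} (\<lambda>x. ?dr (fst x) (snd x))"
      by (simp add: case_prod_unfold)
    show "continuous_on (obj ?K) (\<lambda>x. (0, sl x))" "continuous_on (obj ?H) (\<lambda>y. (0, sr y))"
      using sl_continuous sr_continuous by (auto intro!: continuous_intros)
  qed (use sl sr in auto)
qed

end

section \<open>Extension of a bimodule to gerbes\<close>

text \<open>The parameter \<open>\<xi>\<close> is a cocycle on a groupoid \<open>M\<close>, to whose arrows the elements of the two acting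
  groupoids and of \<open>P\<close> are sent by \<open>\<pi>\<close>, \<open>\<rho>\<close> and \<open>\<Phi>\<close>.\<close>

definition gerbe_bimodule ::
    "('m \<Rightarrow> 'm \<Rightarrow> complex) \<Rightarrow> ('a \<Rightarrow> 'm) \<Rightarrow> ('b \<Rightarrow> 'm) \<Rightarrow> ('p \<Rightarrow> 'm) \<Rightarrow>
     ('p, 'a, 'x, 'b, 'y) bimodule \<Rightarrow> (complex \<times> 'p, complex \<times> 'a, 'x, complex \<times> 'b, 'y) bimodule" where
  "gerbe_bimodule \<xi> \<pi> \<rho> \<Phi> P =
     \<lparr> pts = U1 \<times> pts P,
       lmom = (\<lambda>(\<theta>, p). lmom P p),
       rmom = (\<lambda>(\<theta>, p). rmom P p),
       lact = (\<lambda>(\<theta>, k) (\<theta>', p). (\<theta> * \<theta>' * \<xi> (\<pi> k) (\<Phi> p), lact P k p)),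
       ract = (\<lambda>(\<theta>', p) (\<theta>, h). (\<theta>' * \<theta> * \<xi> (\<Phi> p) (\<rho> h), ract P p h)) \<rparr>"

lemma gerbe_bimodule_simps [simp]:
  "pts (gerbe_bimodule \<xi> \<pi> \<rho> \<Phi> P) = U1 \<times> pts P"
  "lmom (gerbe_bimodule \<xi> \<pi> \<rho> \<Phi> P) (\<theta>, p) = lmom P p"
  "rmom (gerbe_bimodule \<xi> \<pi> \<rho> \<Phi> P) (\<theta>, p) = rmom P p"
  "lact (gerbe_bimodule \<xi> \<pi> \<rho> \<Phi> P) (\<theta>, k) (\<theta>', p) = (\<theta> * \<theta>' * \<xi> (\<pi> k) (\<Phi> p), lact P k p)"
  "ract (gerbe_bimodule \<xi> \<pi> \<rho> \<Phi> P) (\<theta>', p) (\<theta>, h) = (\<theta>' * \<theta> * \<xi> (\<Phi> p) (\<rho> h), ract P p h)"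
  by (simp_all add: gerbe_bimodule_def)

text \<open>The functors \<open>\<pi>\<close> and \<open>\<rho>\<close>, with unit maps \<open>\<pi>0\<close> and \<open>\<rho>0\<close>, and the map \<open>\<Phi>\<close> interpret both actions
  as multiplication in \<open>M\<close>.\<close>

locale bimodule_over_groupoid = division_bimodule K H P dl dr sl sr + M: twisted_groupoid M \<xi>
  for K :: "('a::topological_space, 'x::topological_space) groupoid"
    and H :: "('b::topological_space, 'y::topological_space) groupoid"
    and P :: "('p::topological_space, 'a, 'x, 'b, 'y) bimodule"
    and dl dr sl sr
    and M :: "('m::topological_space, 'z::topological_space) groupoid" and \<xi> +
  fixes \<pi> :: "'a \<Rightarrow> 'm" and \<pi>0 :: "'x \<Rightarrow> 'z" and \<rho> :: "'b \<Rightarrow> 'm" and \<rho>0 :: "'y \<Rightarrow> 'z" and \<Phi> :: "'p \<Rightarrow> 'm"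
  assumes \<pi>_continuous: "continuous_on (arr K) \<pi>" and \<rho>_continuous: "continuous_on (arr H) \<rho>"
    and \<Phi>_continuous: "continuous_on (pts P) \<Phi>"
    and \<pi>: "k \<in> arr K \<Longrightarrow> \<pi> k \<in> arr M \<and> src M (\<pi> k) = \<pi>0 (src K k) \<and> rng M (\<pi> k) = \<pi>0 (rng K k)"
    and \<pi>_idt: "x \<in> obj K \<Longrightarrow> \<pi> (idt K x) = idt M (\<pi>0 x)"
    and \<pi>_cmp: "k \<in> arr K \<Longrightarrow> k' \<in> arr K \<Longrightarrow> src K k = rng K k' \<Longrightarrow> \<pi> (cmp K k k') = cmp M (\<pi> k) (\<pi> k')"
    and \<rho>: "h \<in> arr H \<Longrightarrow> \<rho> h \<in> arr M \<and> src M (\<rho> h) = \<rho>0 (src H h) \<and> rng M (\<rho> h) = \<rho>0 (rng H h)"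
    and \<rho>_idt: "y \<in> obj H \<Longrightarrow> \<rho> (idt H y) = idt M (\<rho>0 y)"
    and \<rho>_cmp: "h \<in> arr H \<Longrightarrow> h' \<in> arr H \<Longrightarrow> src H h = rng H h' \<Longrightarrow> \<rho> (cmp H h h') = cmp M (\<rho> h) (\<rho> h')"
    and \<Phi>: "p \<in> pts P \<Longrightarrow> \<Phi> p \<in> arr M \<and> src M (\<Phi> p) = \<rho>0 (rmom P p) \<and> rng M (\<Phi> p) = \<pi>0 (lmom P p)"
    and \<Phi>_lact: "k \<in> arr K \<Longrightarrow> p \<in> pts P \<Longrightarrow> src K k = lmom P p \<Longrightarrow> \<Phi> (lact P k p) = cmp M (\<pi> k) (\<Phi> p)"
    and \<Phi>_ract: "p \<in> pts P \<Longrightarrow> h \<in> arr H \<Longrightarrow> rmom P p = rng H h \<Longrightarrow> \<Phi> (ract P p h) = cmp M (\<Phi> p) (\<rho> h)"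
begin

lemma
  shows \<pi>_arr [simp]: "k \<in> arr K \<Longrightarrow> \<pi> k \<in> arr M"
    and src_\<pi> [simp]: "k \<in> arr K \<Longrightarrow> src M (\<pi> k) = \<pi>0 (src K k)"
    and rng_\<pi> [simp]: "k \<in> arr K \<Longrightarrow> rng M (\<pi> k) = \<pi>0 (rng K k)"
    and \<rho>_arr [simp]: "h \<in> arr H \<Longrightarrow> \<rho> h \<in> arr M"
    and src_\<rho> [simp]: "h \<in> arr H \<Longrightarrow> src M (\<rho> h) = \<rho>0 (src H h)"
    and rng_\<rho> [simp]: "h \<in> arr H \<Longrightarrow> rng M (\<rho> h) = \<rho>0 (rng H h)"
    and \<Phi>_arr [simp]: "p \<in> pts P \<Longrightarrow> \<Phi> p \<in> arr M"
    and src_\<Phi> [simp]: "p \<in> pts P \<Longrightarrow> src M (\<Phi> p) = \<rho>0 (rmom P p)"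
    and rng_\<Phi> [simp]: "p \<in> pts P \<Longrightarrow> rng M (\<Phi> p) = \<pi>0 (lmom P p)"
  using \<pi> \<rho> \<Phi> by auto

lemma
  shows \<pi>_cont: "continuous_on S k \<Longrightarrow> k ` S \<subseteq> arr K \<Longrightarrow> continuous_on S (\<lambda>s. \<pi> (k s))"
    and \<rho>_cont: "continuous_on S h \<Longrightarrow> h ` S \<subseteq> arr H \<Longrightarrow> continuous_on S (\<lambda>s. \<rho> (h s))"
    and \<Phi>_cont: "continuous_on S p \<Longrightarrow> p ` S \<subseteq> pts P \<Longrightarrow> continuous_on S (\<lambda>s. \<Phi> (p s))"
  using \<pi>_continuous \<rho>_continuous \<Phi>_continuous by (blast intro: continuous_on_compose2)+

lemma pullback_left_Z2: "(\<lambda>k k'. \<xi> (\<pi> k) (\<pi> k')) \<in> Z2 K"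
  by (rule Z2_pullback[OF K.topological_groupoid M.Z2 \<pi>_continuous, where ?f0.0 = \<pi>0])
    (auto simp: \<pi>_idt \<pi>_cmp)

lemma pullback_right_Z2: "(\<lambda>h h'. \<xi> (\<rho> h) (\<rho> h')) \<in> Z2 H"
  by (rule Z2_pullback[OF H.topological_groupoid M.Z2 \<rho>_continuous, where ?f0.0 = \<rho>0])
    (auto simp: \<rho>_idt \<rho>_cmp)

text \<open>The associativity laws and the commutation of the actions are the cocycle identity for the
  triples \<open>(\<pi> k, \<pi> k', \<Phi> p)\<close>, \<open>(\<Phi> p, \<rho> h, \<rho> h')\<close> and \<open>(\<pi> k, \<Phi> p, \<rho> h)\<close>.  A quotient lies over the quotient
  in \<open>P\<close>, and its phase is obtained by division in \<open>U(1)\<close>.\<close>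

lemma gerbe_division_bimodule:
  "division_bimodule (gerbe (\<lambda>k k'. \<xi> (\<pi> k) (\<pi> k')) K) (gerbe (\<lambda>h h'. \<xi> (\<rho> h) (\<rho> h')) H)
     (gerbe_bimodule \<xi> \<pi> \<rho> \<Phi> P)
     (\<lambda>(\<theta>, p) (\<theta>', p'). (\<theta> * inverse (\<theta>' * \<xi> (\<pi> (dl p p')) (\<Phi> p')), dl p p'))
     (\<lambda>(\<theta>, p) (\<theta>', p'). (\<theta>' * inverse (\<theta> * \<xi> (\<Phi> p) (\<rho> (dr p p'))), dr p p'))
     (\<lambda>x. (1, sl x)) (\<lambda>y. (1, sr y))"
  (is "division_bimodule ?K ?H ?P ?dl ?dr _ _")
proof -
  interpret K': twisted_groupoid K "\<lambda>k k'. \<xi> (\<pi> k) (\<pi> k')"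
    by unfold_locales (rule pullback_left_Z2)
  interpret H': twisted_groupoid H "\<lambda>h h'. \<xi> (\<rho> h) (\<rho> h')"
    by unfold_locales (rule pullback_right_Z2)
  interpret K'': top_groupoid ?K by unfold_locales (rule K'.gerbe_topological)
  interpret H'': top_groupoid ?H by unfold_locales (rule H'.gerbe_topological)
  have cl: "\<xi> (\<pi> k) (\<Phi> p) \<in> U1" if "k \<in> arr K" "p \<in> pts P" "src K k = lmom P p" for k p
    using that by (intro M.\<omega>_U1) auto
  have cr: "\<xi> (\<Phi> p) (\<rho> h) \<in> U1" if "h \<in> arr H" "p \<in> pts P" "rmom P p = rng H h" for h p
    using that by (intro M.\<omega>_U1) auto
  show ?thesis
  proof unfold_locales
    fix p assume "p \<in> pts ?P"
    then obtain t q where p: "p = (t, q)" "t \<in> U1" "q \<in> pts P" by auto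
    show "lmom ?P p \<in> obj ?K" "rmom ?P p \<in> obj ?H" using p by auto
    show "lact ?P (idt ?K (lmom ?P p)) p = p" "ract ?P p (idt ?H (rmom ?P p)) = p"
      using p by (auto simp: lact_idt ract_idt \<pi>_idt \<rho>_idt)
    fix p' assume "p' \<in> pts ?P"
    then obtain t' q' where p': "p' = (t', q')" "t' \<in> U1" "q' \<in> pts P" by auto
    show "?dl p p' \<in> arr ?K \<and> src ?K (?dl p p') = lmom ?P p' \<and> lact ?P (?dl p p') p' = p"
      if "rmom ?P p = rmom ?P p'"
      using that p p' cl[of "dl q q'" q'] U1_nonzero[of t'] U1_nonzero[of "\<xi> (\<pi> (dl q q')) (\<Phi> q')"]
      by (auto simp: field_simps)
    show "?dr p p' \<in> arr ?H \<and> rng ?H (?dr p p') = rmom ?P p \<and> ract ?P p (?dr p p') = p'"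
      if "lmom ?P p = lmom ?P p'"
      using that p p' cr[of "dr q q'" q] U1_nonzero[of t] U1_nonzero[of "\<xi> (\<Phi> q) (\<rho> (dr q q'))"]
      by (auto simp: field_simps)
  next
    fix k p assume "k \<in> arr ?K" "p \<in> pts ?P" and kp: "src ?K k = lmom ?P p"
    then obtain t l t' q where k: "k = (t, l)" "t \<in> U1" "l \<in> arr K" and p: "p = (t', q)" "t' \<in> U1" "q \<in> pts P"
      by auto
    have s: "src K l = lmom P q" using kp k p by simp
    show "lact ?P k p \<in> pts ?P \<and> lmom ?P (lact ?P k p) = rng ?K k \<and> rmom ?P (lact ?P k p) = rmom ?P p"
      using s k p cl by simp
    show "?dl (lact ?P k p) p = k"
      using s k p cl[of l q] U1_nonzero[of t'] U1_nonzero[of "\<xi> (\<pi> l) (\<Phi> q)"] by (simp add: dl_lact field_simps)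
    fix h assume "h \<in> arr ?H" and ph: "rmom ?P p = rng ?H h"
    then obtain t'' m where h: "h = (t'', m)" "t'' \<in> U1" "m \<in> arr H" by auto
    have r: "rmom P q = rng H m" using ph p h by simp
    show "ract ?P (lact ?P k p) h = lact ?P k (ract ?P p h)"
      using s r k p h M.\<omega>_cocycle[of "\<pi> l" "\<Phi> q" "\<rho> m"] by (simp add: lact_ract \<Phi>_lact \<Phi>_ract mult_ac)
  next
    fix p h assume "p \<in> pts ?P" "h \<in> arr ?H" and ph: "rmom ?P p = rng ?H h"
    then obtain t q t' m where h: "h = (t', m)" "t' \<in> U1" "m \<in> arr H" and p: "p = (t, q)" "t \<in> U1" "q \<in> pts P"
      by auto
    have r: "rmom P q = rng H m" using ph p h by simp
    show "ract ?P p h \<in> pts ?P \<and> rmom ?P (ract ?P p h) = src ?H h \<and> lmom ?P (ract ?P p h) = lmom ?P p"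
      using r p h cr by simp
    show "?dr p (ract ?P p h) = h"
      using r p h cr[of m q] U1_nonzero[of t] U1_nonzero[of "\<xi> (\<Phi> q) (\<rho> m)"] by (simp add: dr_ract field_simps)
    fix h' assume "h' \<in> arr ?H" and hh': "src ?H h = rng ?H h'"
    then obtain t'' m' where h': "h' = (t'', m')" "t'' \<in> U1" "m' \<in> arr H" by auto
    have "src H m = rng H m'" using hh' h h' by simp
    then show "ract ?P p (cmp ?H h h') = ract ?P (ract ?P p h) h'"
      using r p h h' M.\<omega>_cocycle[of "\<Phi> q" "\<rho> m" "\<rho> m'"] by (simp add: ract_cmp \<Phi>_ract \<rho>_cmp mult_ac)
  next
    fix k k' p assume "k \<in> arr ?K" "k' \<in> arr ?K" "p \<in> pts ?P"
      and kk': "src ?K k = rng ?K k'" and kp: "src ?K k' = lmom ?P p"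
    then obtain t l t' l' t'' q where k: "k = (t, l)" "t \<in> U1" "l \<in> arr K"
      and k': "k' = (t', l')" "t' \<in> U1" "l' \<in> arr K" and p: "p = (t'', q)" "t'' \<in> U1" "q \<in> pts P" by auto
    have "src K l = rng K l'" "src K l' = lmom P q" using kk' kp k k' p by simp_all
    then show "lact ?P (cmp ?K k k') p = lact ?P k (lact ?P k' p)"
      using p k k' M.\<omega>_cocycle[of "\<pi> l" "\<pi> l'" "\<Phi> q"] by (simp add: lact_cmp \<Phi>_lact \<pi>_cmp mult_ac)
  next
    show "continuous_on (pts ?P) (lmom ?P)" "continuous_on (pts ?P) (rmom ?P)"
      unfolding gerbe_bimodule_def
      by (auto simp: case_prod_unfold intro!: lmom_cont rmom_cont continuous_intros)
    have "continuous_on (lpairs ?K ?P) (\<lambda>x. (fst (fst x) * fst (snd x) * \<xi> (\<pi> (snd (fst x))) (\<Phi> (snd (snd x))),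
        lact P (snd (fst x)) (snd (snd x))))"
      by (intro continuous_on_Pair continuous_on_mult lact_cont M.\<omega>_cont \<pi>_cont \<Phi>_cont)
        (auto simp: lpairs_def composable_iff intro!: continuous_intros)
    then show "continuous_on (lpairs ?K ?P) (\<lambda>x. lact ?P (fst x) (snd x))"
      by (simp add: gerbe_bimodule_def case_prod_unfold)
    have "continuous_on (rpairs ?H ?P) (\<lambda>x. (fst (fst x) * fst (snd x) * \<xi> (\<Phi> (snd (fst x))) (\<rho> (snd (snd x))),
        ract P (snd (fst x)) (snd (snd x))))"
      by (intro continuous_on_Pair continuous_on_mult ract_cont M.\<omega>_cont \<rho>_cont \<Phi>_cont)
        (auto simp: rpairs_def composable_iff intro!: continuous_intros)
    then show "continuous_on (rpairs ?H ?P) (\<lambda>x. ract ?P (fst x) (snd x))"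
      by (simp add: gerbe_bimodule_def case_prod_unfold)
    have nzl: "t * \<xi> (\<pi> (dl p p')) (\<Phi> p') \<noteq> 0"
      if "t \<in> U1" "p \<in> pts P" "p' \<in> pts P" "rmom P p = rmom P p'" for t p p'
      using that cl[of "dl p p'" p'] U1_nonzero by auto
    have "continuous_on {x \<in> pts ?P \<times> pts ?P. rmom ?P (fst x) = rmom ?P (snd x)}
        (\<lambda>x. (fst (fst x) * inverse (fst (snd x) * \<xi> (\<pi> (dl (snd (fst x)) (snd (snd x)))) (\<Phi> (snd (snd x)))),
          dl (snd (fst x)) (snd (snd x))))"
      by (intro continuous_on_Pair continuous_on_mult continuous_on_inverse M.\<omega>_cont \<pi>_cont \<Phi>_cont dl_cont)
        (use nzl in \<open>auto simp: composable_iff intro!: continuous_intros\<close>)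
    then show "continuous_on {x \<in> pts ?P \<times> pts ?P. rmom ?P (fst x) = rmom ?P (snd x)} (\<lambda>x. ?dl (fst x) (snd x))"
      by (simp add: case_prod_unfold)
    have nzr: "t * \<xi> (\<Phi> p) (\<rho> (dr p p')) \<noteq> 0"
      if "t \<in> U1" "p \<in> pts P" "p' \<in> pts P" "lmom P p = lmom P p'" for t p p'
      using that cr[of "dr p p'" p] U1_nonzero by auto
    have "continuous_on {x \<in> pts ?P \<times> pts ?P. lmom ?P (fst x) = lmom ?P (snd x)}
        (\<lambda>x. (fst (snd x) * inverse (fst (fst x) * \<xi> (\<Phi> (snd (fst x))) (\<rho> (dr (snd (fst x)) (snd (snd x))))),
          dr (snd (fst x)) (snd (snd x))))"
      by (intro continuous_on_Pair continuous_on_mult continuous_on_inverse M.\<omega>_cont \<rho>_cont \<Phi>_cont dr_cont)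
        (use nzr in \<open>auto simp: composable_iff intro!: continuous_intros\<close>)
    then show "continuous_on {x \<in> pts ?P \<times> pts ?P. lmom ?P (fst x) = lmom ?P (snd x)} (\<lambda>x. ?dr (fst x) (snd x))"
      by (simp add: case_prod_unfold)
    show "continuous_on (obj ?K) (\<lambda>x. (1, sl x))" "continuous_on (obj ?H) (\<lambda>y. (1, sr y))"
      using sl_continuous sr_continuous by (auto intro!: continuous_intros)
  qed (use sl sr in auto)
qed

end

lemma extends_to_gerbesI:
  fixes K :: "('a::{t2_space, second_countable_topology}, 'x::topological_space) groupoid"
    and H :: "('b::{t2_space, second_countable_topology}, 'y::topological_space) groupoid"
    and P :: "('p::topological_space, 'a, 'x, 'b, 'y) bimodule"
    and M :: "('m::topological_space, 'z::topological_space) groupoid"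
  assumes P: "bimodule_over_groupoid K H P dl dr sl sr M \<xi> \<pi> \<pi>0 \<rho> \<rho>0 \<Phi>"
    and K: "groupoid K" and H: "groupoid H"
  shows "extends_to_gerbes K (\<lambda>k k'. \<xi> (\<pi> k) (\<pi> k')) H (\<lambda>h h'. \<xi> (\<rho> h) (\<rho> h')) P
    (gerbe_bimodule \<xi> \<pi> \<rho> \<Phi> P)"
proof -
  interpret bimodule_over_groupoid K H P dl dr sl sr M \<xi> \<pi> \<pi>0 \<rho> \<rho>0 \<Phi> by (rule P)
  show ?thesis
    unfolding extends_to_gerbes_def
    using pullback_left_Z2 pullback_right_Z2
      division_morita_equivalence[OF division_bimodule_axioms K H]
      division_morita_equivalence[OF gerbe_division_bimodule
        gerbe_groupoid[OF K pullback_left_Z2] gerbe_groupoid[OF H pullback_right_Z2]]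
    by (auto simp: lpairs_def rpairs_def \<pi>_idt \<rho>_idt lact_idt ract_idt)
qed

section \<open>The bimodule of arrows with source over the neutral element\<close>

context acted_groupoid
begin

lemma crossed_product_groupoid_cocycle: "groupoid_cocycle (crossed_product \<mu> K act) fst"
proof (unfold_locales)
  show "topological_groupoid (crossed_product \<mu> K act)" by (rule crossed_product_topological)
  show "continuous_on (arr (crossed_product \<mu> K act)) fst" by (intro continuous_intros)
qed auto

abbreviation (input) dual :: "'g measure \<Rightarrow> ('g \<times> 'g \<times> 'a, 'g \<times> 'x) groupoid" where
  "dual \<mu> \<equiv> skew_product fst (crossed_product \<mu> K act)"

lemma dual_topological: "topological_groupoid (dual \<mu>)"
proof -
  interpret groupoid_cocycle "crossed_product \<mu> K act" fst by (rule crossed_product_groupoid_cocycle)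
  show ?thesis by (rule skew_product_topological)
qed

lemma W_bimodule_simps [simp]:
  "lmom (W_bimodule \<mu> K act) = rng (dual \<mu>)"
  "rmom (W_bimodule \<mu> K act) w = snd (src (dual \<mu>) w)"
  "lact (W_bimodule \<mu> K act) = cmp (dual \<mu>)"
  "ract (W_bimodule \<mu> K act) w a = cmp (dual \<mu>) w (0, 0, a)"
  by (simp_all add: W_bimodule_def Let_def)

lemma W_bimodule_pts: "pts (W_bimodule \<mu> K act) = {(g, - g, a) | g a. a \<in> arr K}"
  unfolding W_bimodule_def Let_def bimodule.simps ..

lemma W_bimodule_pts_src: "pts (W_bimodule \<mu> K act) = {w \<in> arr (dual \<mu>). fst (src (dual \<mu>) w) = 0}"
  unfolding W_bimodule_pts by (auto simp: add_eq_0_iff)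

text \<open>All axioms are groupoid identities of the skew product: the right action is a multiplication
  by arrows of the slice over \<open>0\<close>, and the quotients of \<open>w\<close> and \<open>w'\<close> are \<open>w w'\<^sup>-\<^sup>1\<close> and
  \<open>w\<^sup>-\<^sup>1 w'\<close>.\<close>

lemma W_division_bimodule:
  "division_bimodule (dual \<mu>) K (W_bimodule \<mu> K act)
     (\<lambda>w w'. cmp (dual \<mu>) w (ivt (dual \<mu>) w')) (\<lambda>w w'. snd (snd (cmp (dual \<mu>) (ivt (dual \<mu>) w) w')))
     (\<lambda>(g, x). (g, - g, idt K x)) (\<lambda>y. (0, 0, idt K y))"
  (is "division_bimodule ?L K ?W ?dl ?dr _ _")
proof -
  interpret L: top_groupoid ?L by unfold_locales (rule dual_topological)
  have e [simp]: "(0, 0, a) \<in> arr ?L" "src ?L (0, 0, a) = (0, src K a)" "rng ?L (0, 0, a) = (0, rng K a)"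
    if "a \<in> arr K" for a
    using that by auto
  have e_cmp: "cmp ?L (0, 0, a) (0, 0, b) = (0, 0, cmp K a b)" if "b \<in> arr K" for a b
    using that by simp
  have e_surj: "l = (0, 0, snd (snd l))" "snd (snd l) \<in> arr K"
    if "l \<in> arr ?L" "fst (src ?L l) = 0" "fst (rng ?L l) = 0" for l
    using that by (cases l; auto)+
  have W: "w \<in> arr ?L" "src ?L w = (0, rmom ?W w)" "rmom ?W w \<in> obj K" if "w \<in> pts ?W" for w
  proof -
    show w: "w \<in> arr ?L" using that unfolding W_bimodule_pts_src by blast
    show "src ?L w = (0, rmom ?W w)" using that unfolding W_bimodule_pts_src by (simp add: prod_eq_iff)
    show "rmom ?W w \<in> obj K" using L.src_obj[OF w] by (auto simp: mem_Times_iff)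
  qed
  have W': "w \<in> pts ?W" if "w \<in> arr ?L" "src ?L w = (0, y)" for w y
    using that unfolding W_bimodule_pts_src by simp
  have comp: "src ?L w = rng ?L (0, 0, a)" if "w \<in> pts ?W" "a \<in> arr K" "rmom ?W w = rng K a" for w a
    using W(2)[OF that(1)] that by simp
  note simps [simp del] = skew_product_simps W_bimodule_simps(2)
  have r: "rmom ?W w = y" if "src ?L w = (0, y)" for w y
    using that by (simp add: W_bimodule_simps(2))
  have Lo: "obj ?L = UNIV \<times> obj K" by (simp add: skew_product_simps)
  have quot: "cmp ?L (ivt ?L w) w' = (0, 0, ?dr w w')" "?dr w w' \<in> arr K" "rng K (?dr w w') = rmom ?W w"
    if w: "w \<in> pts ?W" and w': "w' \<in> pts ?W" and eq: "rng ?L w = rng ?L w'" for w w'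
  proof -
    let ?l = "cmp ?L (ivt ?L w) w'"
    have l: "?l \<in> arr ?L" "src ?L ?l = (0, rmom ?W w')" "rng ?L ?l = (0, rmom ?W w)"
      using W(1,2)[OF w] W(1,2)[OF w'] eq by simp_all
    have f: "fst (src ?L ?l) = 0" "fst (rng ?L ?l) = 0" unfolding l(2,3) by simp_all
    show q: "?l = (0, 0, ?dr w w')" and a: "?dr w w' \<in> arr K"
      using e_surj[OF l(1) f] .
    have "(0 :: 'g, rng K (?dr w w')) = (0, rmom ?W w)"
      by (rule trans[OF e(3)[OF a, unfolded q[symmetric], symmetric] l(3)])
    then show "rng K (?dr w w') = rmom ?W w" by simp
  qed
  show ?thesis
  proof unfold_locales
    fix w assume w: "w \<in> pts ?W"
    note Ww = W[OF w]
    show "lmom ?W w \<in> obj ?L" "rmom ?W w \<in> obj K" using Ww(1,3) by simp_all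
    show "lact ?W (idt ?L (lmom ?W w)) w = w" using Ww(1) by simp
    have "idt ?L (src ?L w) = (0, 0, idt K (rmom ?W w))"
      unfolding Ww(2) by (simp add: skew_product_simps)
    then show "ract ?W w (idt K (rmom ?W w)) = w"
      using L.cmp_idt[OF Ww(1)] by simp
    fix w' assume w': "w' \<in> pts ?W"
    note Ww' = W[OF w']
    show "?dl w w' \<in> arr ?L \<and> src ?L (?dl w w') = lmom ?W w' \<and> lact ?W (?dl w w') w' = w"
      if "rmom ?W w = rmom ?W w'"
      using Ww(1,2) Ww'(1,2) that by simp
    show "?dr w w' \<in> arr K \<and> rng K (?dr w w') = rmom ?W w \<and> ract ?W w (?dr w w') = w'"
      if "lmom ?W w = lmom ?W w'"
    proof -
      have eq: "rng ?L w = rng ?L w'" using that by simp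
      note q = quot[OF w w' eq]
      have "cmp ?L w (0, 0, ?dr w w') = w'"
        unfolding q(1)[symmetric] using Ww(1) Ww'(1) eq by (rule L.cmp_ivt_cancel)
      then show ?thesis using q(2,3) by simp
    qed
  next
    fix k w assume k: "k \<in> arr ?L" and w: "w \<in> pts ?W" and kw: "src ?L k = lmom ?W w"
    note Ww = W[OF w]
    have kw': "src ?L k = rng ?L w" using kw by simp
    show "lact ?W k w \<in> pts ?W \<and> lmom ?W (lact ?W k w) = rng ?L k \<and> rmom ?W (lact ?W k w) = rmom ?W w"
    proof -
      have "cmp ?L k w \<in> arr ?L" "src ?L (cmp ?L k w) = (0, rmom ?W w)" "rng ?L (cmp ?L k w) = rng ?L k"
        using k Ww(1,2) kw' by simp_all
      from W'[OF this(1,2)] r[OF this(2)] this(3) show ?thesis by simp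
    qed
    show "?dl (lact ?W k w) w = k"
      using k Ww(1) kw' by simp
    fix a assume a: "a \<in> arr K" "rmom ?W w = rng K a"
    show "ract ?W (lact ?W k w) a = lact ?W k (ract ?W w a)"
      using k Ww(1) kw' a(1) comp[OF w a] by (simp add: L.cmp_assoc)
  next
    fix w a assume w: "w \<in> pts ?W" and a: "a \<in> arr K" "rmom ?W w = rng K a"
    note Ww = W[OF w]
    have c: "src ?L w = rng ?L (0, 0, a)" using comp[OF w a] .
    have s: "ract ?W w a \<in> arr ?L" "src ?L (ract ?W w a) = (0, src K a)" "rng ?L (ract ?W w a) = rng ?L w"
      using a(1) Ww(1) c e[OF a(1)] by simp_all
    show "ract ?W w a \<in> pts ?W \<and> rmom ?W (ract ?W w a) = src K a \<and> lmom ?W (ract ?W w a) = lmom ?W w"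
      using W'[OF s(1,2)] r[OF s(2)] s(3) by simp
    show "?dr w (ract ?W w a) = a"
      using a(1) Ww(1) c by simp
    fix b assume b: "b \<in> arr K" "src K a = rng K b"
    show "ract ?W w (cmp K a b) = ract ?W (ract ?W w a) b"
      using a(1) b Ww(1) c e(2,3)[OF a(1)] e(2,3)[OF b(1)] by (simp add: L.cmp_assoc flip: e_cmp)
  next
    fix k k' w assume "k \<in> arr ?L" "k' \<in> arr ?L" "w \<in> pts ?W" "src ?L k = rng ?L k'" "src ?L k' = lmom ?W w"
    then show "lact ?W (cmp ?L k k') w = lact ?W k (lact ?W k' w)"
      using W(1)[of w] by (simp add: L.cmp_assoc)
  next
    fix x assume "x \<in> obj ?L"
    then obtain g y where x: "x = (g, y)" "y \<in> obj K" unfolding Lo by auto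
    have "(g, - g, idt K y) \<in> pts ?W" "rng ?L (g, - g, idt K y) = x"
      unfolding W_bimodule_pts_src using x by (auto simp: skew_product_simps)
    then show "(case x of (g, x) \<Rightarrow> (g, - g, idt K x)) \<in> pts ?W \<and> lmom ?W (case x of (g, x) \<Rightarrow> (g, - g, idt K x)) = x"
      using x by simp
  next
    fix y assume "y \<in> obj K"
    then have "(0, 0, idt K y) \<in> arr ?L" "src ?L (0, 0, idt K y) = (0, y)" by simp_all
    then show "(0, 0, idt K y) \<in> pts ?W \<and> rmom ?W (0, 0, idt K y) = y"
      using W' r by blast
  next
    have sub: "pts ?W \<subseteq> arr ?L" unfolding W_bimodule_pts_src by blast
    have "continuous_on (pts ?W) (\<lambda>w. rng ?L w)"
      by (intro L.rng_cont continuous_on_id) (use sub in simp)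
    then show "continuous_on (pts ?W) (lmom ?W)" by simp
    have "continuous_on (pts ?W) (\<lambda>w. snd (src ?L w))"
      by (intro continuous_on_snd L.src_cont continuous_on_id) (use sub in simp)
    then show "continuous_on (pts ?W) (rmom ?W)" by (simp add: W_bimodule_simps(2)[abs_def])
    have "continuous_on (lpairs ?L ?W) (\<lambda>x. cmp ?L (fst x) (snd x))"
      by (intro L.cmp_cont continuous_intros) (use sub in \<open>auto simp: lpairs_def composable_iff\<close>)
    then show "continuous_on (lpairs ?L ?W) (\<lambda>x. lact ?W (fst x) (snd x))" by simp
    have "continuous_on (rpairs K ?W) (\<lambda>x. cmp ?L (fst x) (0, 0, snd x))"
      by (intro L.cmp_cont continuous_intros) (use W in \<open>auto simp: rpairs_def composable_iff\<close>)
    then show "continuous_on (rpairs K ?W) (\<lambda>x. ract ?W (fst x) (snd x))" by simp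
    show "continuous_on {x \<in> pts ?W \<times> pts ?W. rmom ?W (fst x) = rmom ?W (snd x)} (\<lambda>x. ?dl (fst x) (snd x))"
      by (intro L.cmp_cont L.ivt_cont continuous_intros) (use W in \<open>auto simp: composable_iff\<close>)
    show "continuous_on {x \<in> pts ?W \<times> pts ?W. lmom ?W (fst x) = lmom ?W (snd x)} (\<lambda>x. ?dr (fst x) (snd x))"
      by (intro continuous_on_snd L.cmp_cont L.ivt_cont continuous_intros) (use W in \<open>auto simp: composable_iff\<close>)
    show "continuous_on (obj ?L) (\<lambda>(g, x). (g, - g, idt K x))"
      unfolding case_prod_unfold by (intro continuous_intros idt_cont) (auto simp: Lo)
    show "continuous_on (obj K) (\<lambda>y. (0, 0, idt K y))"
      by (intro continuous_intros idt_cont) auto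
  qed
qed

lemma W_act_simp [simp]: "W_act g (h, h', a) = (g + h, - (g + h), a)"
  by (simp add: W_act_def)

text \<open>If \<open>(b, b', d)\<close> acts on \<open>(h, - h, c)\<close>, then \<open>h = b + b'\<close>; with this substitution both sides
  of the equivariance law are the same word in the group variables.\<close>

lemma W_equivariant: "equivariant_bimodule (dual \<mu>) translation K act (W_bimodule \<mu> K act) W_act"
  (is "equivariant_bimodule ?L _ _ _ ?W _")
proof -
  note pts = W_bimodule_pts[of \<mu>]
  \<comment> \<open>Without differences, associativity and the inversion of sums normalize words in the group.\<close>
  note [simp del] = add_uminus_conv_diff
  note [simp] = minus_add add.assoc
  have "continuous_action (pts ?W) W_act"
    unfolding continuous_action_def
  proof (intro conjI)
    have "continuous_on (UNIV \<times> pts ?W) (\<lambda>x. (fst x + fst (snd x), - (fst x + fst (snd x)), snd (snd (snd x))))"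
      by (intro continuous_intros)
    then show "continuous_on (UNIV \<times> pts ?W) (\<lambda>(g, p). W_act g p)"
      by (simp add: W_act_def case_prod_unfold)
  qed (auto simp: pts)
  moreover have "lmom ?W (W_act g w) = obj_act ?L translation g (lmom ?W w) \<and>
      rmom ?W (W_act g w) = oact g (rmom ?W w)" if "w \<in> pts ?W" for g w
    using that by (auto simp: pts)
  moreover have "W_act g (ract ?W (lact ?W k w) a) = ract ?W (lact ?W (translation g k) (W_act g w)) (act g a)"
    if kw: "(k, w) \<in> lpairs ?L ?W" and wa: "(w, a) \<in> rpairs K ?W" for g k w a
  proof -
    obtain h c where w: "w = (h, - h, c)" "c \<in> arr K" using kw by (auto simp: lpairs_def pts)
    obtain b b' d where k: "k = (b, b', d)" "d \<in> arr K" using kw by (cases k) (auto simp: lpairs_def)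
    have h: "h = b + b'" using kw by (auto simp: lpairs_def w k)
    have a: "a \<in> arr K" using wa by (simp add: rpairs_def)
    show ?thesis using a w(2) k(2) by (simp add: w(1) k(1) h)
  qed
  ultimately show ?thesis
    unfolding equivariant_bimodule_def by blast
qed

end

section \<open>Restriction to the neutral element\<close>

lemma slice_homeomorphic:
  fixes A :: "'t::topological_space set" and B :: "'b::topological_space set"
  shows "homeomorphic_map (top_of_set (A \<times> B))
    (top_of_set {(t, g :: 'g::topological_group_add, b). (t, g, b) \<in> A \<times> UNIV \<times> B \<and> g = 0}) (\<lambda>(t, b). (t, 0, b))"
  (is "homeomorphic_map _ (top_of_set ?S) _")
proof -
  have "continuous_on (A \<times> B) (\<lambda>x. (fst x, 0 :: 'g, snd x))"
    by (intro continuous_intros)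
  moreover have "continuous_on ?S (\<lambda>x. (fst x, snd (snd x)))"
    by (intro continuous_intros)
  ultimately have "homeomorphic_maps (top_of_set (A \<times> B)) (top_of_set ?S)
      (\<lambda>x. (fst x, 0, snd x)) (\<lambda>x. (fst x, snd (snd x)))"
    unfolding homeomorphic_maps_def continuous_map_subtopology_eu by auto
  then show ?thesis
    unfolding homeomorphic_map_maps by (auto simp: case_prod_unfold)
qed

lemma (in acted_groupoid) gerbe_slice_iso:
  assumes eq: "\<And>a b. \<omega>' (0, a) (0, b) = \<omega> a b"
  shows "groupoid_iso (gerbe \<omega> K)
    ((gerbe \<omega>' (crossed_product \<mu> K act))\<lparr>arr := {(\<theta>, g, a). (\<theta>, g, a) \<in> arr (gerbe \<omega>' (crossed_product \<mu> K act)) \<and> g = 0}\<rparr>)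
    (\<lambda>(\<theta>, a). (\<theta>, 0, a)) id"
  unfolding groupoid_iso_def
proof (intro conjI)
  show "homeomorphic_map (top_of_set (arr (gerbe \<omega> K))) (top_of_set (arr ((gerbe \<omega>' (crossed_product \<mu> K act))
      \<lparr>arr := {(\<theta>, g, a). (\<theta>, g, a) \<in> arr (gerbe \<omega>' (crossed_product \<mu> K act)) \<and> g = 0}\<rparr>)))
      (\<lambda>(\<theta>, a). (\<theta>, 0, a))"
    using slice_homeomorphic[of U1 "arr K", where 'g = 'g] by simp
qed (clarsimp simp: composable_iff eq)+

theorem theorem13p2:
  fixes \<H> :: "('a::{t2_space, second_countable_topology}, 'x::topological_space) groupoid"
    and \<alpha> :: "'g::{topological_group_add, t2_space, second_countable_topology} \<Rightarrow> 'a \<Rightarrow> 'a"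
    and \<mu> :: "'g measure"
    and chi :: "'g \<times> 'a \<Rightarrow> 'g \<times> 'a \<Rightarrow> complex"
  assumes "locally_compact_space (euclidean :: 'g topology)"
    and "left_haar_measure \<mu>"
    and "G_groupoid \<H> \<alpha>"
    and "chi \<in> Z2 (crossed_product \<mu> \<H> \<alpha>)"
  shows
    "let GH = crossed_product \<mu> \<H> \<alpha>;
         L = skew_product fst GH;
         \<tau> = (translation :: 'g \<Rightarrow> 'g \<times> 'g \<times> 'a \<Rightarrow> 'g \<times> 'g \<times> 'a);
         GL = crossed_product \<mu> L \<tau>;
         \<sigma> = (\<lambda>a b. chi (0, a) (0, b));
         chi_L = (\<lambda>(_, k) (_, k'). chi k k');
         chi_GL = (\<lambda>(_, _, k) (_, _, k'). chi k k');
         W = W_bimodule \<mu> \<H> \<alpha>;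
         GW = induced_bimodule \<H> \<alpha> W W_act
     in G_groupoid L \<tau> \<and>
        equivariant_bimodule L \<tau> \<H> \<alpha> W W_act \<and>
        (\<exists>E1 E2.
           extends_to_gerbes L chi_L \<H> \<sigma> W E1 \<and>
           extends_to_gerbes GL chi_GL GH chi GW E2 \<and>
           subequivalence (gerbe chi_L L) (gerbe \<sigma> \<H>) E1 (gerbe chi_GL GL) (gerbe chi GH) E2)"
proof -
  \<comment> \<open>Without differences, associativity and the inversion of sums normalize words in the group.\<close>
  note [simp del] = add_uminus_conv_diff
  note [simp] = minus_add add.assoc
  define GH where "GH = crossed_product \<mu> \<H> \<alpha>"
  define L where "L = skew_product fst GH"
  define \<tau> where "\<tau> = (translation :: 'g \<Rightarrow> 'g \<times> 'g \<times> 'a \<Rightarrow> 'g \<times> 'g \<times> 'a)"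
  define GL where "GL = crossed_product \<mu> L \<tau>"
  define W where "W = W_bimodule \<mu> \<H> \<alpha>"
  define GW where "GW = induced_bimodule \<H> \<alpha> W W_act"
  \<comment> \<open>The first component of \<open>\<Phi>\<close> absorbs \<open>g\<close> on the right because \<open>G \<ltimes> \<H>\<close> acts there, from the right,
    on the variable \<open>g\<close>.\<close>
  define \<Phi> where "\<Phi> = (\<lambda>(g :: 'g, h :: 'g, h' :: 'g, c :: 'a). (h' + g, c))"
  define E1 where "E1 = gerbe_bimodule chi snd (Pair 0) snd W"
  define E2 where "E2 = gerbe_bimodule chi (\<lambda>k. snd (snd k)) (\<lambda>k. k) \<Phi> GW"
  interpret H: acted_groupoid \<H> \<alpha> using assms(3) by unfold_locales
  have gGH: "groupoid GH"
    unfolding GH_def by (rule crossed_product_groupoid[OF assms(3,2,1)])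
  have coc: "groupoid_cocycle GH fst"
    unfolding GH_def by (rule H.crossed_product_groupoid_cocycle)
  have gL: "groupoid L"
    unfolding L_def by (rule skew_product_groupoid[OF gGH coc assms(1)])
  have GgL: "G_groupoid L \<tau>"
    unfolding L_def \<tau>_def by (rule skew_product_G_groupoid[OF gGH coc assms(1)])
  have gGL: "groupoid GL"
    unfolding GL_def by (rule crossed_product_groupoid[OF GgL assms(2,1)])
  have equi: "equivariant_bimodule L \<tau> \<H> \<alpha> W W_act"
    unfolding L_def \<tau>_def W_def GH_def by (rule H.W_equivariant)
  interpret L: acted_groupoid L \<tau> using GgL by unfold_locales
  interpret M: twisted_groupoid GH chi
    using groupoidD(1)[OF gGH] assms(4) unfolding GH_def by unfold_locales
  interpret W: equivariant_division_bimodule L \<H> W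
      "\<lambda>w w'. cmp L w (ivt L w')" "\<lambda>w w'. snd (snd (cmp L (ivt L w) w'))"
      "\<lambda>(g, x). (g, - g, idt \<H> x)" "\<lambda>y. (0, 0, idt \<H> y)" \<tau> \<alpha> W_act
    unfolding equivariant_division_bimodule_def equivariant_division_bimodule_axioms_def
    using H.W_division_bimodule[of \<mu>] equi H.acted_groupoid_axioms L.acted_groupoid_axioms
    unfolding L_def W_def GH_def by blast
  have Wp: "pts W = {(g, - g, a) | g a. a \<in> arr \<H>}"
    unfolding W_def by (rule H.W_bimodule_pts)
  have Wl: "lact W (g, h, a) (g', h', b) = (g, h + h', cmp \<H> a (\<alpha> h b))" for g h a g' h' b
    unfolding W_def by simp
  have Wr: "ract W (g, h, a) b = (g, h, cmp \<H> a (\<alpha> h b))" for g h a b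
    unfolding W_def by simp
  have Wlm: "lmom W (g, h, a) = (g, rng \<H> a)" for g h a
    unfolding W_def by simp
  have Wrm: "rmom W (g, h, a) = src \<H> (\<alpha> (- h) a)" for g h a
    unfolding W_def by simp
  note Ws = Wl Wr Wlm Wrm
  have 1: "extends_to_gerbes L (\<lambda>k k'. chi (snd k) (snd k')) \<H> (\<lambda>a b. chi (0, a) (0, b)) W E1"
    unfolding E1_def
  proof (rule extends_to_gerbesI[OF _ gL H.groupoid])
    show "bimodule_over_groupoid L \<H> W (\<lambda>w w'. cmp L w (ivt L w')) (\<lambda>w w'. snd (snd (cmp L (ivt L w) w')))
        (\<lambda>(g, x). (g, - g, idt \<H> x)) (\<lambda>y. (0, 0, idt \<H> y)) GH chi snd snd (Pair 0) (\<lambda>y. y) snd"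
      by unfold_locales
        (auto simp: L_def GH_def Wp Ws intro!: continuous_intros)
  qed
  have 2: "extends_to_gerbes GL (\<lambda>k k'. chi (snd (snd k)) (snd (snd k'))) GH (\<lambda>k k'. chi k k') GW E2"
    unfolding E2_def
  proof (rule extends_to_gerbesI[OF _ gGL gGH])
    let ?dl = "\<lambda>(g, p) (g', p'). (g + - g', cmp L p (ivt L (W_act (g + - g') p')))"
    let ?dr = "\<lambda>(g, p) (g', p'). (- g + g', \<alpha> (- g) (snd (snd (cmp L (ivt L p) p'))))"
    interpret GW: division_bimodule GL GH GW ?dl ?dr
        "\<lambda>x. (0, (\<lambda>(g, x). (g, - g, idt \<H> x)) x)" "\<lambda>y. (0, 0, 0, idt \<H> y)"
      using W.induced_division_bimodule[of \<mu> \<mu>] unfolding GL_def GW_def GH_def .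
    show "bimodule_over_groupoid GL GH GW ?dl ?dr
        (\<lambda>x. (0, (\<lambda>(g, x). (g, - g, idt \<H> x)) x)) (\<lambda>y. (0, 0, 0, idt \<H> y))
        GH chi (\<lambda>k. snd (snd k)) snd (\<lambda>k. k) (\<lambda>y. y) \<Phi>"
    proof unfold_locales
      show "continuous_on (pts GW) \<Phi>"
        unfolding \<Phi>_def case_prod_unfold by (intro continuous_intros)
      fix p assume "p \<in> pts GW"
      then obtain g h c where p: "p = (g, h, - h, c)" "c \<in> arr \<H>" by (auto simp: GW_def Wp)
      show "\<Phi> p \<in> arr GH \<and> src GH (\<Phi> p) = rmom GW p \<and> rng GH (\<Phi> p) = snd (lmom GW p)"
        using p by (simp add: \<Phi>_def GH_def GW_def Ws)
    next
      fix k p assume "k \<in> arr GL" "p \<in> pts GW" and kp: "src GL k = lmom GW p"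
      then obtain g h c i j j' d where p: "p = (g, h, - h, c)" "c \<in> arr \<H>"
          and k: "k = (i, j, j', d)" "d \<in> arr \<H>"
        by (auto simp: GW_def GL_def L_def GH_def Wp)
      \<comment> \<open>The arrow \<open>(j, j', d)\<close> of \<open>L\<close> has its source over \<open>j + j'\<close>, and \<open>i\<close> moves \<open>p\<close> to the point over
        \<open>i + h\<close>.\<close>
      have "j + j' = i + h"
        using kp by (simp add: p k GL_def L_def GH_def GW_def \<tau>_def Ws) (metis add.assoc add_minus_cancel)
      then have "j' = - j + (i + h)" by (metis minus_add_cancel)
      then show "\<Phi> (lact GW k p) = cmp GH (snd (snd k)) (\<Phi> p)"
        using p k by (simp add: \<Phi>_def GH_def GW_def Ws)
    qed (auto simp: GL_def L_def GH_def GW_def \<tau>_def \<Phi>_def Wp Ws intro!: continuous_intros)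
  qed
  have 3: "subequivalence (gerbe (\<lambda>k k'. chi (snd k) (snd k')) L) (gerbe (\<lambda>a b. chi (0, a) (0, b)) \<H>) E1
      (gerbe (\<lambda>k k'. chi (snd (snd k)) (snd (snd k'))) GL) (gerbe (\<lambda>k k'. chi k k') GH) E2"
    unfolding subequivalence_def bimodule_iso_def
  proof (intro conjI)
    show "groupoid_iso (gerbe (\<lambda>k k'. chi (snd k) (snd k')) L)
        ((gerbe (\<lambda>k k'. chi (snd (snd k)) (snd (snd k'))) GL)\<lparr>arr := {(\<theta>, g, a). (\<theta>, g, a) \<in>
          arr (gerbe (\<lambda>k k'. chi (snd (snd k)) (snd (snd k'))) GL) \<and> g = 0}\<rparr>) (\<lambda>(\<theta>, a). (\<theta>, 0, a)) id"
      unfolding GL_def by (rule L.gerbe_slice_iso) simp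
    show "groupoid_iso (gerbe (\<lambda>a b. chi (0, a) (0, b)) \<H>)
        ((gerbe (\<lambda>k k'. chi k k') GH)\<lparr>arr := {(\<theta>, g, b). (\<theta>, g, b) \<in>
          arr (gerbe (\<lambda>k k'. chi k k') GH) \<and> g = 0}\<rparr>) (\<lambda>(\<theta>, b). (\<theta>, 0, b)) id"
      unfolding GH_def by (rule H.gerbe_slice_iso) simp
    show "homeomorphic_map (top_of_set (pts E1))
        (top_of_set (pts (E2\<lparr>pts := {(\<theta>, g, p). (\<theta>, g, p) \<in> pts E2 \<and> g = 0}\<rparr>))) (\<lambda>(\<theta>, p). (\<theta>, 0, p))"
      using slice_homeomorphic[of U1 "pts W", where 'g = 'g] by (simp add: E1_def E2_def GW_def)
  qed (auto simp: E1_def E2_def GW_def \<Phi>_def lpairs_def rpairs_def Wp)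
  have c: "(\<lambda>(_, k) (_, k'). chi k k') = (\<lambda>k k'. chi (snd k) (snd k'))"
    "(\<lambda>(_, _, k) (_, _, k'). chi k k') = (\<lambda>k k'. chi (snd (snd k)) (snd (snd k')))"
    by (auto simp: fun_eq_iff)
  show ?thesis
    unfolding Let_def c
    using GgL equi 1 2 3 unfolding GH_def[symmetric] L_def[symmetric] \<tau>_def[symmetric] GL_def[symmetric]
      W_def[symmetric] GW_def[symmetric] by blast
qed

end
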